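(* Let $s\ge\frac12$ (respectively $s>\frac12$) be a real number. Then the following is true: (1) If $a\in\widetilde A(\mathbf C^d\times\mathbf C^d)$ satisfies $$|a(z,w)|\lesssim e^{\frac12|z-w|^2-r(|z|^{1/s}+|w|^{1/s})},\qquad z,w\in\mathbf C^d,$$ for some (respectively for every) $r>0$, then $\operatorname{Op}_{\mathfrak V}(a)$ from $\mathcal A_0(\mathbf C^d)$ to $\mathcal A_0'(\mathbf C^d)$ is uniquely extendable to a linear and continuous map from $\mathcal A_s'(\mathbf C^d)$ to $\mathcal A_s(\mathbf C^d)$ (respectively from $\mathcal A_{0,s}'(\mathbf C^d)$ to $\mathcal A_{0,s}(\mathbf C^d)$). (2) If $a\in\widetilde A(\mathbf C^d\times\mathbf C^d)$ satisfies $$|a(z,w)|\lesssim e^{\frac12|z-w|^2+r(|z|^{1/s}+|w|^{1/s})},\qquad z,w\in\mathbf C^d,$$ for every (respectively for some) $r>0$, then $\operatorname{Op}_{\mathfrak V}(a)$ from $\mathcal A_0(\mathbf C^d)$ to $\mathcal A_0'(\mathbf C^d)$ is uniquely extendable to a linear and continuous map from $\mathcal A_s(\mathbf C^d)$ to $\mathcal A_s'(\mathbf C^d)$ (respectively from $\mathcal A_{0,s}(\mathbf C^d)$ to $\mathcal A_{0,s}'(\mathbf C^d)$).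
   Context: $f\lesssim g$ means $f\le Cg$ for some constant $C>0$ (which may depend on $r$). For real $s>0$, $r>0$ and $\alpha\in\mathbf N^d$ let $\vartheta_{r,s}(\alpha)=e^{r|\alpha|^{1/(2s)}}$, and let $\ell^p_{[\vartheta]}(\mathbf N^d)$ be the Banach space of complex sequences $c$ with $\|c\,\vartheta\|_{\ell^p}<\infty$; fix any $p\in[1,\infty]$ (the spaces below do not depend on it). With $e_\alpha(z)=z^\alpha/\sqrt{\alpha!}$, the spaces $\mathcal A_{0,s}(\mathbf C^d)$, $\mathcal A_s(\mathbf C^d)$, $\mathcal A_s'(\mathbf C^d)$, $\mathcal A_{0,s}'(\mathbf C^d)$ consist of all power series $F=\sum_\alpha c(F,\alpha)e_\alpha$ whose coefficient sequences belong respectively to $\bigcap_{r>0}\ell^p_{[\vartheta_{r,s}]}$ (projective limit topology), $\bigcup_{r>0}\ell^p_{[\vartheta_{r,s}]}$ (inductive limit topology), $\bigcap_{r>0}\ell^p_{[1/\vartheta_{r,s}]}$ (projective limit topology), $\bigcup_{r>0}\ell^p_{[1/\vartheta_{r,s}]}$ (inductive limit topology); the topologies are transported from the sequence spaces. $\mathcal A_0(\mathbf C^d)$ is the space of polynomials (finitely many nonzero coefficients, with the inductive limit topology over $N$ of the polynomials of degree at most $N$), and $\mathcal A_0'(\mathbf C^d)$ is the space of all formal power series (topology of convergence of each coefficient). $\widetilde A(\mathbf C^d\times\mathbf C^d)$ is the set of all functions $a$ such that $(z,w)\mapsto a(z,\overline w)$ is entire on $\mathbf C^{2d}$. $\operatorname{Op}_{\mathfrak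 V}(a)$ is the analytic pseudo-differential operator $(\operatorname{Op}_{\mathfrak V}(a)F)(z)=\int_{\mathbf C^d}a(z,w)F(w)e^{(z,w)}\,d\mu(w)$, where $(z,w)=\sum_jz_j\overline{w_j}$, $d\mu(w)=\pi^{-d}e^{-|w|^2}d\lambda(w)$ and $d\lambda$ is Lebesgue measure; equivalently, writing $K(z,w)=e^{(z,w)}a(z,w)=\sum_{\alpha,\beta}c_K(\alpha,\beta)e_\alpha(z)e_\beta(\overline w)$, one has $\operatorname{Op}_{\mathfrak V}(a)F=\sum_\alpha\big(\sum_\beta c_K(\alpha,\beta)c(F,\beta)\big)e_\alpha$ for $F\in\mathcal A_0(\mathbf C^d)$. *)

theory Defs
  imports "HOL-Analysis.Analysis"
begin

section \<open>Multi-indices and formal power series\<close>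

definition mabs :: "nat ^ 'd \<Rightarrow> nat" where
  "mabs \<alpha> = (\<Sum>i\<in>UNIV. \<alpha> $ i)"

definition mfact :: "nat ^ 'd \<Rightarrow> nat" where
  "mfact \<alpha> = (\<Prod>i\<in>UNIV. fact (\<alpha> $ i))"

definition e_basis :: "nat ^ 'd \<Rightarrow> complex ^ 'd \<Rightarrow> complex" where
  "e_basis \<alpha> z = (\<Prod>i\<in>UNIV. (z $ i) ^ (\<alpha> $ i)) / of_real (sqrt (real (mfact \<alpha>)))"

text \<open>
  A formal power series F = \<open>\<Sum>\<^sub>\<alpha> c(F,\<alpha>) e\<^sub>\<alpha>\<close> is represented by its coefficient sequence
  \<open>c(F,\<cdot>)\<close> with respect to the normalised monomials \<^term>\<open>e_basis\<close>. Under this identification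
  the space of all formal power series is the whole type, and the topologies transported from
  sequence spaces are the topologies of the sequence spaces themselves.
\<close>

type_synonym 'd fseries = "nat ^ 'd \<Rightarrow> complex"

text \<open>\<open>F\<close> converges unconditionally on all of \<open>\<complex>\<^sup>d\<close> to the function \<open>f\<close>.\<close>

definition is_series_of :: "'d fseries \<Rightarrow> (complex ^ 'd \<Rightarrow> complex) \<Rightarrow> bool" where
  "is_series_of F f \<longleftrightarrow> (\<forall>z. ((\<lambda>\<alpha>. F \<alpha> * e_basis \<alpha> z) has_sum f z) UNIV)"

definition series_fun :: "'d fseries \<Rightarrow> complex ^ 'd \<Rightarrow> complex" where
  "series_fun F z = (\<Sum>\<^sub>\<infinity>\<alpha>. F \<alpha> * e_basis \<alpha> z)"

definition A_zero :: "('d::finite) fseries set" where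
  "A_zero = {F. finite {\<alpha>. F \<alpha> \<noteq> 0}}"


section \<open>Weighted sequence spaces\<close>

definition lp_space :: "ereal \<Rightarrow> ('i \<Rightarrow> complex) set" where
  "lp_space p = {c. if p = \<infinity> then bounded (range c)
                    else (\<lambda>i. cmod (c i) powr real_of_ereal p) summable_on UNIV}"

text \<open>The value outside \<^term>\<open>lp_space p\<close> is a dummy: the library's metric spaces want distances
  that are nonnegative on the whole type, while a supremum over an unbounded set is unspecified.\<close>

definition lp_norm :: "ereal \<Rightarrow> ('i \<Rightarrow> complex) \<Rightarrow> real" where
  "lp_norm p c = (if c \<notin> lp_space p then 0
     else if p = \<infinity> then (SUP i. cmod (c i))
     else (\<Sum>\<^sub>\<infinity>i. cmod (c i) powr real_of_ereal p) powr (1 / real_of_ereal p))"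

definition weighted_lp :: "ereal \<Rightarrow> ('i \<Rightarrow> real) \<Rightarrow> ('i \<Rightarrow> complex) set" where
  "weighted_lp p \<theta> = {c. (\<lambda>i. c i * of_real (\<theta> i)) \<in> lp_space p}"

definition weighted_lp_dist ::
    "ereal \<Rightarrow> ('i \<Rightarrow> real) \<Rightarrow> ('i \<Rightarrow> complex) \<Rightarrow> ('i \<Rightarrow> complex) \<Rightarrow> real" where
  "weighted_lp_dist p \<theta> c c' = lp_norm p (\<lambda>i. (c i - c' i) * of_real (\<theta> i))"

definition weighted_lp_topology :: "ereal \<Rightarrow> ('i \<Rightarrow> real) \<Rightarrow> ('i \<Rightarrow> complex) topology" where
  "weighted_lp_topology p \<theta> =
     Metric_space.mtopology (weighted_lp p \<theta>) (weighted_lp_dist p \<theta>)"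

definition vartheta :: "real \<Rightarrow> real \<Rightarrow> nat ^ 'd \<Rightarrow> real" where
  "vartheta r s \<alpha> = exp (r * real (mabs \<alpha>) powr (1 / (2 * s)))"


section \<open>Projective and inductive limits of topological spaces of sequences\<close>

text \<open>The coarsest topology on the intersection for which all inclusions are continuous.\<close>

definition projective_limit_topology :: "'r set \<Rightarrow> ('r \<Rightarrow> 'a topology) \<Rightarrow> 'a topology" where
  "projective_limit_topology R T = topology_generated_by
     {U \<inter> (\<Inter>r\<in>R. topspace (T r)) | U r. r \<in> R \<and> openin (T r) U}"

definition absolutely_convex :: "('i \<Rightarrow> complex) set \<Rightarrow> bool" where
  "absolutely_convex V \<longleftrightarrow>
     (\<forall>x\<in>V. \<forall>y\<in>V. \<forall>a b :: complex. cmod a + cmod b \<le> 1 \<longrightarrow> (\<lambda>i. a * x i + b * y i) \<in> V)"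

text \<open>
  The inductive limit is taken in the category of locally convex spaces: the finest locally convex
  topology on the union for which all inclusions are continuous. A base of neighbourhoods of 0
  consists of the absolutely convex sets whose trace on each step is a neighbourhood of 0 there.
\<close>

definition inductive_limit_nhd0 :: "'r set \<Rightarrow> ('r \<Rightarrow> ('i \<Rightarrow> complex) topology) \<Rightarrow>
    ('i \<Rightarrow> complex) set \<Rightarrow> bool" where
  "inductive_limit_nhd0 R T V \<longleftrightarrow>
     V \<subseteq> (\<Union>r\<in>R. topspace (T r)) \<and> absolutely_convex V \<and>
     (\<forall>r\<in>R. \<exists>W. openin (T r) W \<and> (\<lambda>i. 0) \<in> W \<and> W \<subseteq> V)"

definition inductive_limit_topology :: "'r set \<Rightarrow> ('r \<Rightarrow> ('i \<Rightarrow> complex) topology) \<Rightarrow>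
    ('i \<Rightarrow> complex) topology" where
  "inductive_limit_topology R T = topology (\<lambda>U.
     U \<subseteq> (\<Union>r\<in>R. topspace (T r)) \<and>
     (\<forall>x\<in>U. \<exists>V. inductive_limit_nhd0 R T V \<and> (\<forall>y\<in>V. (\<lambda>i. x i + y i) \<in> U)))"


section \<open>The spaces of power series, as topological spaces\<close>

text \<open>The carriers are the \<^const>\<open>topspace\<close>s: the intersection, respectively union, over all
  \<open>r > 0\<close> of the weighted \<open>\<ell>\<^sup>p\<close> spaces.\<close>

definition A_0s :: "ereal \<Rightarrow> real \<Rightarrow> ('d::finite) fseries topology" where
  "A_0s p s = projective_limit_topology {0<..} (\<lambda>r. weighted_lp_topology p (vartheta r s))"

definition A_s :: "ereal \<Rightarrow> real \<Rightarrow> ('d::finite) fseries topology" where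
  "A_s p s = inductive_limit_topology {0<..} (\<lambda>r. weighted_lp_topology p (vartheta r s))"

definition A_s_dual :: "ereal \<Rightarrow> real \<Rightarrow> ('d::finite) fseries topology" where
  "A_s_dual p s =
     projective_limit_topology {0<..} (\<lambda>r. weighted_lp_topology p (\<lambda>\<alpha>. 1 / vartheta r s \<alpha>))"

definition A_0s_dual :: "ereal \<Rightarrow> real \<Rightarrow> ('d::finite) fseries topology" where
  "A_0s_dual p s =
     inductive_limit_topology {0<..} (\<lambda>r. weighted_lp_topology p (\<lambda>\<alpha>. 1 / vartheta r s \<alpha>))"


section \<open>The carriers\<close>

lemma powr_convex_nonneg:
  fixes q t x y :: real
  assumes q: "1 \<le> q" and t: "0 \<le> t" "t \<le> 1" and "0 \<le> x" "0 \<le> y"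
  shows "((1 - t) * x + t * y) powr q \<le> (1 - t) * x powr q + t * y powr q"
proof -
  have small: "u powr q \<le> u" if "0 \<le> u" "u \<le> 1" for u :: real
    using powr_mono'[of 1 q u] that q by simp
  consider "x > 0" "y > 0" | "x = 0" | "y = 0" using assms by force
  then show ?thesis
  proof cases
    case 1
    with convex_onD[OF powr_convex[OF q] t, of x y] show ?thesis by simp
  next
    case 2
    with small[OF t] assms show ?thesis
      by (simp add: powr_mult mult_right_mono)
  next
    case 3
    with small[of "1 - t"] assms show ?thesis
      by (simp add: powr_mult mult_right_mono)
  qed
qed

lemma lp_minkowski:
  assumes p: "1 \<le> p" and c: "c \<in> lp_space p" and d: "d \<in> lp_space p"
  shows "(\<lambda>i. c i + d i) \<in> lp_space p \<and> lp_norm p (\<lambda>i. c i + d i) \<le> lp_norm p c + lp_norm p d"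
proof (cases "p = \<infinity>")
  case True
  have bc: "bdd_above (range (\<lambda>i. cmod (c i)))" "bdd_above (range (\<lambda>i. cmod (d i)))"
    using c d True by (auto simp: lp_space_def bounded_iff bdd_above_def)
  have le: "cmod (c i + d i) \<le> (SUP i. cmod (c i)) + (SUP i. cmod (d i))" for i
    by (rule order_trans[OF norm_triangle_ineq add_mono])
       (auto intro: cSUP_upper bc)
  then have "(\<lambda>i. c i + d i) \<in> lp_space p" using True by (auto simp: lp_space_def bounded_iff)
  then show ?thesis using True c d le by (auto simp: lp_norm_def intro: cSUP_least)
next
  case False
  define q where "q = real_of_ereal p"
  have q: "1 \<le> q" using p False by (cases p) (auto simp: q_def one_ereal_def)
  define S where "S c = (\<Sum>\<^sub>\<infinity>i. cmod (c i) powr q)" for c :: "'a \<Rightarrow> complex"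
  have sp: "c \<in> lp_space p \<longleftrightarrow> (\<lambda>i. cmod (c i) powr q) summable_on UNIV" for c :: "'a \<Rightarrow> complex"
    using False by (simp add: lp_space_def q_def)
  have nm: "lp_norm p c = S c powr (1/q)" if "c \<in> lp_space p" for c :: "'a \<Rightarrow> complex"
    using False that by (simp add: lp_norm_def q_def S_def)
  have S0: "S c \<ge> 0" for c :: "'a \<Rightarrow> complex"
    unfolding S_def by (rule infsum_nonneg) simp
  have nmq: "lp_norm p c powr q = S c" if "c \<in> lp_space p" for c :: "'a \<Rightarrow> complex"
    using q S0[of c] that by (simp add: nm powr_powr)
  have nm0: "lp_norm p c \<ge> 0" if "c \<in> lp_space p" for c :: "'a \<Rightarrow> complex"
    using that by (simp add: nm)
  have zero: "c = (\<lambda>i. 0)" if "c \<in> lp_space p" "lp_norm p c = 0" for c :: "'a \<Rightarrow> complex"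
  proof -
    have "S c = 0" using that nmq[OF that(1)] q by simp
    then have "cmod (c i) powr q = 0" for i
      using that(1) unfolding sp S_def
      by (intro nonneg_infsum_le_0D[where A = UNIV and f = "\<lambda>i. cmod (c i) powr q"]) auto
    then show ?thesis by auto
  qed
  let ?A = "lp_norm p c" and ?B = "lp_norm p d"
  consider "?A = 0" | "?B = 0" | "?A > 0" "?B > 0" using nm0[OF c] nm0[OF d] by force
  then show ?thesis
  proof cases
    case 1
    then show ?thesis using zero[OF c 1] d nm0[OF c] by simp
  next
    case 2
    then show ?thesis using zero[OF d 2] c nm0[OF d] by simp
  next
    case 3
    define t where "t = ?B / (?A + ?B)"
    have t: "0 \<le> t" "t \<le> 1" and t': "1 - t = ?A / (?A + ?B)"
      using 3 by (auto simp: t_def field_simps)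
    define f where "f i = (?A + ?B) powr q *
      ((1 - t) / ?A powr q * cmod (c i) powr q + t / ?B powr q * cmod (d i) powr q)" for i
    have le: "cmod (c i + d i) powr q \<le> f i" for i
    proof -
      have eq: "(?A + ?B) * ((1 - t) * (cmod (c i) / ?A) + t * (cmod (d i) / ?B))
          = cmod (c i) + cmod (d i)"
      proof -
        have "(1 - t) * (cmod (c i) / ?A) = cmod (c i) / (?A + ?B)"
          "t * (cmod (d i) / ?B) = cmod (d i) / (?A + ?B)"
          unfolding t' using 3 by (simp_all add: t_def)
        then show ?thesis using 3 by (simp flip: add_divide_distrib)
      qed
      have "cmod (c i + d i) powr q \<le> (cmod (c i) + cmod (d i)) powr q"
        using q by (intro powr_mono2) (auto intro: norm_triangle_ineq)
      also have "\<dots> = ((?A + ?B) * ((1 - t) * (cmod (c i) / ?A) + t * (cmod (d i) / ?B))) powr q"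
        by (simp only: eq)
      also have "\<dots> = (?A + ?B) powr q * ((1 - t) * (cmod (c i) / ?A) + t * (cmod (d i) / ?B)) powr q"
        by (rule powr_mult)
      also have "\<dots> \<le> (?A + ?B) powr q *
          ((1 - t) * (cmod (c i) / ?A) powr q + t * (cmod (d i) / ?B) powr q)"
        using powr_convex_nonneg[OF q t, of "cmod (c i) / ?A" "cmod (d i) / ?B"] 3
        by (intro mult_left_mono) auto
      also have "\<dots> = f i"
        using 3 by (simp add: f_def powr_divide)
      finally show ?thesis .
    qed
    have sc: "(\<lambda>i. cmod (c i) powr q) summable_on UNIV" "(\<lambda>i. cmod (d i) powr q) summable_on UNIV"
      using c d sp by auto
    have sc': "((\<lambda>i. cmod (c i) powr q) has_sum S c) UNIV" "((\<lambda>i. cmod (d i) powr q) has_sum S d) UNIV"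
      using sc unfolding S_def by (simp_all add: has_sum_infsum)
    have "(f has_sum (?A + ?B) powr q * ((1 - t) / ?A powr q * S c + t / ?B powr q * S d)) UNIV"
      unfolding f_def by (intro has_sum_cmult_right has_sum_add sc')
    then have fs: "(f has_sum (?A + ?B) powr q) UNIV"
      using 3 by (simp flip: nmq[OF c] nmq[OF d])
    have sm: "(\<lambda>i. cmod (c i + d i) powr q) summable_on UNIV"
      by (rule summable_on_comparison_test[of f]) (use fs le in \<open>auto simp: summable_on_def\<close>)
    have "S (\<lambda>i. c i + d i) \<le> (?A + ?B) powr q"
      unfolding S_def by (rule has_sum_mono[OF has_sum_infsum[OF sm] fs]) (use le in auto)
    then have "lp_norm p (\<lambda>i. c i + d i) \<le> ((?A + ?B) powr q) powr (1/q)"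
      unfolding nm[OF iffD2[OF sp sm]] using q S0 by (intro powr_mono2) auto
    also have "\<dots> = ?A + ?B" using 3 q by (simp add: powr_powr)
    finally show ?thesis using sm sp by auto
  qed
qed

lemma lp_norm_nonneg: "lp_norm p c \<ge> 0"
proof (cases "p = \<infinity> \<and> c \<in> lp_space p")
  case True
  then have "bdd_above (range (\<lambda>i. cmod (c i)))"
    by (auto simp: lp_space_def bounded_iff bdd_above_def)
  then have "cmod (c undefined) \<le> (SUP i. cmod (c i))" by (rule cSUP_upper[OF UNIV_I])
  then show ?thesis using True by (simp add: lp_norm_def order_trans[OF norm_ge_zero])
qed (auto simp: lp_norm_def)

lemma lp_norm_eq_0:
  assumes p: "1 \<le> p" and c: "c \<in> lp_space p" and z: "lp_norm p c = 0"
  shows "c i = 0"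
proof (cases "p = \<infinity>")
  case True
  then have "bdd_above (range (\<lambda>i. cmod (c i)))"
    using c by (auto simp: lp_space_def bounded_iff bdd_above_def)
  then have "cmod (c i) \<le> (SUP i. cmod (c i))" by (rule cSUP_upper[OF UNIV_I])
  then show ?thesis using True z c by (simp add: lp_norm_def)
next
  case False
  then have "(\<Sum>\<^sub>\<infinity>i. cmod (c i) powr real_of_ereal p) = 0"
    using z c by (auto simp: lp_norm_def)
  then have "cmod (c i) powr real_of_ereal p = 0"
    using c False unfolding lp_space_def
    by (intro nonneg_infsum_le_0D[where A = UNIV and f = "\<lambda>i. cmod (c i) powr real_of_ereal p"]) auto
  then show ?thesis by simp
qed

lemma lp_space_uminus: "(\<lambda>i. - c i) \<in> lp_space p \<longleftrightarrow> c \<in> lp_space p"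
  and lp_norm_uminus: "lp_norm p (\<lambda>i. - c i) = lp_norm p c"
  by (simp_all add: lp_space_def lp_norm_def bounded_iff)

lemma lp_space_0: "1 \<le> p \<Longrightarrow> (\<lambda>i. 0) \<in> lp_space p"
  and lp_norm_0: "1 \<le> p \<Longrightarrow> lp_norm p (\<lambda>i. 0) = 0"
  by (auto simp: lp_space_def lp_norm_def bounded_iff)

text \<open>Hence \<^const>\<open>weighted_lp_topology\<close> is a genuine metric topology, with carrier
  \<^const>\<open>weighted_lp\<close>.\<close>

lemma Metric_space_weighted_lp:
  assumes p: "1 \<le> p" and \<theta>: "\<And>i. \<theta> i \<noteq> 0"
  shows "Metric_space (weighted_lp p \<theta>) (weighted_lp_dist p \<theta>)"
proof -
  define m where "m c i = c i * complex_of_real (\<theta> i)" for c i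
  define dd where "dd c c' i = m c i - m c' i" for c c' i
  have W: "c \<in> weighted_lp p \<theta> \<longleftrightarrow> m c \<in> lp_space p" for c
    by (simp add: weighted_lp_def m_def[abs_def])
  have D: "weighted_lp_dist p \<theta> c c' = lp_norm p (dd c c')" for c c'
    by (simp add: weighted_lp_dist_def dd_def[abs_def] m_def[abs_def] left_diff_distrib)
  have dW: "dd c c' \<in> lp_space p" if "m c \<in> lp_space p" "m c' \<in> lp_space p" for c c'
    using lp_minkowski[OF p that(1), of "\<lambda>i. - m c' i"] that(2)
    by (simp add: lp_space_uminus dd_def[abs_def])
  have sym: "lp_norm p (dd c c') = lp_norm p (dd c' c)" for c c'
    using lp_norm_uminus[of p "dd c c'"] by (simp add: dd_def[abs_def])
  show ?thesis
  proof (unfold_locales, goal_cases)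
    case (2 x y)
    show ?case unfolding D by (rule sym)
  next
    case (1 x y)
    show ?case unfolding D by (rule lp_norm_nonneg)
  next
    case (3 x y)
    have "dd x y = (\<lambda>i. 0)" if "lp_norm p (dd x y) = 0"
      using lp_norm_eq_0[OF p dW that] 3 by (auto simp: W)
    moreover have "x = y" if "dd x y = (\<lambda>i. 0)"
      using that \<theta> by (auto simp: dd_def[abs_def] m_def fun_eq_iff)
    moreover have "dd x x = (\<lambda>i. 0)" by (simp add: dd_def[abs_def])
    ultimately show ?case unfolding D using lp_norm_0[OF p] by auto
  next
    case (4 x y z)
    then have "dd x y \<in> lp_space p" "dd y z \<in> lp_space p" by (auto simp: W intro: dW)
    from lp_minkowski[OF p this] show ?case unfolding D by (simp add: dd_def[abs_def])
  qed
qed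

lemma topspace_weighted_lp_topology:
  assumes "1 \<le> p" and "\<And>i. \<theta> i \<noteq> 0"
  shows "topspace (weighted_lp_topology p \<theta>) = weighted_lp p \<theta>"
  unfolding weighted_lp_topology_def
  by (rule Metric_space.topspace_mtopology[OF Metric_space_weighted_lp]) (use assms in auto)

lemma topspace_projective_limit_topology:
  assumes "R \<noteq> {}"
  shows "topspace (projective_limit_topology R T) = (\<Inter>r\<in>R. topspace (T r))"
  unfolding projective_limit_topology_def topology_generated_by_topspace
  using assms by (auto dest: openin_subset)

lemma inductive_limit_nhd0_Int:
  assumes "inductive_limit_nhd0 R T V" "inductive_limit_nhd0 R T V'"
  shows "inductive_limit_nhd0 R T (V \<inter> V')"
  unfolding inductive_limit_nhd0_def
proof (intro conjI ballI)
  show "V \<inter> V' \<subseteq> (\<Union>r\<in>R. topspace (T r))" "absolutely_convex (V \<inter> V')"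
    using assms by (auto simp: inductive_limit_nhd0_def absolutely_convex_def)
  fix r assume "r \<in> R"
  then obtain W W' where "openin (T r) W" "(\<lambda>i. 0) \<in> W" "W \<subseteq> V"
      "openin (T r) W'" "(\<lambda>i. 0) \<in> W'" "W' \<subseteq> V'"
    using assms unfolding inductive_limit_nhd0_def by meson
  then show "\<exists>W. openin (T r) W \<and> (\<lambda>i. 0) \<in> W \<and> W \<subseteq> V \<inter> V'"
    by (intro exI[of _ "W \<inter> W'"]) auto
qed

lemma openin_inductive_limit_topology:
  "openin (inductive_limit_topology R T) U \<longleftrightarrow>
     U \<subseteq> (\<Union>r\<in>R. topspace (T r)) \<and>
     (\<forall>x\<in>U. \<exists>V. inductive_limit_nhd0 R T V \<and> (\<forall>y\<in>V. (\<lambda>i. x i + y i) \<in> U))"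
proof -
  have "istopology (\<lambda>U. U \<subseteq> (\<Union>r\<in>R. topspace (T r)) \<and>
     (\<forall>x\<in>U. \<exists>V. inductive_limit_nhd0 R T V \<and> (\<forall>y\<in>V. (\<lambda>i. x i + y i) \<in> U)))"
    (is "istopology ?P")
    unfolding istopology_def
  proof (intro conjI allI impI)
    fix S S' assume S: "?P S" and S': "?P S'"
    have sub: "S \<inter> S' \<subseteq> (\<Union>r\<in>R. topspace (T r))" using S by blast
    have "\<exists>V. inductive_limit_nhd0 R T V \<and> (\<forall>y\<in>V. (\<lambda>i. x i + y i) \<in> S \<inter> S')"
      if x: "x \<in> S" "x \<in> S'" for x
    proof -
      obtain V where V: "inductive_limit_nhd0 R T V" "\<forall>y\<in>V. (\<lambda>i. x i + y i) \<in> S"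
        using S x by blast
      obtain V' where V': "inductive_limit_nhd0 R T V'" "\<forall>y\<in>V'. (\<lambda>i. x i + y i) \<in> S'"
        using S' x by blast
      show ?thesis
        using V V' by (intro exI[of _ "V \<inter> V'"]) (auto intro: inductive_limit_nhd0_Int)
    qed
    then show "S \<inter> S' \<subseteq> (\<Union>r\<in>R. topspace (T r))"
      and "\<forall>x\<in>S \<inter> S'. \<exists>V. inductive_limit_nhd0 R T V \<and> (\<forall>y\<in>V. (\<lambda>i. x i + y i) \<in> S \<inter> S')"
      using sub by blast+
  next
    fix K assume K: "\<forall>S\<in>K. ?P S"
    show "\<Union>K \<subseteq> (\<Union>r\<in>R. topspace (T r))" using K by blast
    show "\<forall>x\<in>\<Union>K. \<exists>V. inductive_limit_nhd0 R T V \<and> (\<forall>y\<in>V. (\<lambda>i. x i + y i) \<in> \<Union>K)"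
    proof
      fix x assume "x \<in> \<Union>K"
      then obtain S where "S \<in> K" "x \<in> S" by blast
      with K obtain V where "inductive_limit_nhd0 R T V" "\<forall>y\<in>V. (\<lambda>i. x i + y i) \<in> S" by blast
      with \<open>S \<in> K\<close> show "\<exists>V. inductive_limit_nhd0 R T V \<and> (\<forall>y\<in>V. (\<lambda>i. x i + y i) \<in> \<Union>K)"
        by blast
    qed
  qed
  then show ?thesis
    by (simp add: inductive_limit_topology_def topology_inverse')
qed

lemma weighted_lp_lincomb:
  assumes p: "1 \<le> p" and "x \<in> weighted_lp p \<theta>" "y \<in> weighted_lp p \<theta>"
  shows "(\<lambda>i. a * x i + b * y i) \<in> weighted_lp p \<theta>"
proof -
  have scale: "(\<lambda>i. a * c i) \<in> lp_space p" if c: "c \<in> lp_space p" for a :: complex and c :: "'a \<Rightarrow> complex"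
  proof (cases "p = \<infinity>")
    case True
    then obtain B where "\<And>i. cmod (c i) \<le> B" using c by (auto simp: lp_space_def bounded_iff)
    then have "cmod (a * c i) \<le> cmod a * B" for i by (simp add: norm_mult mult_left_mono)
    then show ?thesis using True by (auto simp: lp_space_def bounded_iff)
  next
    case False
    then show ?thesis using c
      by (auto simp: lp_space_def norm_mult powr_mult intro!: summable_on_cmult_right)
  qed
  show ?thesis
    using lp_minkowski[OF p scale[of "\<lambda>i. x i * of_real (\<theta> i)" a] scale[of "\<lambda>i. y i * of_real (\<theta> i)" b]]
      assms by (simp add: weighted_lp_def algebra_simps)
qed

lemma weighted_lp_antimono:
  assumes p: "1 \<le> p" and le: "\<And>i. 0 \<le> \<theta> i \<and> \<theta> i \<le> \<theta>' i"
  shows "weighted_lp p \<theta>' \<subseteq> weighted_lp p \<theta>"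
proof
  fix c assume c: "c \<in> weighted_lp p \<theta>'"
  have le': "cmod (c i * of_real (\<theta> i)) \<le> cmod (c i * of_real (\<theta>' i))" for i
    using le[of i] by (simp add: norm_mult mult_left_mono)
  show "c \<in> weighted_lp p \<theta>"
  proof (cases "p = \<infinity>")
    case True
    then obtain B where "\<And>i. cmod (c i * of_real (\<theta>' i)) \<le> B"
      using c by (auto simp: weighted_lp_def lp_space_def bounded_iff)
    then have "cmod (c i * of_real (\<theta> i)) \<le> B" for i
      using le'[of i] order_trans by blast
    then have "bounded (range (\<lambda>i. c i * complex_of_real (\<theta> i)))"
      unfolding bounded_iff by blast
    then show ?thesis using True by (simp add: weighted_lp_def lp_space_def)
  next
    case False
    have "0 \<le> real_of_ereal p" using p by (cases p) (auto simp: one_ereal_def)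
    with c False show ?thesis unfolding weighted_lp_def lp_space_def
      by (auto intro!: summable_on_comparison_test[where
            f = "\<lambda>i. cmod (c i * of_real (\<theta>' i)) powr real_of_ereal p"] powr_mono2 le')
  qed
qed

lemma topspace_inductive_limit_weighted_lp:
  assumes p: "1 \<le> p" and pos: "\<And>r i. 0 < \<theta> r i"
    and directed: "\<And>r r'. r \<in> R \<Longrightarrow> r' \<in> R \<Longrightarrow> \<exists>t\<in>R. \<forall>i. \<theta> t i \<le> \<theta> r i \<and> \<theta> t i \<le> \<theta> r' i"
  shows "topspace (inductive_limit_topology R (\<lambda>r. weighted_lp_topology p (\<theta> r)))
    = (\<Union>r\<in>R. weighted_lp p (\<theta> r))" (is "topspace ?L = ?X")
proof -
  have ts: "topspace (weighted_lp_topology p (\<theta> r)) = weighted_lp p (\<theta> r)" for r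
    by (rule topspace_weighted_lp_topology[OF p]) (use pos in \<open>auto simp: less_le\<close>)
  have lin: "(\<lambda>i. a * x i + b * y i) \<in> ?X" if xy: "x \<in> ?X" "y \<in> ?X" for x y a b
  proof -
    obtain r r' where r: "r \<in> R" "x \<in> weighted_lp p (\<theta> r)" and r': "r' \<in> R" "y \<in> weighted_lp p (\<theta> r')"
      using xy by blast
    obtain t where t: "t \<in> R" "\<forall>i. \<theta> t i \<le> \<theta> r i \<and> \<theta> t i \<le> \<theta> r' i"
      using directed[OF r(1) r'(1)] by blast
    have "x \<in> weighted_lp p (\<theta> t)" "y \<in> weighted_lp p (\<theta> t)"
      using weighted_lp_antimono[OF p, of "\<theta> t" "\<theta> r"] weighted_lp_antimono[OF p, of "\<theta> t" "\<theta> r'"]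
        r r' t pos less_imp_le by blast+
    then show ?thesis using weighted_lp_lincomb[OF p] t(1) by blast
  qed
  have "inductive_limit_nhd0 R (\<lambda>r. weighted_lp_topology p (\<theta> r)) ?X"
    unfolding inductive_limit_nhd0_def ts
  proof (intro conjI ballI)
    show "absolutely_convex ?X" unfolding absolutely_convex_def using lin by blast
    fix r assume "r \<in> R"
    then show "\<exists>W. openin (weighted_lp_topology p (\<theta> r)) W \<and> (\<lambda>i. 0) \<in> W \<and> W \<subseteq> ?X"
      using lp_space_0[OF p] ts openin_topspace[of "weighted_lp_topology p (\<theta> r)"]
      by (intro exI[of _ "weighted_lp p (\<theta> r)"]) (auto simp: weighted_lp_def)
  qed simp
  moreover have "(\<lambda>i. x i + y i) \<in> ?X" if "x \<in> ?X" "y \<in> ?X" for x y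
    using lin[OF that, of 1 1] by simp
  ultimately have "openin ?L ?X"
    unfolding openin_inductive_limit_topology ts by blast
  then have "?X \<subseteq> topspace ?L" by (rule openin_subset)
  moreover have "topspace ?L \<subseteq> ?X"
    using openin_topspace[of ?L] unfolding openin_inductive_limit_topology ts by (rule conjunct1)
  ultimately show ?thesis by (rule subset_antisym[rotated])
qed

lemma vartheta_pos: "0 < vartheta r s \<alpha>"
  by (simp add: vartheta_def)

lemma vartheta_mono: "r \<le> r' \<Longrightarrow> vartheta r s \<alpha> \<le> vartheta r' s \<alpha>"
  by (simp add: vartheta_def mult_right_mono)

theorem carriers:
  fixes s :: real and p :: ereal
  assumes p: "1 \<le> p"
  shows "topspace (A_0s p s :: ('d::finite) fseries topology) = (\<Inter>r\<in>{0<..}. weighted_lp p (vartheta r s))"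
    and "topspace (A_s p s :: 'd fseries topology) = (\<Union>r\<in>{0<..}. weighted_lp p (vartheta r s))"
    and "topspace (A_s_dual p s :: 'd fseries topology) = (\<Inter>r\<in>{0<..}. weighted_lp p (\<lambda>\<alpha>. 1 / vartheta r s \<alpha>))"
    and "topspace (A_0s_dual p s :: 'd fseries topology) = (\<Union>r\<in>{0<..}. weighted_lp p (\<lambda>\<alpha>. 1 / vartheta r s \<alpha>))"
proof -
  have ne: "{0::real<..} \<noteq> {}" using gt_ex by auto
  show "topspace (A_0s p s :: 'd fseries topology) = (\<Inter>r\<in>{0<..}. weighted_lp p (vartheta r s))"
    "topspace (A_s_dual p s :: 'd fseries topology) = (\<Inter>r\<in>{0<..}. weighted_lp p (\<lambda>\<alpha>. 1 / vartheta r s \<alpha>))"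
    unfolding A_0s_def A_s_dual_def topspace_projective_limit_topology[OF ne]
    by (simp_all add: topspace_weighted_lp_topology[OF p] vartheta_def)
  show "topspace (A_s p s :: 'd fseries topology) = (\<Union>r\<in>{0<..}. weighted_lp p (vartheta r s))"
    unfolding A_s_def
  proof (rule topspace_inductive_limit_weighted_lp[OF p vartheta_pos])
    fix r r' :: real assume "r \<in> {0<..}" "r' \<in> {0<..}"
    then show "\<exists>t\<in>{0<..}. \<forall>i::nat^'d. vartheta t s i \<le> vartheta r s i \<and> vartheta t s i \<le> vartheta r' s i"
      by (intro bexI[of _ "min r r'"]) (auto intro: vartheta_mono)
  qed
  show "topspace (A_0s_dual p s :: 'd fseries topology) = (\<Union>r\<in>{0<..}. weighted_lp p (\<lambda>\<alpha>. 1 / vartheta r s \<alpha>))"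
    unfolding A_0s_dual_def
  proof (rule topspace_inductive_limit_weighted_lp[OF p])
    fix r r' :: real assume "r \<in> {0<..}" "r' \<in> {0<..}"
    then show "\<exists>t\<in>{0<..}. \<forall>i::nat^'d. 1 / vartheta t s i \<le> 1 / vartheta r s i \<and>
        1 / vartheta t s i \<le> 1 / vartheta r' s i"
      by (intro bexI[of _ "max r r'"]) (auto intro!: divide_left_mono vartheta_mono mult_pos_pos vartheta_pos)
  qed (simp add: vartheta_pos)
qed


section \<open>Analytic pseudo-differential operators\<close>

definition cvec_conj :: "complex ^ 'd \<Rightarrow> complex ^ 'd" where
  "cvec_conj w = (\<chi> i. cnj (w $ i))"

text \<open>Entire means complex (Frechet) differentiable everywhere, i.e. real differentiable with
  complex-linear derivative.\<close>

definition entire2 :: "((complex ^ 'd) \<times> (complex ^ 'd) \<Rightarrow> complex) \<Rightarrow> bool" where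
  "entire2 f \<longleftrightarrow> (\<forall>x. \<exists>D. (f has_derivative D) (at x) \<and>
     (\<forall>k z w. D (k *s z, k *s w) = k * D (z, w)))"

definition A_tilde :: "(complex ^ 'd \<Rightarrow> complex ^ 'd \<Rightarrow> complex) set" where
  "A_tilde = {a. entire2 (\<lambda>(z, w). a z (cvec_conj w))}"

definition sesqui :: "complex ^ 'd \<Rightarrow> complex ^ 'd \<Rightarrow> complex" where
  "sesqui z w = (\<Sum>j\<in>UNIV. z $ j * cnj (w $ j))"

definition gauss_measure :: "(complex ^ 'd) measure" where
  "gauss_measure = density lborel (\<lambda>w. ennreal (exp (- (norm w)\<^sup>2) / pi ^ CARD('d)))"

definition Op_integrand :: "(complex ^ 'd \<Rightarrow> complex ^ 'd \<Rightarrow> complex) \<Rightarrow>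
    (complex ^ 'd \<Rightarrow> complex) \<Rightarrow> complex ^ 'd \<Rightarrow> complex ^ 'd \<Rightarrow> complex" where
  "Op_integrand a f z w = a z w * f w * exp (sesqui z w)"

definition Op_V :: "(complex ^ 'd \<Rightarrow> complex ^ 'd \<Rightarrow> complex) \<Rightarrow>
    (complex ^ 'd \<Rightarrow> complex) \<Rightarrow> complex ^ 'd \<Rightarrow> complex" where
  "Op_V a f z = (LINT w|gauss_measure. Op_integrand a f z w)"

text \<open>The graph of the operator on formal power series: the defining integral for \<open>F\<close> converges
  absolutely for every \<open>z\<close>, and \<open>G\<close> is the power series of the resulting function. The second
  conjunct determines \<open>G\<close> uniquely.\<close>

definition Op_V_maps ::
    "(complex ^ 'd \<Rightarrow> complex ^ 'd \<Rightarrow> complex) \<Rightarrow> 'd fseries \<Rightarrow> 'd fseries \<Rightarrow> bool" where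
  "Op_V_maps a F G \<longleftrightarrow>
     (\<forall>z. integrable gauss_measure (Op_integrand a (series_fun F) z)) \<and>
     is_series_of G (Op_V a (series_fun F))"

text \<open>Linearity is required on the carrier only.\<close>

definition linear_on_space :: "('d::finite) fseries topology \<Rightarrow> ('d fseries \<Rightarrow> 'd fseries) \<Rightarrow> bool" where
  "linear_on_space X T \<longleftrightarrow> (\<forall>F\<in>topspace X. \<forall>G\<in>topspace X. \<forall>k l :: complex.
     T (\<lambda>\<alpha>. k * F \<alpha> + l * G \<alpha>) = (\<lambda>\<alpha>. k * T F \<alpha> + l * T G \<alpha>))"

definition continuous_extension_Op ::
    "(complex ^ 'd \<Rightarrow> complex ^ 'd \<Rightarrow> complex) \<Rightarrow> 'd fseries topology \<Rightarrow> 'd fseries topology \<Rightarrow>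
      ('d fseries \<Rightarrow> 'd fseries) \<Rightarrow> bool" where
  "continuous_extension_Op a X Y T \<longleftrightarrow>
     linear_on_space X T \<and> continuous_map X Y T \<and> (\<forall>F\<in>A_zero. Op_V_maps a F (T F))"

text \<open>Values of an extension outside the carrier of its domain are irrelevant, so uniqueness is
  equality on the carrier.\<close>

definition uniquely_extendable_Op ::
    "(complex ^ 'd \<Rightarrow> complex ^ 'd \<Rightarrow> complex) \<Rightarrow> 'd fseries topology \<Rightarrow> 'd fseries topology \<Rightarrow>
      bool" where
  "uniquely_extendable_Op a X Y \<longleftrightarrow>
     (\<exists>T. continuous_extension_Op a X Y T \<and>
       (\<forall>T'. continuous_extension_Op a X Y T' \<longrightarrow> (\<forall>F\<in>topspace X. T' F = T F)))"

definition lesssim :: "(complex ^ 'd \<Rightarrow> complex ^ 'd \<Rightarrow> complex) \<Rightarrow>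
    (complex ^ 'd \<Rightarrow> complex ^ 'd \<Rightarrow> real) \<Rightarrow> bool" where
  "lesssim a g \<longleftrightarrow> (\<exists>C>0. \<forall>z w. cmod (a z w) \<le> C * g z w)"

end

theory Submission
  imports Defs "HOL-Complex_Analysis.Cauchy_Integral_Formula" "HOL-Probability.Distributions"
    "HOL-Real_Asymp.Real_Asymp"
begin

text \<open>
  The kernel \<open>K(z,w) = e\<^bsup>(z,w)\<^esup> a(z,w)\<close> is entire in \<open>(z, conj w)\<close>, and since
  \<open>Re (z,w) + |z - w|\<^sup>2/2 = |z|\<^sup>2/2 + |w|\<^sup>2/2\<close>, the hypotheses on \<open>a\<close> say that \<open>|K|\<close> is at most
  \<open>C exp (|z|\<^sup>2/2 + |w|\<^sup>2/2 + m(|z|\<^bsup>1/s\<^esup> + |w|\<^bsup>1/s\<^esup>))\<close> with \<open>m\<close> negative or positive.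
  Cauchy's estimates on the tori \<open>|z\<^sub>j| = \<surd>\<alpha>\<^sub>j\<close>, \<open>|w\<^sub>j| = \<surd>\<beta>\<^sub>j\<close> then give
  \<open>|c(\<alpha>,\<beta>)| \<le> C' \<vartheta>(\<alpha>) \<vartheta>(\<beta>)\<close> for \<open>\<vartheta> = \<vartheta>\<^bsub>m+\<epsilon>,s\<^esub>\<close> and every \<open>\<epsilon> > 0\<close>, the
  exponent \<open>|z|\<^bsup>1/s\<^esup>\<close> turning into \<open>|\<alpha>|\<^bsup>1/(2s)\<^esup>\<close>. An infinite matrix with such entries maps
  one weighted sequence space boundedly into another, which is the required continuity. On polynomials
  the matrix agrees with the integral operator because the \<open>e\<^sub>\<alpha>\<close> are orthonormal for the Gaussian
  measure, and polynomials are dense, which gives uniqueness.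
\<close>

section \<open>Power series expansion of entire functions of several variables\<close>

text \<open>The critical constraint is convergence of the defining Gaussian integral. Once the
  kernel is expanded in w, coefficients of size exp (\<delta> |\<gamma>|) can be integrated term by
  term only for small \<delta>; the condition used is exp \<delta> \<le> sqrt (5/4). For s = 1/2 the
  weight \<open>vartheta \<mu> s\<close> is itself exp (\<mu> |\<alpha>|), so \<mu> has to be small.
  For s > 1/2 the exponent |\<alpha>|^(1/(2s)) is sublinear and every \<mu> is admissible, which is
  how a growth bound with one fixed, possibly large r can be handled.

  The quantifiers on r match the shape of the limits. A linear map from a projective to an inductive
  limit is continuous as soon as it is bounded between one pair of steps, and a single r provides
  that. From an inductive to a projective limit bounds between all pairs of steps are used, and
  these come from all r together. The steps are indexed by open half-lines, so the small loss
  \<epsilon> in the coefficient bound is free, and so is the loss in replacing l^p norms by weighted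
  suprema and sums. This is why one argument serves all p.\<close>

definition circ :: "real \<Rightarrow> complex" where
  "circ t = exp (2 * of_real pi * \<i> * of_real t)"

text \<open>Writing Taylor coefficients as integrals over the unit circle makes their continuous and
  holomorphic dependence on further variables visible.\<close>

definition circ_coeff :: "nat \<Rightarrow> (complex \<Rightarrow> complex) \<Rightarrow> complex" where
  "circ_coeff k g = integral (cbox 0 1) (\<lambda>t. g (circ t) / circ t ^ k)"

lemma circ_nonzero [simp]: "circ t \<noteq> 0"
  and norm_circ [simp]: "cmod (circ t) = 1"
  by (simp_all add: circ_def)

lemma continuous_on_circ [continuous_intros]:
  "continuous_on A h \<Longrightarrow> continuous_on A (\<lambda>x. circ (h x))"
  unfolding circ_def by (intro continuous_intros)

text \<open>Cauchy's formula for the k-th derivative has \<open>Suc k\<close> powers in the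
  denominator; the speed \<open>2 * pi * \<i> * circ t\<close> of the unit circle cancels one of
  them.\<close>

lemma circ_coeff_eq_deriv:
  assumes "g holomorphic_on UNIV"
  shows "circ_coeff k g = (deriv ^^ k) g 0 / fact k"
proof -
  have path: "circlepath 0 1 = circ"
    by (simp add: fun_eq_iff circ_def circlepath mult_ac)
  have vd: "vector_derivative circ (at t) = 2 * pi * \<i> * circ t" for t
    using vector_derivative_circlepath[of 0 1 t] by (simp add: path circ_def)
  have "((\<lambda>u. g u / (u - 0) ^ Suc k) has_contour_integral (2 * pi * \<i>) / fact k * (deriv ^^ k) g 0)
      (circlepath 0 1)"
    by (rule Cauchy_has_contour_integral_higher_derivative_circlepath)
       (use assms in \<open>auto intro: holomorphic_on_imp_continuous_on holomorphic_on_subset\<close>)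
  then have "((\<lambda>t. g (circ t) / circ t ^ Suc k * (2 * pi * \<i> * circ t)) has_integral
      (2 * pi * \<i>) / fact k * (deriv ^^ k) g 0) {0..1}"
    unfolding path has_contour_integral vd by simp
  from has_integral_mult_right[OF this, of "inverse (2 * pi * \<i>)"]
  have "((\<lambda>t. g (circ t) / circ t ^ k) has_integral (deriv ^^ k) g 0 / fact k) {0..1}"
    by (simp add: field_simps)
  then show ?thesis by (simp add: circ_coeff_def integral_unique)
qed

lemma circ_coeff_sums:
  assumes "g holomorphic_on UNIV"
  shows "(\<lambda>k. circ_coeff k g * \<zeta> ^ k) sums g \<zeta>"
  using holomorphic_power_series[of g 0 "cmod \<zeta> + 1" \<zeta>] assms
  by (auto simp: circ_coeff_eq_deriv intro: holomorphic_on_subset)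

lemma circ_coeff_0:
  assumes "g holomorphic_on UNIV"
  shows "circ_coeff 0 g = g 0"
  using circ_coeff_eq_deriv[OF assms, of 0] by simp

text \<open>Cauchy's estimate with the power on the left, so that radius 0 is allowed: the radii
  \<open>sqrt (real (\<alpha> $ i))\<close> chosen later vanish at zero exponents. At R = 0 it reads
  \<open>cmod (g 0) \<le> M\<close> for k = 0 and \<open>0 \<le> M\<close> otherwise.\<close>

lemma circ_coeff_bound:
  assumes g: "g holomorphic_on UNIV" and R: "0 \<le> R" and M: "\<And>\<zeta>. cmod \<zeta> = R \<Longrightarrow> cmod (g \<zeta>) \<le> M"
  shows "cmod (circ_coeff k g) * R ^ k \<le> M"
proof (cases "R = 0")
  case True
  have "cmod (g 0) \<le> M" using M[of 0] True by simp
  moreover from this have "0 \<le> M" using norm_ge_zero order_trans by blast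
  ultimately show ?thesis using True g by (cases k) (auto simp: circ_coeff_0)
next
  case False
  then have "cmod ((deriv ^^ k) g 0) \<le> fact k * M / R ^ k"
    using R g M by (intro Cauchy_inequality)
      (auto intro: holomorphic_on_imp_continuous_on holomorphic_on_subset)
  with False R show ?thesis
    by (simp add: circ_coeff_eq_deriv[OF g] norm_divide field_simps)
qed

text \<open>Boundedness on polydiscs follows from continuity; requiring it avoids compactness arguments
  in the function space.\<close>

definition multi_entire :: "(('n \<Rightarrow> complex) \<Rightarrow> complex) \<Rightarrow> bool" where
  "multi_entire f \<longleftrightarrow> continuous_on UNIV f \<and> (\<forall>i z. (\<lambda>\<zeta>. f (z(i := \<zeta>))) holomorphic_on UNIV) \<and>
     (\<forall>R. \<exists>M. \<forall>z. (\<forall>i. cmod (z i) \<le> R) \<longrightarrow> cmod (f z) \<le> M)"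

lemma continuous_on_fun_upd [continuous_intros]:
  fixes f :: "'a::topological_space \<Rightarrow> 'n \<Rightarrow> 'b::topological_space"
  assumes "continuous_on A f" "continuous_on A g"
  shows "continuous_on A (\<lambda>x. (f x)(i := g x))"
proof (rule continuous_on_coordinatewise_then_product)
  fix j
  show "continuous_on A (\<lambda>x. ((f x)(i := g x)) j)"
    using assms continuous_on_product_coordinates continuous_on_product_then_coordinatewise
    by (cases "j = i") auto
qed

lemma multi_entire_continuous:
  assumes "multi_entire f" "continuous_on A g"
  shows "continuous_on A (\<lambda>x. f (g x))"
  using assms continuous_on_compose2[of UNIV f A g] by (auto simp: multi_entire_def)

text \<open>This closure property lets the variables be expanded one at a time. Continuity is that
  of a parameter integral, boundedness is Cauchy's estimate on the unit circle, and holomorphy in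
  another variable is differentiation under the integral.\<close>

lemma multi_entire_circ_coeff:
  fixes f :: "('n \<Rightarrow> complex) \<Rightarrow> complex"
  assumes f: "multi_entire f"
  shows "multi_entire (\<lambda>z. circ_coeff k (\<lambda>\<zeta>. f (z(i := \<zeta>))))"
  unfolding multi_entire_def
proof (intro conjI allI)
  have hol: "(\<lambda>\<zeta>. f (z(j := \<zeta>))) holomorphic_on UNIV" for j z
    using f by (auto simp: multi_entire_def)
  show "continuous_on UNIV (\<lambda>z. circ_coeff k (\<lambda>\<zeta>. f (z(i := \<zeta>))))"
    unfolding circ_coeff_def
    by (rule integral_continuous_on_param)
       (auto simp: case_prod_unfold intro!: continuous_on_divide multi_entire_continuous[OF f]
          continuous_on_fun_upd continuous_on_circ continuous_on_power continuous_on_fst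
          continuous_on_snd continuous_on_id)
  show "\<exists>M. \<forall>z. (\<forall>i. cmod (z i) \<le> R) \<longrightarrow> cmod (circ_coeff k (\<lambda>\<zeta>. f (z(i := \<zeta>)))) \<le> M" for R
  proof -
    obtain M where M: "\<And>z. (\<forall>i. cmod (z i) \<le> max R 1) \<Longrightarrow> cmod (f z) \<le> M"
      using f unfolding multi_entire_def by meson
    have "cmod (circ_coeff k (\<lambda>\<zeta>. f (z(i := \<zeta>)))) \<le> M" if "\<forall>i. cmod (z i) \<le> R" for z
    proof -
      have "cmod (f (z(i := \<zeta>))) \<le> M" if "cmod \<zeta> = 1" for \<zeta>
        using that \<open>\<forall>i. cmod (z i) \<le> R\<close> by (intro M) (auto intro: max.coboundedI1)
      then show ?thesis using circ_coeff_bound[OF hol, where R = 1 and k = k] by simp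
    qed
    then show ?thesis by blast
  qed
  fix j z
  show "(\<lambda>\<xi>. circ_coeff k (\<lambda>\<zeta>. f ((z(j := \<xi>))(i := \<zeta>)))) holomorphic_on UNIV"
  proof (cases "j = i")
    case True
    then show ?thesis by simp
  next
    case False
    define h where "h \<xi> t = f (z(i := circ t, j := \<xi>))" for \<xi> t
    have holh: "(\<lambda>\<xi>. h \<xi> t) holomorphic_on UNIV" for t
      unfolding h_def by (rule hol)
    have hol2: "(\<lambda>\<eta>. h (\<xi> + \<eta>) t) holomorphic_on UNIV" for \<xi> t
      using holomorphic_on_compose[of "\<lambda>\<eta>. \<xi> + \<eta>" UNIV "\<lambda>\<xi>. h \<xi> t"] holh[of t]
      by (simp add: o_def holomorphic_on_add holomorphic_on_const holomorphic_on_id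
            holomorphic_on_subset[OF _ subset_UNIV])
    \<comment> \<open>The Leibniz rule asks for a jointly continuous derivative. Written as the
      first circle coefficient of a translate, the derivative is again a parameter integral, and its
      continuity follows from that of f.\<close>
    have der: "((\<lambda>\<xi>. h \<xi> t) has_field_derivative circ_coeff 1 (\<lambda>\<eta>. h (\<xi> + \<eta>) t)) (at \<xi>)" for \<xi> t
    proof -
      have "((\<lambda>\<xi>. h \<xi> t) has_field_derivative deriv (\<lambda>\<xi>. h \<xi> t) \<xi>) (at \<xi>)"
        by (rule holomorphic_derivI[OF holh]) auto
      moreover have "deriv (\<lambda>\<eta>. h (\<xi> + \<eta>) t) 0 = deriv (\<lambda>\<xi>. h \<xi> t) \<xi>"
        using deriv_shift_0[of "\<lambda>\<xi>. h \<xi> t" \<xi>] by (simp add: o_def)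
      ultimately show ?thesis
        by (simp add: circ_coeff_eq_deriv[OF hol2])
    qed
    have cont: "continuous_on UNIV (\<lambda>x. h (fst x) (snd x))"
      unfolding h_def by (intro continuous_intros multi_entire_continuous[OF f])
    have "(\<lambda>\<xi>. integral (cbox 0 1) (\<lambda>t. h \<xi> t / circ t ^ k)) holomorphic_on UNIV"
    proof (rule leibniz_rule_holomorphic)
      fix \<xi> t
      show "((\<lambda>\<xi>. h \<xi> t / circ t ^ k) has_field_derivative
          circ_coeff 1 (\<lambda>\<eta>. h (\<xi> + \<eta>) t) / circ t ^ k) (at \<xi> within UNIV)"
        using DERIV_cdivide[OF der] by simp
      show "(\<lambda>t. h \<xi> t / circ t ^ k) integrable_on cbox 0 1"
        using continuous_on_compose2[OF cont, of "cbox 0 1" "\<lambda>t. (\<xi>, t)"]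
        by (intro integrable_continuous) (simp add: continuous_on_Pair continuous_on_divide
            continuous_on_power continuous_on_circ)
    next
      have "continuous_on (UNIV \<times> cbox 0 1) (\<lambda>x. circ_coeff 1 (\<lambda>\<eta>. h (fst x + \<eta>) (snd x)))"
        unfolding circ_coeff_def
      proof (rule integral_continuous_on_param)
        have "continuous_on ((UNIV \<times> cbox 0 1) \<times> cbox 0 1)
            (\<lambda>x. (\<lambda>x. h (fst x) (snd x)) (fst (fst x) + circ (snd x), snd (fst x)))"
          by (rule continuous_on_compose2[OF cont]) (auto intro!: continuous_intros)
        then show "continuous_on ((UNIV \<times> cbox 0 1) \<times> cbox 0 1)
            (\<lambda>(x, t). h (fst x + circ t) (snd x) / circ t ^ 1)"
          by (auto simp: case_prod_unfold intro!: continuous_intros)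
      qed
      then show "continuous_on (UNIV \<times> cbox 0 1)
          (\<lambda>(\<xi>, t). circ_coeff 1 (\<lambda>\<eta>. h (\<xi> + \<eta>) t) / circ t ^ k)"
        by (auto simp: case_prod_unfold intro!: continuous_intros)
    qed auto
    then show ?thesis
      unfolding circ_coeff_def h_def using False by (simp add: fun_upd_twist)
  qed
qed

text \<open>Multi-indices in the variables I live on the whole type and vanish off I, so induction
  over I never changes the type.\<close>

definition multi_supp :: "'n set \<Rightarrow> ('n \<Rightarrow> nat) set" where
  "multi_supp I = {\<alpha>. \<forall>i. i \<notin> I \<longrightarrow> \<alpha> i = 0}"

lemma multi_supp_empty: "multi_supp {} = {\<lambda>_. 0}"
  and multi_supp_UNIV: "multi_supp UNIV = UNIV"
  by (auto simp: multi_supp_def)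

lemma has_sum_multi_supp_insert:
  assumes "i \<notin> I"
  shows "(h has_sum S) (multi_supp (insert i I)) \<longleftrightarrow>
    ((\<lambda>(k, \<alpha>). h (\<alpha>(i := k))) has_sum S) (UNIV \<times> multi_supp I)"
  by (rule has_sum_reindex_bij_witness[where j = "\<lambda>\<alpha>. (\<alpha> i, \<alpha>(i := 0))" and i = "\<lambda>(k, \<alpha>). \<alpha>(i := k)"])
     (use assms in \<open>auto simp: multi_supp_def fun_eq_iff\<close>)

lemma prod_insert_fun_upd:
  assumes "finite I" "i \<notin> I"
  shows "(\<Prod>j\<in>insert i I. h j ((\<alpha>(i := k)) j)) = h i k * (\<Prod>j\<in>I. h j (\<alpha> j))"
proof -
  have "(\<Prod>j\<in>I. h j ((\<alpha>(i := k)) j)) = (\<Prod>j\<in>I. h j (\<alpha> j))"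
    using assms by (intro prod.cong) auto
  then show ?thesis using assms by simp
qed

text \<open>Fubini for nonnegative families, one variable per step. It supplies the geometric
  majorants and the summability of the weights.\<close>

lemma has_sum_prod_multi_supp:
  fixes g :: "'n \<Rightarrow> nat \<Rightarrow> real"
  assumes "finite I" "\<And>i. i \<in> I \<Longrightarrow> (g i has_sum G i) UNIV" "\<And>i k. i \<in> I \<Longrightarrow> 0 \<le> g i k"
  shows "((\<lambda>\<alpha>. \<Prod>i\<in>I. g i (\<alpha> i)) has_sum (\<Prod>i\<in>I. G i)) (multi_supp I)"
  using assms
proof (induction I rule: finite_induct)
  case empty
  show ?case by (simp add: multi_supp_empty has_sum_finiteI)
next
  case (insert i I)
  let ?P = "\<lambda>\<alpha>. \<Prod>i\<in>I. g i (\<alpha> i)"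
  have inner: "((\<lambda>\<alpha>. g i k * ?P \<alpha>) has_sum g i k * (\<Prod>i\<in>I. G i)) (multi_supp I)" for k
    by (intro has_sum_cmult_right insert.IH) (use insert.prems in auto)
  have outer: "((\<lambda>k. g i k * (\<Prod>i\<in>I. G i)) has_sum G i * (\<Prod>i\<in>I. G i)) UNIV"
    by (intro has_sum_cmult_left insert.prems) auto
  have "((\<lambda>x. g i (fst x) * ?P (snd x)) has_sum G i * (\<Prod>i\<in>I. G i)) (UNIV \<times> multi_supp I)"
    by (rule has_sum_SigmaI[OF _ outer], unfold fst_conv snd_conv, rule inner,
        rule summable_on_SigmaI, unfold fst_conv snd_conv, rule inner)
       (use outer insert.prems in \<open>auto simp: summable_on_def intro!: mult_nonneg_nonneg prod_nonneg\<close>)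
  then show ?case
    unfolding has_sum_multi_supp_insert[OF insert.hyps(2)] case_prod_unfold
      prod_insert_fun_upd[OF insert.hyps(1,2), of g]
    by (subst prod.insert[OF insert.hyps(1,2)])
qed

lemma powser_eq_0_imp_coeff_eq_0:
  fixes a :: "nat \<Rightarrow> complex"
  assumes "\<And>\<zeta>. (\<lambda>n. a n * \<zeta> ^ n) sums 0"
  shows "a n = 0"
proof (rule ccontr)
  assume "a n \<noteq> 0"
  have "a 0 = 0" using assms[of 0] powser_sums_zero[of a] sums_unique2 by blast
  with \<open>a n \<noteq> 0\<close> have "0 < n" by (cases n) auto
  \<comment> \<open>Zeros of a nontrivial power series are isolated, whereas this one has the sum 0
    everywhere.\<close>
  show False
  proof (rule powser_0_nonzero[of 1 0 a "\<lambda>_. 0" n])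
    fix s :: real
    assume "0 < s" "\<And>z. z \<in> cball (0::complex) s - {0} \<Longrightarrow> (0::complex) \<noteq> 0"
    from this(2)[of "of_real s"] this(1) show False by simp
  qed (use assms \<open>0 < n\<close> \<open>a n \<noteq> 0\<close> in auto)
qed

text \<open>With the other variables fixed, collecting powers of the i-th one gives a power series
  in one variable with sum 0. Its coefficients are power series in the other variables, so they
  vanish identically and the induction hypothesis applies to each.\<close>

lemma multi_powser_eq_0_imp_coeff_eq_0:
  fixes c :: "('n \<Rightarrow> nat) \<Rightarrow> complex"
  assumes "finite I" "\<And>z. ((\<lambda>\<alpha>. c \<alpha> * (\<Prod>i\<in>I. z i ^ \<alpha> i)) has_sum 0) (multi_supp I)"
    and "\<alpha> \<in> multi_supp I"
  shows "c \<alpha> = 0"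
  using assms
proof (induction I arbitrary: c \<alpha> rule: finite_induct)
  case (empty c \<alpha>)
  from empty(1)[of undefined] have "c (\<lambda>_. 0) = 0"
    by (simp add: multi_supp_empty has_sum_finite_iff)
  with empty(2) show ?case by (simp add: multi_supp_empty)
next
  case (insert i I c \<alpha>)
  let ?g = "\<lambda>z k \<alpha>. c (\<alpha>(i := k)) * (\<Prod>i\<in>I. z i ^ \<alpha> i)"
  have sum: "((\<lambda>(k, \<alpha>). ?g z k \<alpha> * \<zeta> ^ k) has_sum 0) (UNIV \<times> multi_supp I)" for z \<zeta>
  proof -
    have "(\<Prod>j\<in>insert i I. (z(i := \<zeta>)) j ^ (\<alpha>(i := k)) j) = \<zeta> ^ k * (\<Prod>i\<in>I. z i ^ \<alpha> i)" for \<alpha> k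
    proof -
      have "(\<Prod>j\<in>I. (z(i := \<zeta>)) j ^ (\<alpha>(i := k)) j) = (\<Prod>i\<in>I. z i ^ \<alpha> i)"
        using insert.hyps by (intro prod.cong) auto
      then show ?thesis using insert.hyps by simp
    qed
    then show ?thesis
      using insert.prems(1)[of "z(i := \<zeta>)"]
      unfolding has_sum_multi_supp_insert[OF insert.hyps(2)]
      by (simp add: case_prod_unfold mult_ac del: fun_upd_apply)
  qed
  have inner: "(?g z k has_sum infsum (?g z k) (multi_supp I)) (multi_supp I)" for z k
  proof -
    \<comment> \<open>At \<zeta> = 1 the powers of \<zeta> disappear, and the rows of a summable
      family are summable.\<close>
    have "(\<lambda>(k, \<alpha>). ?g z k \<alpha>) summable_on (UNIV \<times> multi_supp I)"
      using has_sum_imp_summable[OF sum[of z 1]] by simp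
    from summable_on_SigmaD1[OF this UNIV_I] show ?thesis by (rule has_sum_infsum)
  qed
  have "infsum (?g z k) (multi_supp I) = 0" for z k
  proof (rule powser_eq_0_imp_coeff_eq_0)
    fix \<zeta> :: complex
    show "(\<lambda>k. infsum (?g z k) (multi_supp I) * \<zeta> ^ k) sums 0"
      by (intro has_sum_imp_sums has_sum_SigmaD[OF sum[of z \<zeta>]])
         (auto intro!: has_sum_cmult_left inner)
  qed
  then have "(?g z k has_sum 0) (multi_supp I)" for z k using inner[where z = z and k = k] by simp
  then have "c ((\<alpha>(i := 0))(i := \<alpha> i)) = 0"
    by (rule insert.IH[where c = "\<lambda>\<beta>. c (\<beta>(i := \<alpha> i))"])
       (use insert.prems(2) in \<open>auto simp: multi_supp_def\<close>)
  then show ?case by simp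
qed

text \<open>Expansion and estimate are bundled because one induction proves both: the estimate in
  fewer variables is what makes the series in more variables converge.\<close>

definition has_cauchy_expansion ::
    "'n set \<Rightarrow> (('n \<Rightarrow> complex) \<Rightarrow> complex) \<Rightarrow> (('n \<Rightarrow> nat) \<Rightarrow> complex) \<Rightarrow> bool" where
  "has_cauchy_expansion I f c \<longleftrightarrow>
    (\<forall>z. ((\<lambda>\<alpha>. c \<alpha> * (\<Prod>i\<in>I. z i ^ \<alpha> i)) has_sum f z) (multi_supp I)) \<and>
    (\<forall>R M. (\<forall>i. 0 \<le> R i) \<longrightarrow> (\<forall>z. (\<forall>i\<in>I. cmod (z i) = R i) \<longrightarrow> cmod (f z) \<le> M) \<longrightarrow>
       (\<forall>\<alpha>\<in>multi_supp I. cmod (c \<alpha>) * (\<Prod>i\<in>I. R i ^ \<alpha> i) \<le> M))"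

lemma has_cauchy_expansionI:
  assumes "\<And>z. ((\<lambda>\<alpha>. c \<alpha> * (\<Prod>i\<in>I. z i ^ \<alpha> i)) has_sum f z) (multi_supp I)"
    and "\<And>R M \<alpha>. \<lbrakk>\<And>i. 0 \<le> R i; \<And>z. (\<forall>i\<in>I. cmod (z i) = R i) \<Longrightarrow> cmod (f z) \<le> M;
      \<alpha> \<in> multi_supp I\<rbrakk> \<Longrightarrow> cmod (c \<alpha>) * (\<Prod>i\<in>I. R i ^ \<alpha> i) \<le> M"
  shows "has_cauchy_expansion I f c"
  unfolding has_cauchy_expansion_def by (intro conjI allI impI ballI assms) simp_all

lemma has_cauchy_expansion_has_sum:
  assumes "has_cauchy_expansion I f c"
  shows "((\<lambda>\<alpha>. c \<alpha> * (\<Prod>i\<in>I. z i ^ \<alpha> i)) has_sum f z) (multi_supp I)"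
  using assms unfolding has_cauchy_expansion_def by (elim conjE allE)

lemma has_cauchy_expansion_bound:
  assumes "has_cauchy_expansion I f c" "\<And>i. 0 \<le> R i"
    "\<And>z. (\<forall>i\<in>I. cmod (z i) = R i) \<Longrightarrow> cmod (f z) \<le> M" "\<alpha> \<in> multi_supp I"
  shows "cmod (c \<alpha>) * (\<Prod>i\<in>I. R i ^ \<alpha> i) \<le> M"
  using assms(1)[unfolded has_cauchy_expansion_def, THEN conjunct2, THEN spec, THEN spec,
      of R M] assms(2-4) by simp

text \<open>The coefficients \<open>F k\<close> of the expansion in the i-th variable are entire and
  depend only on the remaining ones, so they have expansions themselves. The double series converges
  absolutely by Cauchy's estimate on a larger torus; summing it row by row then identifies its value
  as f z.\<close>

theorem multi_entire_expansion:
  fixes f :: "('n \<Rightarrow> complex) \<Rightarrow> complex"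
  assumes "finite I" "multi_entire f" "\<And>z z'. (\<And>i. i \<in> I \<Longrightarrow> z i = z' i) \<Longrightarrow> f z = f z'"
  shows "\<exists>c. has_cauchy_expansion I f c"
  using assms
proof (induction I arbitrary: f rule: finite_induct)
  case empty
  have const: "f z = f (\<lambda>_. 0)" for z by (rule empty) auto
  show ?case
  proof (intro exI has_cauchy_expansionI)
    show "((\<lambda>\<alpha>. f (\<lambda>_. 0) * (\<Prod>i\<in>{}. z i ^ \<alpha> i)) has_sum f z) (multi_supp {})" for z
      using const[of z] by (simp add: multi_supp_empty has_sum_finiteI)
    show "cmod (f (\<lambda>_. 0)) * (\<Prod>i\<in>{}. R i ^ \<alpha> i) \<le> M"
      if "\<And>z. (\<forall>i\<in>{}. cmod (z i) = R i) \<Longrightarrow> cmod (f z) \<le> M" for R :: "'n \<Rightarrow> real" and M \<alpha>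
      using that[of "\<lambda>_. 0"] by simp
  qed
next
  case (insert i I f)
  let ?I = "insert i I"
  define F where "F k z = circ_coeff k (\<lambda>\<zeta>. f (z(i := \<zeta>)))" for k z
  have hol: "(\<lambda>\<zeta>. f (z(j := \<zeta>))) holomorphic_on UNIV" for j z
    using insert.prems(1) by (auto simp: multi_entire_def)
  have F_dep: "F k z = F k z'" if "\<And>i. i \<in> I \<Longrightarrow> z i = z' i" for k z z'
  proof -
    have "f (z(i := \<zeta>)) = f (z'(i := \<zeta>))" for \<zeta>
      by (rule insert.prems(2)) (use that in auto)
    then show ?thesis by (simp add: F_def)
  qed
  have "\<exists>c. has_cauchy_expansion I (F k) c" for k
    by (rule insert.IH[OF _ F_dep]) (auto simp: F_def intro: multi_entire_circ_coeff insert.prems)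
  then obtain c where c: "\<And>k. has_cauchy_expansion I (F k) (c k)" by metis
  note c_sum = has_cauchy_expansion_has_sum[OF c]
  define d where "d \<alpha> = c (\<alpha> i) (\<alpha>(i := 0))" for \<alpha>
  have d_upd: "d (\<alpha>(i := k)) = c k \<alpha>" if "\<alpha> \<in> multi_supp I" for \<alpha> k
  proof -
    have "\<alpha>(i := 0) = \<alpha>" using that insert.hyps by (auto simp: multi_supp_def fun_eq_iff)
    then show ?thesis by (simp add: d_def)
  qed
  have d_bound: "cmod (d \<alpha>) * (\<Prod>i\<in>?I. R i ^ \<alpha> i) \<le> M"
    if R: "\<And>i. 0 \<le> R i" and M: "\<And>z. (\<forall>i\<in>?I. cmod (z i) = R i) \<Longrightarrow> cmod (f z) \<le> M"
      and \<alpha>: "\<alpha> \<in> multi_supp ?I" for R M \<alpha>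
  proof -
    define k \<beta> where "k = \<alpha> i" and "\<beta> = \<alpha>(i := 0)"
    have \<beta>: "\<beta> \<in> multi_supp I" and \<alpha>_eq: "\<alpha> = \<beta>(i := k)"
      using \<alpha> by (auto simp: multi_supp_def \<beta>_def k_def)
    have F_bound: "cmod (F k z) * R i ^ k \<le> M" if "\<forall>i\<in>I. cmod (z i) = R i" for z
      unfolding F_def
      by (rule circ_coeff_bound[OF hol R]) (use that insert.hyps in \<open>auto intro!: M\<close>)
    have "cmod (f (\<lambda>i. of_real (R i))) \<le> M" by (rule M) (simp add: R)
    then have "0 \<le> M" by (rule order_trans[OF norm_ge_zero])
    \<comment> \<open>Dividing by \<open>R i ^ k\<close> reduces this to the estimate for
      \<open>F k\<close>. If that power is 0, the claim is only \<open>0 \<le> M\<close>, which one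
      point of the torus has just supplied.\<close>
    have "R i ^ k * (cmod (c k \<beta>) * (\<Prod>i\<in>I. R i ^ \<beta> i)) \<le> M"
    proof (cases "R i ^ k = 0")
      case True
      show ?thesis unfolding True using \<open>0 \<le> M\<close> by simp
    next
      case False
      then have pos: "R i ^ k > 0" using zero_le_power[OF R[of i], of k] by linarith
      have "cmod (c k \<beta>) * (\<Prod>i\<in>I. R i ^ \<beta> i) \<le> M / R i ^ k"
      proof (rule has_cauchy_expansion_bound[OF c])
        show "cmod (F k z) \<le> M / R i ^ k" if "\<forall>i\<in>I. cmod (z i) = R i" for z
          using F_bound[OF that] by (simp only: pos_le_divide_eq[OF pos])
      qed (use R \<beta> in simp_all)
      then show ?thesis using pos by (simp add: pos_le_divide_eq mult.commute)
    qed
    then show ?thesis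
      unfolding \<alpha>_eq d_upd[OF \<beta>] prod_insert_fun_upd[OF insert.hyps(1,2), of "\<lambda>j n. R j ^ n"]
      by (simp add: mult_ac)
  qed
  have "((\<lambda>\<alpha>. d \<alpha> * (\<Prod>i\<in>?I. z i ^ \<alpha> i)) has_sum f z) (multi_supp ?I)" for z
  proof -
    \<comment> \<open>Radii of at least twice \<open>cmod (z j)\<close> dominate the series by a
      geometric one of ratio 1/2; the summand 1 keeps them positive where z vanishes.\<close>
    define R where "R j = 2 * cmod (z j) + 1" for j
    have R: "R j > 0" "R j \<ge> 0" for j by (simp_all add: R_def add_nonneg_pos)
    obtain M where M: "\<And>z. (\<forall>j. cmod (z j) \<le> sum R ?I) \<Longrightarrow> cmod (f z) \<le> M"
      using insert.prems(1) unfolding multi_entire_def by meson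
    have M': "cmod (f u) \<le> M" if "\<forall>j\<in>?I. cmod (u j) = R j" for u
    proof -
      \<comment> \<open>The polydisc bound asks for all coordinates to be small, so those on which f
        does not depend are set to 0.\<close>
      have "f u = f (\<lambda>j. if j \<in> ?I then u j else 0)" by (rule insert.prems(2)) auto
      moreover have "cmod (if j \<in> ?I then u j else 0) \<le> sum R ?I" for j
        using that R insert.hyps by (auto intro!: member_le_sum sum_nonneg simp del: sum.insert)
      ultimately show ?thesis using M by simp
    qed
    have "cmod (f (\<lambda>i. of_real (R i))) \<le> M" by (rule M') (simp add: R)
    then have "0 \<le> M" by (rule order_trans[OF norm_ge_zero])
    have le: "norm (d \<alpha> * (\<Prod>j\<in>?I. z j ^ \<alpha> j)) \<le> M * (\<Prod>j\<in>?I. (1/2) ^ \<alpha> j)"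
      if "\<alpha> \<in> multi_supp ?I" for \<alpha>
    proof -
      have "(\<Prod>j\<in>?I. cmod (z j) ^ \<alpha> j) \<le> (\<Prod>j\<in>?I. R j ^ \<alpha> j * (1/2) ^ \<alpha> j)"
        unfolding power_mult_distrib[symmetric]
        by (intro prod_mono conjI power_mono zero_le_power) (auto simp: R_def)
      then have "norm (d \<alpha> * (\<Prod>j\<in>?I. z j ^ \<alpha> j)) \<le> cmod (d \<alpha>) * (\<Prod>j\<in>?I. R j ^ \<alpha> j * (1/2) ^ \<alpha> j)"
        unfolding norm_mult prod_norm[symmetric] norm_power by (rule mult_left_mono) simp
      also have "\<dots> = cmod (d \<alpha>) * (\<Prod>j\<in>?I. R j ^ \<alpha> j) * (\<Prod>j\<in>?I. (1/2) ^ \<alpha> j)"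
        by (simp only: prod.distrib mult.assoc)
      also have "\<dots> \<le> M * (\<Prod>j\<in>?I. (1/2) ^ \<alpha> j)"
        by (rule mult_right_mono[OF d_bound[OF R(2) M' that]]) (auto intro!: prod_nonneg)
      finally show ?thesis .
    qed
    have half: "((^) (1/2::real) has_sum 2) UNIV"
      using geometric_sums[of "1/2::real"] by (intro sums_nonneg_imp_has_sum) auto
    have "(\<lambda>\<alpha>. M * (\<Prod>j\<in>?I. (1/2) ^ \<alpha> j)) summable_on (multi_supp ?I)"
      by (intro summable_on_cmult_right has_sum_imp_summable[OF has_sum_prod_multi_supp[OF _ half]])
         (use insert.hyps in auto)
    then have "(\<lambda>\<alpha>. norm (d \<alpha> * (\<Prod>j\<in>?I. z j ^ \<alpha> j))) summable_on (multi_supp ?I)"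
      by (rule summable_on_comparison_test) (use le in auto)
    then have "(\<lambda>\<alpha>. d \<alpha> * (\<Prod>j\<in>?I. z j ^ \<alpha> j)) summable_on (multi_supp ?I)"
      by (rule abs_summable_summable)
    then obtain S where S: "((\<lambda>\<alpha>. d \<alpha> * (\<Prod>j\<in>?I. z j ^ \<alpha> j)) has_sum S) (multi_supp ?I)"
      unfolding summable_on_def by (elim exE)
    then have total: "((\<lambda>(k, \<alpha>). d (\<alpha>(i := k)) * (\<Prod>j\<in>?I. z j ^ (\<alpha>(i := k)) j)) has_sum S) (UNIV \<times> multi_supp I)"
      by (simp only: has_sum_multi_supp_insert[OF insert.hyps(2)])
    have inner: "((\<lambda>\<alpha>. d (\<alpha>(i := k)) * (\<Prod>j\<in>?I. z j ^ (\<alpha>(i := k)) j)) has_sum F k z * z i ^ k)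
        (multi_supp I)" for k
    proof -
      have "((\<lambda>\<alpha>. c k \<alpha> * (\<Prod>i\<in>I. z i ^ \<alpha> i) * z i ^ k) has_sum F k z * z i ^ k) (multi_supp I)"
        by (intro has_sum_cmult_left c_sum)
      also have "?this \<longleftrightarrow> ?thesis"
        unfolding prod_insert_fun_upd[OF insert.hyps(1,2), of "\<lambda>j n. z j ^ n"]
        by (intro has_sum_cong) (simp add: d_upd mult_ac)
      finally show ?thesis .
    qed
    have "((\<lambda>k. F k z * z i ^ k) has_sum S) UNIV"
      by (rule has_sum_SigmaD[OF total]) (unfold prod.case, rule inner)
    then have "(\<lambda>k. F k z * z i ^ k) sums S" by (rule has_sum_imp_sums)
    moreover have "(\<lambda>k. F k z * z i ^ k) sums f z"
      using circ_coeff_sums[OF hol[of z i], of "z i"] by (simp add: F_def)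
    ultimately have "S = f z" by (rule sums_unique2)
    with S show ?thesis by simp
  qed
  then show ?case by (intro exI[of _ d] has_cauchy_expansionI d_bound)
qed

section \<open>Orthonormality of the normalised monomials\<close>

lemma lborel_complex_eq:
  "(lborel :: complex measure) = distr lborel borel (\<lambda>(x, y). Complex x y)"
proof (rule lborel_eqI)
  have [measurable]: "(\<lambda>(x, y). Complex x y) \<in> borel_measurable borel"
    by (intro borel_measurable_continuous_onI) (auto simp: case_prod_unfold intro!: continuous_intros)
  fix l u :: complex assume le: "\<And>b. b \<in> Basis \<Longrightarrow> l \<bullet> b \<le> u \<bullet> b"
  then have le': "Re l \<le> Re u" "Im l \<le> Im u" using le[of 1] le[of \<i>] by (simp_all add: Basis_complex_def)
  have "(\<lambda>(x, y). Complex x y) -` box l u = box (Re l, Im l) (Re u, Im u)"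
    by (auto simp: box_def Basis_complex_def Basis_prod_def)
  then have "emeasure (distr lborel borel (\<lambda>(x, y). Complex x y)) (box l u)
      = emeasure lborel (box (Re l, Im l) (Re u, Im u))"
    by (simp add: emeasure_distr)
  also have "\<dots> = (\<Prod>b\<in>Basis. ((Re u, Im u) - (Re l, Im l)) \<bullet> b)"
    using le' by (subst emeasure_lborel_box) (auto simp: Basis_prod_def)
  also have "\<dots> = (\<Prod>b\<in>Basis. (u - l) \<bullet> b)"
    by (simp add: Basis_prod_def Basis_complex_def prod.union_disjoint mult.commute)
  finally show "emeasure (distr lborel borel (\<lambda>(x, y). Complex x y)) (box l u) = (\<Prod>b\<in>Basis. (u - l) \<bullet> b)" .
qed simp

lemma
  fixes f :: "complex \<Rightarrow> 'b::{banach, second_countable_topology}"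
  assumes f: "integrable lborel f"
  shows lborel_integral_complex_fst: "integral\<^sup>L lborel f = (LINT y|lborel. LINT x|lborel. f (Complex x y))"
    and lborel_integral_complex_snd: "integral\<^sup>L lborel f = (LINT x|lborel. LINT y|lborel. f (Complex x y))"
proof -
  have m: "(\<lambda>(x, y). Complex x y) \<in> measurable (lborel :: (real \<times> real) measure) borel"
    by (simp, intro borel_measurable_continuous_onI) (auto simp: case_prod_unfold intro!: continuous_intros)
  have fm: "f \<in> borel_measurable borel" using borel_measurable_integrable[OF f] by simp
  have i: "integrable (lborel \<Otimes>\<^sub>M lborel) (\<lambda>(x, y). f (Complex x y))"
    using f unfolding lborel_prod lborel_complex_eq integrable_distr_eq[OF m fm]
    by (simp add: case_prod_unfold)
  have "integral\<^sup>L lborel f = integral\<^sup>L (lborel \<Otimes>\<^sub>M lborel) (\<lambda>(x, y). f (Complex x y))"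
    unfolding lborel_prod lborel_complex_eq integral_distr[OF m fm] by (simp add: case_prod_unfold)
  with lborel_pair.integral_fst'[OF i] lborel_pair.integral_snd[OF i]
  show "integral\<^sup>L lborel f = (LINT x|lborel. LINT y|lborel. f (Complex x y))"
    "integral\<^sup>L lborel f = (LINT y|lborel. LINT x|lborel. f (Complex x y))" by simp_all
qed

lemma prod_Basis_vec:
  "(\<Prod>b\<in>(Basis :: ('a::euclidean_space ^ 'd::finite) set). f b) = (\<Prod>i\<in>UNIV. \<Prod>b\<in>Basis. f (axis i b))"
proof -
  have inj: "inj_on (\<lambda>(i::'d, b). axis i b) (UNIV \<times> (Basis :: 'a set))"
    by (auto simp: inj_on_def axis_eq_axis nonzero_Basis)
  have im: "(\<lambda>(i::'d, b). axis i b) ` (UNIV \<times> (Basis :: 'a set)) = Basis"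
    by (auto simp: Basis_vec_def)
  show ?thesis
    unfolding prod.cartesian_product prod.reindex[OF inj, unfolded im] by (simp add: o_def case_prod_unfold)
qed

lemma measurable_vec_lambda:
  "vec_lambda \<in> borel_measurable (\<Pi>\<^sub>M i\<in>(UNIV::'d::finite set). (lborel :: 'a::euclidean_space measure))"
proof (rule borel_measurable_euclidean_space[THEN iffD2], rule ballI)
    fix b :: "'a ^ 'd" assume "b \<in> Basis"
    then obtain i c where b: "b = axis i c" by (auto simp: Basis_vec_def)
    have "(\<lambda>x. x i \<bullet> c) \<in> borel_measurable (\<Pi>\<^sub>M i\<in>(UNIV::'d set). (lborel :: 'a measure))"
      by measurable
    then show "(\<lambda>x. vec_lambda x \<bullet> b) \<in> borel_measurable (\<Pi>\<^sub>M i\<in>(UNIV::'d set). (lborel :: 'a measure))"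
      by (simp add: b inner_axis)
qed

lemma lborel_vec_eq:
  "(lborel :: ('a::euclidean_space ^ 'd::finite) measure) = distr (\<Pi>\<^sub>M i\<in>UNIV. lborel) borel vec_lambda"
proof (rule lborel_eqI)
  interpret finite_product_sigma_finite "\<lambda>_. lborel :: 'a measure" "UNIV :: 'd set"
    by unfold_locales auto
  fix l u :: "'a ^ 'd" assume le: "\<And>b. b \<in> Basis \<Longrightarrow> l \<bullet> b \<le> u \<bullet> b"
  have le': "l $ i \<bullet> c \<le> u $ i \<bullet> c" if "c \<in> Basis" for i c
    using le[of "axis i c"] that by (simp add: inner_axis)
  have "vec_lambda -` box l u \<inter> space (\<Pi>\<^sub>M i\<in>(UNIV::'d set). (lborel :: 'a measure))
      = (\<Pi>\<^sub>E i\<in>UNIV. box (l $ i) (u $ i))"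
    by (auto simp: box_def Basis_vec_def inner_axis PiE_def space_PiM)
  then have "emeasure (distr (\<Pi>\<^sub>M i\<in>UNIV. lborel) borel vec_lambda) (box l u)
      = (\<Prod>i\<in>UNIV. emeasure lborel (box (l $ i) (u $ i)))"
    by (simp add: emeasure_distr measurable_vec_lambda measure_times)
  also have "\<dots> = (\<Prod>i\<in>UNIV. ennreal (\<Prod>b\<in>Basis. (u $ i - l $ i) \<bullet> b))"
    using le' by (simp add: emeasure_lborel_box)
  also have "\<dots> = ennreal (\<Prod>b\<in>Basis. (u - l) \<bullet> b)"
    using le' by (simp add: prod_ennreal prod_nonneg prod_Basis_vec inner_axis inner_diff_left)
  finally show "emeasure (distr (\<Pi>\<^sub>M i\<in>UNIV. lborel) borel vec_lambda) (box l u)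
    = ennreal (\<Prod>b\<in>Basis. (u - l) \<bullet> b)" .
qed simp

lemma
  fixes g :: "'d::finite \<Rightarrow> 'a::euclidean_space \<Rightarrow> 'b::{real_normed_field, banach, second_countable_topology}"
  assumes g: "\<And>i. integrable lborel (g i)"
  shows lborel_integrable_vec_prod: "integrable lborel (\<lambda>w. \<Prod>i\<in>UNIV. g i (w $ i))"
    and lborel_integral_vec_prod: "(LINT w|lborel. (\<Prod>i\<in>UNIV. g i (w $ i))) = (\<Prod>i\<in>UNIV. integral\<^sup>L lborel (g i))"
proof -
  interpret product_sigma_finite "\<lambda>_::'d. lborel :: 'a measure"
    by unfold_locales
  have gm [measurable]: "g i \<in> borel_measurable borel" for i
    using borel_measurable_integrable[OF g] by simp
  have pm: "(\<lambda>w::'a^'d. \<Prod>i\<in>UNIV. g i (w $ i)) \<in> borel_measurable borel"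
  proof (rule borel_measurable_prod)
    fix i
    have "(\<lambda>w::'a^'d. w $ i) \<in> borel_measurable borel"
      by (intro borel_measurable_continuous_onI continuous_intros)
    then show "(\<lambda>w::'a^'d. g i (w $ i)) \<in> borel_measurable borel" by measurable
  qed
  show "integrable lborel (\<lambda>w. \<Prod>i\<in>UNIV. g i (w $ i))"
    using product_integrable_prod[OF finite[of UNIV], of g] g
    by (subst lborel_vec_eq) (simp add: integrable_distr_eq[OF measurable_vec_lambda pm])
  show "(LINT w|lborel. (\<Prod>i\<in>UNIV. g i (w $ i))) = (\<Prod>i\<in>UNIV. integral\<^sup>L lborel (g i))"
    using product_integral_prod[OF finite[of UNIV], of g] g
    by (subst lborel_vec_eq) (simp add: integral_distr[OF measurable_vec_lambda pm])
qed

text \<open>Choosing \<open>q < 1\<close> yields a summable factor, at the price of a worse Gaussian exponent.\<close>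

lemma power_div_sqrt_fact_le:
  fixes x q :: real
  assumes "0 \<le> x" "0 < q"
  shows "x ^ n / sqrt (fact n) \<le> sqrt q ^ n * exp (x\<^sup>2 / (2 * q))"
proof -
  have "(x\<^sup>2 / q) ^ n / fact n \<le> exp (x\<^sup>2 / q)"
  proof -
    have "(\<lambda>n. (x\<^sup>2 / q) ^ n / fact n) sums exp (x\<^sup>2 / q)"
      using exp_converges[of "x\<^sup>2 / q"] by (simp add: divide_inverse mult.commute)
    then show ?thesis
      using sum_le_suminf[of "\<lambda>n. (x\<^sup>2 / q) ^ n / fact n" "{n}"] assms
      by (auto simp: sums_iff)
  qed
  then have "(x ^ n)\<^sup>2 / fact n \<le> q ^ n * exp (x\<^sup>2 / q)"
    using assms by (simp add: field_simps power_divide flip: power_mult)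
  then have "sqrt ((x ^ n)\<^sup>2 / fact n) \<le> sqrt (q ^ n * exp (x\<^sup>2 / q))" by (rule real_sqrt_le_mono)
  moreover have "sqrt (exp (x\<^sup>2 / q)) = exp (x\<^sup>2 / (2 * q))"
    by (rule real_sqrt_unique) (simp_all flip: exp_double)
  moreover have "sqrt ((x ^ n)\<^sup>2 / fact n) = x ^ n / sqrt (fact n)"
    using assms by (simp only: real_sqrt_divide real_sqrt_abs) simp
  ultimately show ?thesis
    by (simp only: real_sqrt_mult real_sqrt_power)
qed

section \<open>Gaussian integrability and moments\<close>

lemma integrable_exp_neg_square_real:
  assumes "0 < c"
  shows "integrable lborel (\<lambda>x::real. exp (- (c * x\<^sup>2)))"
proof -
  have "integrable lborel (\<lambda>x::real. exp (- x\<^sup>2))"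
    using has_bochner_integral_even_function[OF gaussian_moment_0]
    by (auto dest: has_bochner_integral_integrable simp: has_bochner_integral_iff)
  from lborel_integrable_real_affine[OF this, of "sqrt c" 0] show ?thesis
    using assms by (simp add: power_mult_distrib)
qed

lemma integrable_exp_neg_square_complex:
  assumes "0 < c"
  shows "integrable lborel (\<lambda>w::complex. exp (- (c * (cmod w)\<^sup>2)))"
proof -
  let ?g = "\<lambda>x::real. exp (- (c * x\<^sup>2))"
  have m: "(\<lambda>(x, y). Complex x y) \<in> measurable (lborel :: (real \<times> real) measure) borel"
    by (simp, intro borel_measurable_continuous_onI) (auto simp: case_prod_unfold intro!: continuous_intros)
  have "integrable (lborel \<Otimes>\<^sub>M lborel) (\<lambda>(x, y). ?g x * ?g y)"
    by (rule lborel_pair.Fubini_integrable)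
      (auto simp: case_prod_unfold abs_mult intro!: integrable_mult_right integrable_mult_left
        integrable_exp_neg_square_real assms)
  then show ?thesis
    unfolding lborel_prod
    unfolding lborel_complex_eq
    by (subst integrable_distr_eq[OF m])
       (simp_all add: case_prod_unfold cmod_def exp_add[symmetric] algebra_simps)
qed

lemma norm_vec_power2: "(norm (w :: complex ^ 'd::finite))\<^sup>2 = (\<Sum>i\<in>UNIV. (cmod (w $ i))\<^sup>2)"
  by (simp add: norm_vec_def L2_set_def sum_nonneg)

lemma integrable_exp_neg_square_vec:
  assumes "0 < c"
  shows "integrable lborel (\<lambda>w::complex ^ 'd::finite. exp (- (c * (norm w)\<^sup>2)))"
  using lborel_integrable_vec_prod[of "\<lambda>_::'d. \<lambda>w. exp (- (c * (cmod w)\<^sup>2))",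
      OF integrable_exp_neg_square_complex[OF assms]]
  by (simp add: norm_vec_power2 exp_sum sum_distrib_left flip: sum_negf)

definition gauss_moment :: "nat \<Rightarrow> complex" where
  "gauss_moment k = (LINT x|lborel. of_real (x ^ k * exp (- x\<^sup>2)))"

text \<open>The recursion is integration by parts, read off from the closed formulas for even and
  odd moments. At k = 0 the truncated \<open>k - 1\<close> is harmless because of the factor
  \<open>of_nat k\<close>.\<close>

lemma integrable_gauss_moment: "integrable lborel (\<lambda>x. of_real (x ^ k * exp (- x\<^sup>2)) :: complex)"
  and gauss_moment_0: "gauss_moment 0 = of_real (sqrt pi)"
  and gauss_moment_Suc: "gauss_moment (Suc k) = of_nat k / 2 * gauss_moment (k - 1)"
proof -
  have even: "has_bochner_integral lborel (\<lambda>x. exp (- x\<^sup>2) * x ^ (2 * k))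
      (sqrt pi * (fact (2 * k) / (2 ^ (2 * k) * fact k)))" for k
    using has_bochner_integral_even_function[OF gaussian_moment_even_pos[where k=k]] by simp
  have odd: "has_bochner_integral lborel (\<lambda>x::real. exp (- x\<^sup>2) * x ^ (2 * k + 1)) 0" for k
    using gaussian_moment_odd_pos by (rule has_bochner_integral_odd_function) simp
  have real: "has_bochner_integral lborel (\<lambda>x::real. x ^ k * exp (- x\<^sup>2))
      (if even k then sqrt pi * (fact k / (2 ^ k * fact (k div 2))) else 0)" for k
    using even[of "k div 2"] odd[of "k div 2"]
    by (cases "even k") (simp_all add: mult.commute odd_two_times_div_two_succ del: power_Suc)
  have cplx: "has_bochner_integral lborel (\<lambda>x::real. of_real (x ^ k * exp (- x\<^sup>2)) :: complex)
      (of_real (if even k then sqrt pi * (fact k / (2 ^ k * fact (k div 2))) else 0))" for k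
    by (rule has_bochner_integral_of_real[OF real])
  show "integrable lborel (\<lambda>x. of_real (x ^ k * exp (- x\<^sup>2)) :: complex)"
    by (rule integrable.intros[OF cplx])
  have g: "gauss_moment k = of_real (if even k then sqrt pi * (fact k / (2 ^ k * fact (k div 2))) else 0)" for k
    unfolding gauss_moment_def using cplx by (rule has_bochner_integral_integral_eq)
  show "gauss_moment 0 = of_real (sqrt pi)" by (simp add: g)
  show "gauss_moment (Suc k) = of_nat k / 2 * gauss_moment (k - 1)"
  proof (cases "odd k")
    case True
    then obtain m where k: "k = 2 * m + 1" by (rule oddE)
    have "fact (Suc k) / (2 ^ Suc k * fact (Suc k div 2))
        = real k / 2 * (fact (k - 1) / (2 ^ (k - 1) * fact ((k - 1) div 2)))"
      by (simp add: k divide_simps)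
    then have "sqrt pi * (fact (Suc k) / (2 ^ Suc k * fact (Suc k div 2)))
        = real k / 2 * (sqrt pi * (fact (k - 1) / (2 ^ (k - 1) * fact ((k - 1) div 2))))"
      by simp
    then have "complex_of_real (sqrt pi * (fact (Suc k) / (2 ^ Suc k * fact (Suc k div 2))))
        = complex_of_real (real k / 2 * (sqrt pi * (fact (k - 1) / (2 ^ (k - 1) * fact ((k - 1) div 2)))))"
      by (rule arg_cong)
    then show ?thesis using True
      unfolding g by (simp del: fact_Suc power_Suc)
  next
    case False
    then show ?thesis by (cases k) (simp_all add: g)
  qed
qed

text \<open>Since x exp (-x^2) is the derivative of -exp (-x^2) / 2, this is integration by parts
  against x^k P. Induction on P from the moment recursion avoids boundary terms. The power x^k is
  carried along because splitting off the constant coefficient of P turns k into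
  \<open>Suc k\<close>.\<close>

lemma gauss_poly_parts:
  fixes P :: "complex poly"
  shows "(LINT x|lborel. of_real x ^ Suc k * poly P (of_real x) * of_real (exp (- x\<^sup>2)))
      = of_nat k / 2 * (LINT x|lborel. of_real x ^ (k - 1) * poly P (of_real x) * of_real (exp (- x\<^sup>2)))
        + 1 / 2 * (LINT x|lborel. of_real x ^ k * poly (pderiv P) (of_real x) * of_real (exp (- x\<^sup>2)))"
proof -
  define L where "L k P = (LINT x|lborel. of_real x ^ k * poly P (of_real x) * of_real (exp (- x\<^sup>2)))"
    for k and P :: "complex poly"
  have int: "integrable lborel (\<lambda>x. of_real x ^ k * poly P (of_real x) * of_real (exp (- x\<^sup>2)))"
    for k and P :: "complex poly"
  proof (induction P arbitrary: k)
    case 0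
    show ?case by simp
  next
    case (pCons a P)
    have "integrable lborel (\<lambda>x. a * of_real (x ^ k * exp (- x\<^sup>2))
        + of_real x ^ Suc k * poly P (of_real x) * of_real (exp (- x\<^sup>2)))"
      by (intro Bochner_Integration.integrable_add integrable_mult_right integrable_gauss_moment pCons.IH)
    then show ?case by (simp add: algebra_simps)
  qed
  have L_pCons: "L k (pCons a P) = a * gauss_moment k + L (Suc k) P" for k a and P :: "complex poly"
  proof -
    have "L k (pCons a P) = (LINT x|lborel. a * of_real (x ^ k * exp (- x\<^sup>2))
        + of_real x ^ Suc k * poly P (of_real x) * of_real (exp (- x\<^sup>2)))"
      unfolding L_def by (simp add: algebra_simps)
    also have "\<dots> = a * gauss_moment k + L (Suc k) P"
      unfolding L_def gauss_moment_def
      by (subst Bochner_Integration.integral_add) (simp_all only: integrable_mult_right integrable_gauss_moment int integral_mult_right_zero)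
    finally show ?thesis .
  qed
  have L_add: "L k (P + Q) = L k P + L k Q" for k and P Q :: "complex poly"
    unfolding L_def
    by (subst Bochner_Integration.integral_add[symmetric]) (simp_all only: int, simp add: algebra_simps)
  have "L (Suc k) P = of_nat k / 2 * L (k - 1) P + 1 / 2 * L k (pderiv P)" for k and P :: "complex poly"
  proof (induction P arbitrary: k)
    case 0
    show ?case by (simp add: L_def)
  next
    case (pCons a P)

    have "L (Suc k) (pCons a P) = a * (of_nat k / 2 * gauss_moment (k - 1)) + L (Suc (Suc k)) P"
      by (simp add: L_pCons gauss_moment_Suc)
    also have "L (Suc (Suc k)) P = of_nat (Suc k) / 2 * L k P + 1 / 2 * L (Suc k) (pderiv P)"
      using pCons.IH[of "Suc k"] by simp
    also have "a * (of_nat k / 2 * gauss_moment (k - 1)) + (of_nat (Suc k) / 2 * L k P + 1 / 2 * L (Suc k) (pderiv P))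
        = of_nat k / 2 * L (k - 1) (pCons a P) + 1 / 2 * L k (pderiv (pCons a P))"
      by (cases k) (simp_all add: L_pCons L_add pderiv_pCons field_simps)
    finally show ?case .
  qed
  from this[of k P] show "(LINT x|lborel. of_real x ^ Suc k * poly P (of_real x) * of_real (exp (- x\<^sup>2)))
      = of_nat k / 2 * (LINT x|lborel. of_real x ^ (k - 1) * poly P (of_real x) * of_real (exp (- x\<^sup>2)))
        + 1 / 2 * (LINT x|lborel. of_real x ^ k * poly (pderiv P) (of_real x) * of_real (exp (- x\<^sup>2)))"
    unfolding L_def .
qed

text \<open>The recursion for these moments, and hence the orthogonality of the monomials, comes from
  integration by parts in the real and imaginary directions separately.\<close>

definition cgauss_moment :: "nat \<Rightarrow> nat \<Rightarrow> complex" where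
  "cgauss_moment n m = (LINT w|lborel. w ^ n * cnj w ^ m * of_real (exp (- (cmod w)\<^sup>2)))"

lemma power_mult_exp_neg_square_le:
  fixes x :: real
  assumes "0 \<le> x"
  shows "x ^ n * exp (- x\<^sup>2) \<le> sqrt (fact n) * exp (- (1 / 2 * x\<^sup>2))"
proof -
  have "x ^ n / sqrt (fact n) * exp (- x\<^sup>2) \<le> exp (x\<^sup>2 / 2) * exp (- x\<^sup>2)"
    using power_div_sqrt_fact_le[OF assms, of 1 n] by (intro mult_right_mono) simp_all
  also have "\<dots> = exp (- (1 / 2 * x\<^sup>2))" by (simp flip: exp_add)
  finally show ?thesis by (simp add: field_simps)
qed

lemma integrable_cgauss_moment:
  "integrable lborel (\<lambda>w. w ^ n * cnj w ^ m * of_real (exp (- (cmod w)\<^sup>2)))"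
proof (rule Bochner_Integration.integrable_bound)
  show "integrable lborel (\<lambda>w::complex. sqrt (fact (n + m)) * exp (- (1 / 2 * (cmod w)\<^sup>2)))"
    by (intro integrable_mult_right integrable_exp_neg_square_complex) simp
  show "AE w in lborel. norm (w ^ n * cnj w ^ m * of_real (exp (- (cmod w)\<^sup>2)))
      \<le> norm (sqrt (fact (n + m)) * exp (- (1 / 2 * (cmod w)\<^sup>2)))"
    using power_mult_exp_neg_square_le[OF norm_ge_zero]
    by (intro AE_I2) (simp add: norm_mult norm_power flip: power_add)
qed (simp, intro borel_measurable_continuous_onI continuous_intros)

text \<open>Along a horizontal line \<open>w ^ n * cnj w ^ m\<close> is a polynomial in Re w, along
  a vertical line a polynomial in Im w. Integration by parts on each line, followed by Fubini,
  trades the factor Re w or Im w for half the partial derivative, which lowers n or m by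
  one.\<close>

lemma
  shows integrable_cgauss_moment_Re: "integrable lborel (\<lambda>w. of_real (Re w) * (w ^ n * cnj w ^ m * of_real (exp (- (cmod w)\<^sup>2))))"
    and integrable_cgauss_moment_Im: "integrable lborel (\<lambda>w. of_real (Im w) * (w ^ n * cnj w ^ m * of_real (exp (- (cmod w)\<^sup>2))))"
    and cgauss_moment_Re_parts:
      "(LINT w|lborel. of_real (Re w) * (w ^ n * cnj w ^ m * of_real (exp (- (cmod w)\<^sup>2))))
        = 1 / 2 * (of_nat n * cgauss_moment (n - 1) m + of_nat m * cgauss_moment n (m - 1))"
    and cgauss_moment_Im_parts:
      "(LINT w|lborel. of_real (Im w) * (w ^ n * cnj w ^ m * of_real (exp (- (cmod w)\<^sup>2))))
        = \<i> / 2 * (of_nat n * cgauss_moment (n - 1) m - of_nat m * cgauss_moment n (m - 1))"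
proof -
  define E where "E w = (of_real (exp (- (cmod w)\<^sup>2)) :: complex)" for w
  define F where "F n m w = w ^ n * cnj w ^ m * E w" for n m w
  have E: "E (Complex x y) = of_real (exp (- x\<^sup>2)) * of_real (exp (- y\<^sup>2))" for x y
    by (simp add: E_def cmod_def flip: of_real_mult exp_add)
  have F_int: "integrable lborel (F n m)" for n m
    using integrable_cgauss_moment[of n m] by (simp add: F_def[abs_def] E_def)
  have F_cgauss_moment: "integral\<^sup>L lborel (F n m) = cgauss_moment n m" for n m
    by (simp add: F_def[abs_def] E_def cgauss_moment_def)
  have Re_int: "integrable lborel (\<lambda>w. of_real (Re w) * F n m w)" for n m
  proof -
    have "integrable lborel (\<lambda>w. 1 / 2 * (F (Suc n) m w + F n (Suc m) w))"
      by (intro integrable_mult_right Bochner_Integration.integrable_add F_int)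
    also have "(\<lambda>w. 1 / 2 * (F (Suc n) m w + F n (Suc m) w)) = (\<lambda>w. 1 / 2 * (w + cnj w) * F n m w)"
      by (simp add: F_def fun_eq_iff algebra_simps)
    finally show ?thesis by (simp add: complex_add_cnj)
  qed
  have Im_int: "integrable lborel (\<lambda>w. of_real (Im w) * F n m w)" for n m
  proof -
    have "integrable lborel (\<lambda>w. - \<i> / 2 * (F (Suc n) m w - F n (Suc m) w))"
      by (intro integrable_mult_right Bochner_Integration.integrable_diff F_int)
    also have "(\<lambda>w. - \<i> / 2 * (F (Suc n) m w - F n (Suc m) w)) = (\<lambda>w. - \<i> / 2 * (w - cnj w) * F n m w)"
      by (simp add: F_def fun_eq_iff field_simps)
    also have "\<dots> = (\<lambda>w. of_real (Im w) * F n m w)"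
      by (simp add: fun_eq_iff complex_diff_cnj mult.left_commute[of \<i>])
    finally show ?thesis .
  qed
  show "integrable lborel (\<lambda>w. of_real (Re w) * (w ^ n * cnj w ^ m * of_real (exp (- (cmod w)\<^sup>2))))"
    "integrable lborel (\<lambda>w. of_real (Im w) * (w ^ n * cnj w ^ m * of_real (exp (- (cmod w)\<^sup>2))))"
    using Re_int[of n m] Im_int[of n m] by (simp_all add: F_def E_def)
  have parts: "(LINT x|lborel. of_real x * (poly P (of_real x) * (of_real (exp (- x\<^sup>2)) * c)))
      = 1 / 2 * (LINT x|lborel. poly (pderiv P) (of_real x) * (of_real (exp (- x\<^sup>2)) * c))"
    for P :: "complex poly" and c
  proof -
    have "(LINT x|lborel. of_real x * (poly P (of_real x) * (of_real (exp (- x\<^sup>2)) * c)))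
        = (LINT x|lborel. of_real x ^ Suc 0 * poly P (of_real x) * of_real (exp (- x\<^sup>2)) * c)"
      by (simp add: mult_ac)
    also have "\<dots> = (LINT x|lborel. of_real x ^ Suc 0 * poly P (of_real x) * of_real (exp (- x\<^sup>2))) * c"
      by (rule integral_mult_left_zero)
    also have "\<dots> = 1 / 2 * ((LINT x|lborel. poly (pderiv P) (of_real x) * of_real (exp (- x\<^sup>2))) * c)"
      unfolding gauss_poly_parts by simp
    also have "(LINT x|lborel. poly (pderiv P) (of_real x) * of_real (exp (- x\<^sup>2))) * c
        = (LINT x|lborel. poly (pderiv P) (of_real x) * of_real (exp (- x\<^sup>2)) * c)"
      by (rule integral_mult_left_zero[symmetric])
    finally show ?thesis by (simp only: mult.assoc)
  qed
  \<comment> \<open>\<open>G\<close> and, below, \<open>H\<close> are the partial derivatives of the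
    monomial in x and in y, multiplied by the Gaussian weight.\<close>
  define G where "G w = of_nat n * F (n - 1) m w + of_nat m * F n (m - 1) w" for w
  have G_int: "integrable lborel G"
    unfolding G_def[abs_def] by (intro Bochner_Integration.integrable_add integrable_mult_right F_int)
  define H where "H w = \<i> * (of_nat n * F (n - 1) m w - of_nat m * F n (m - 1) w)" for w
  have H_int: "integrable lborel H"
    unfolding H_def[abs_def] by (intro Bochner_Integration.integrable_diff integrable_mult_right F_int)
  have "(LINT w|lborel. of_real (Re w) * F n m w) = (LINT y|lborel. LINT x|lborel. of_real x * F n m (Complex x y))"
    by (subst lborel_integral_complex_fst[OF Re_int]) simp
  also have "\<dots> = (LINT y|lborel. 1 / 2 * (LINT x|lborel. G (Complex x y)))"
  proof (rule Bochner_Integration.integral_cong[OF refl])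
    fix y :: real
    \<comment> \<open>The two linear factors are w and \<open>cnj w\<close> as polynomials in x, for
      fixed y.\<close>
    let ?P = "[:\<i> * of_real y, 1:] ^ n * [:- \<i> * of_real y, 1:] ^ m"
    have W: "of_real x + \<i> * of_real y = Complex x y" "of_real x - \<i> * of_real y = cnj (Complex x y)" for x
      by (simp_all add: complex_eq_iff)
    have "F n m (Complex x y) = poly ?P (of_real x) * (of_real (exp (- x\<^sup>2)) * of_real (exp (- y\<^sup>2)))" for x
      unfolding F_def E by (simp add: poly_power add.commute[of "\<i> * of_real y"] W flip: minus_mult_left)
    moreover have "G (Complex x y) = poly (pderiv ?P) (of_real x) * (of_real (exp (- x\<^sup>2)) * of_real (exp (- y\<^sup>2)))" for x
      unfolding G_def F_def E
      by (simp add: pderiv_mult pderiv_power pderiv_pCons poly_power add.commute[of "\<i> * of_real y"] W algebra_simps)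
    ultimately show "(LINT x|lborel. of_real x * F n m (Complex x y)) = 1 / 2 * (LINT x|lborel. G (Complex x y))"
      by (simp only: parts)
  qed
  also have "\<dots> = 1 / 2 * (LINT y|lborel. LINT x|lborel. G (Complex x y))"
    by (rule integral_mult_right_zero)
  also have "\<dots> = 1 / 2 * integral\<^sup>L lborel G"
    by (simp only: lborel_integral_complex_fst[OF G_int])
  also have "integral\<^sup>L lborel G = of_nat n * cgauss_moment (n - 1) m + of_nat m * cgauss_moment n (m - 1)"
    unfolding G_def[abs_def]
    by (subst Bochner_Integration.integral_add) (simp_all add: F_int F_cgauss_moment)
  finally show "(LINT w|lborel. of_real (Re w) * (w ^ n * cnj w ^ m * of_real (exp (- (cmod w)\<^sup>2))))
      = 1 / 2 * (of_nat n * cgauss_moment (n - 1) m + of_nat m * cgauss_moment n (m - 1))"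
    by (simp add: F_def E_def)
  have "(LINT w|lborel. of_real (Im w) * F n m w) = (LINT x|lborel. LINT y|lborel. of_real y * F n m (Complex x y))"
    by (subst lborel_integral_complex_snd[OF Im_int]) simp
  also have "\<dots> = (LINT x|lborel. 1 / 2 * (LINT y|lborel. H (Complex x y)))"
  proof (rule Bochner_Integration.integral_cong[OF refl])
    fix x :: real
    let ?P = "[:of_real x, \<i>:] ^ n * [:of_real x, - \<i>:] ^ m"
    have W: "of_real x + \<i> * of_real y = Complex x y" "of_real x - \<i> * of_real y = cnj (Complex x y)" for y
      by (simp_all add: complex_eq_iff)
    have "F n m (Complex x y) = poly ?P (of_real y) * (of_real (exp (- y\<^sup>2)) * of_real (exp (- x\<^sup>2)))" for y
      unfolding F_def E by (simp add: poly_power mult.commute[of "of_real y"] W)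
    moreover have "H (Complex x y) = poly (pderiv ?P) (of_real y) * (of_real (exp (- y\<^sup>2)) * of_real (exp (- x\<^sup>2)))" for y
      unfolding H_def F_def E
      by (simp add: pderiv_mult pderiv_power pderiv_pCons poly_power mult.commute[of "of_real y"] W algebra_simps)
    ultimately show "(LINT y|lborel. of_real y * F n m (Complex x y)) = 1 / 2 * (LINT y|lborel. H (Complex x y))"
      by (simp only: parts)
  qed
  also have "\<dots> = 1 / 2 * (LINT x|lborel. LINT y|lborel. H (Complex x y))"
    by (rule integral_mult_right_zero)
  also have "\<dots> = 1 / 2 * integral\<^sup>L lborel H"
    by (simp only: lborel_integral_complex_snd[OF H_int])
  also have "integral\<^sup>L lborel H = \<i> * (of_nat n * cgauss_moment (n - 1) m - of_nat m * cgauss_moment n (m - 1))"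
    unfolding H_def[abs_def] integral_mult_right_zero
    by (subst Bochner_Integration.integral_diff) (simp_all add: F_int F_cgauss_moment)
  finally show "(LINT w|lborel. of_real (Im w) * (w ^ n * cnj w ^ m * of_real (exp (- (cmod w)\<^sup>2))))
      = \<i> / 2 * (of_nat n * cgauss_moment (n - 1) m - of_nat m * cgauss_moment n (m - 1))"
    by (simp add: F_def E_def)
qed

text \<open>Integration by parts for the Wirtinger derivatives: adding \<i> times the formula for Im
  w to that for Re w cancels the terms with factor n, and subtracting it cancels those with factor
  m.\<close>

lemma
  shows cgauss_moment_Suc_left: "cgauss_moment (Suc n) m = of_nat m * cgauss_moment n (m - 1)"
    and cgauss_moment_Suc_right: "cgauss_moment n (Suc m) = of_nat n * cgauss_moment (n - 1) m"
proof -
  let ?F = "\<lambda>w. w ^ n * cnj w ^ m * of_real (exp (- (cmod w)\<^sup>2))"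
  have cnj_eq: "of_real (Re w) - \<i> * of_real (Im w) = cnj w" for w
    by (simp add: complex_eq_iff)
  have "w ^ Suc n * cnj w ^ m * of_real (exp (- (cmod w)\<^sup>2)) = of_real (Re w) * ?F w + \<i> * (of_real (Im w) * ?F w)" for w
  proof -
    have "w ^ Suc n * cnj w ^ m * of_real (exp (- (cmod w)\<^sup>2)) = (of_real (Re w) + \<i> * of_real (Im w)) * ?F w"
      by (simp only: complex_eq[symmetric] power_Suc mult_ac)
    then show ?thesis by (simp only: distrib_right left_diff_distrib mult.assoc)
  qed
  then have "cgauss_moment (Suc n) m = (LINT w|lborel. of_real (Re w) * ?F w + \<i> * (of_real (Im w) * ?F w))"
    unfolding cgauss_moment_def by (simp only:)
  also have "\<dots> = (LINT w|lborel. of_real (Re w) * ?F w) + \<i> * (LINT w|lborel. of_real (Im w) * ?F w)"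
    by (subst Bochner_Integration.integral_add)
       (simp_all only: integrable_cgauss_moment_Re integrable_cgauss_moment_Im integrable_mult_right integral_mult_right_zero)
  finally show "cgauss_moment (Suc n) m = of_nat m * cgauss_moment n (m - 1)"
    unfolding cgauss_moment_Re_parts cgauss_moment_Im_parts by (simp add: algebra_simps)
  have "w ^ n * cnj w ^ Suc m * of_real (exp (- (cmod w)\<^sup>2)) = of_real (Re w) * ?F w - \<i> * (of_real (Im w) * ?F w)" for w
  proof -
    have "w ^ n * cnj w ^ Suc m * of_real (exp (- (cmod w)\<^sup>2)) = (of_real (Re w) - \<i> * of_real (Im w)) * ?F w"
      by (simp only: cnj_eq power_Suc mult_ac)
    then show ?thesis by (simp only: distrib_right left_diff_distrib mult.assoc)
  qed
  then have "cgauss_moment n (Suc m) = (LINT w|lborel. of_real (Re w) * ?F w - \<i> * (of_real (Im w) * ?F w))"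
    unfolding cgauss_moment_def by (simp only:)
  also have "\<dots> = (LINT w|lborel. of_real (Re w) * ?F w) - \<i> * (LINT w|lborel. of_real (Im w) * ?F w)"
    by (subst Bochner_Integration.integral_diff)
       (simp_all only: integrable_cgauss_moment_Re integrable_cgauss_moment_Im integrable_mult_right integral_mult_right_zero)
  finally show "cgauss_moment n (Suc m) = of_nat n * cgauss_moment (n - 1) m"
    unfolding cgauss_moment_Re_parts cgauss_moment_Im_parts by (simp add: algebra_simps)
qed

text \<open>Each use of the recursion lowers both exponents, so unequal ones end in a factor 0 and
  equal ones in the total mass pi.\<close>

lemma cgauss_moment_eq: "cgauss_moment n m = (if n = m then of_real pi * fact n else 0)"
proof (induction n arbitrary: m)
  case 0
  show ?case
  proof (cases m)
    case 0
    have E: "of_real (exp (- (cmod (Complex x y))\<^sup>2)) = (of_real (exp (- x\<^sup>2)) * of_real (exp (- y\<^sup>2)) :: complex)" for x y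
      by (simp add: cmod_def flip: of_real_mult exp_add)
    have "cgauss_moment 0 0 = (LINT y|lborel. LINT x|lborel. of_real (exp (- x\<^sup>2)) * of_real (exp (- y\<^sup>2)))"
      unfolding cgauss_moment_def lborel_integral_complex_fst[OF integrable_cgauss_moment] E by simp
    also have "\<dots> = gauss_moment 0 * gauss_moment 0"
      by (simp only: gauss_moment_def power_0 mult_1 integral_mult_left_zero integral_mult_right_zero)
    finally show ?thesis using 0 by (simp add: gauss_moment_0 flip: of_real_mult)
  qed (simp add: cgauss_moment_Suc_right)
next
  case (Suc n)
  show ?case by (cases m) (simp_all add: cgauss_moment_Suc_left Suc.IH)
qed

section \<open>Sums over multi-indices and their exhaustion by degree\<close>

lemma has_sum_multi_vec:
  "((\<lambda>\<alpha>::nat ^ 'd::finite. h (vec_nth \<alpha>)) has_sum S) UNIV \<longleftrightarrow> (h has_sum S) (multi_supp UNIV)"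
  by (rule has_sum_reindex_bij_witness[where j = vec_nth and i = vec_lambda]) (auto simp: multi_supp_UNIV)

lemma has_sum_prod_vec:
  fixes g :: "'d::finite \<Rightarrow> nat \<Rightarrow> real"
  assumes "\<And>i. (g i has_sum G i) UNIV" "\<And>i k. 0 \<le> g i k"
  shows "((\<lambda>\<alpha>::nat ^ 'd. \<Prod>i\<in>UNIV. g i (\<alpha> $ i)) has_sum (\<Prod>i\<in>UNIV. G i)) UNIV"
  using has_sum_prod_multi_supp[of UNIV g G] assms
  by (simp add: has_sum_multi_vec[of "\<lambda>\<alpha>. \<Prod>i\<in>UNIV. g i (\<alpha> i)"])

lemma prod_power_mabs: "(\<Prod>i\<in>UNIV. x ^ (\<alpha> $ i)) = x ^ mabs \<alpha>"
  by (simp add: mabs_def power_sum)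

lemma has_sum_power_mabs:
  fixes x :: real
  assumes "0 \<le> x" "x < 1"
  shows "((\<lambda>\<alpha>::nat ^ 'd::finite. x ^ mabs \<alpha>) has_sum (1 / (1 - x)) ^ CARD('d)) UNIV"
proof -
  have "((\<lambda>k. x ^ k) has_sum 1 / (1 - x)) UNIV"
    using geometric_sums[of x] assms by (intro sums_nonneg_imp_has_sum) auto
  from has_sum_prod_vec[of "\<lambda>_::'d. \<lambda>k. x ^ k", OF this] show ?thesis
    using assms by (simp add: prod_power_mabs)
qed

definition mindex_le :: "nat \<Rightarrow> (nat ^ 'd::finite) set" where
  "mindex_le N = {\<alpha>. mabs \<alpha> \<le> N}"

lemma le_mabs: "\<alpha> $ i \<le> mabs \<alpha>"
  unfolding mabs_def by (rule member_le_sum) auto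

lemma finite_mindex_le: "finite (mindex_le N)"
proof (rule finite_subset)
  show "mindex_le N \<subseteq> vec_lambda ` (\<Pi>\<^sub>E i\<in>UNIV. {..N})"
  proof
    fix \<alpha> :: "nat ^ 'd" assume "\<alpha> \<in> mindex_le N"
    then have "vec_nth \<alpha> \<in> (\<Pi>\<^sub>E i\<in>UNIV. {..N})"
      using le_mabs order_trans by (fastforce simp: mindex_le_def)
    then show "\<alpha> \<in> vec_lambda ` (\<Pi>\<^sub>E i\<in>UNIV. {..N})"
      by (metis image_eqI vec_nth_inverse)
  qed
qed (intro finite_imageI finite_PiE, auto)

text \<open>Turns an unordered sum into the limit of a sequence of finite partial sums, the form in
  which dominated convergence is applied.\<close>

lemma filterlim_mindex_le: "filterlim mindex_le (finite_subsets_at_top UNIV) sequentially"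
  unfolding filterlim_finite_subsets_at_top
proof (intro allI impI)
  fix X :: "(nat ^ 'd) set" assume X: "finite X \<and> X \<subseteq> UNIV"
  have "\<forall>\<^sub>F N in sequentially. Max (insert 0 (mabs ` X)) \<le> N" by (rule eventually_ge_at_top)
  then show "\<forall>\<^sub>F N in sequentially. finite (mindex_le N) \<and> X \<subseteq> mindex_le N \<and> mindex_le N \<subseteq> (UNIV :: (nat ^ 'd) set)"
    by eventually_elim (use X finite_mindex_le in \<open>auto simp: mindex_le_def\<close>)
qed

lemma has_sum_mindex_le:
  assumes "(f has_sum S) UNIV"
  shows "(\<lambda>N. \<Sum>\<alpha>\<in>mindex_le N. f \<alpha>) \<longlonglongrightarrow> S"
  using filterlim_compose[OF assms[unfolded has_sum_def] filterlim_mindex_le] .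

lemma sqrt_prod: "sqrt (\<Prod>i\<in>A. f i) = (\<Prod>i\<in>A. sqrt (f i))"
  by (induction A rule: infinite_finite_induct) (simp_all add: real_sqrt_mult)

lemma e_basis_prod:
  "e_basis \<alpha> z = (\<Prod>i\<in>UNIV. z $ i ^ (\<alpha> $ i) / of_real (sqrt (fact (\<alpha> $ i))))"
  by (simp add: e_basis_def mfact_def prod_dividef sqrt_prod of_nat_prod flip: of_real_prod)

lemma continuous_e_basis: "continuous_on A (e_basis \<alpha>)"
  unfolding e_basis_def by (intro continuous_intros) (simp add: mfact_def)

lemma norm_e_basis_le:
  assumes "0 < q"
  shows "cmod (e_basis \<alpha> z) \<le> sqrt q ^ mabs \<alpha> * exp ((norm z)\<^sup>2 / (2 * q))"
proof -
  have "cmod (e_basis \<alpha> z) = (\<Prod>i\<in>UNIV. cmod (z $ i) ^ (\<alpha> $ i) / sqrt (fact (\<alpha> $ i)))"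
    by (simp add: e_basis_prod norm_divide norm_power flip: prod_norm)
  also have "\<dots> \<le> (\<Prod>i\<in>UNIV. sqrt q ^ (\<alpha> $ i) * exp ((cmod (z $ i))\<^sup>2 / (2 * q)))"
    using assms by (intro prod_mono conjI power_div_sqrt_fact_le) auto
  also have "\<dots> = sqrt q ^ mabs \<alpha> * exp ((norm z)\<^sup>2 / (2 * q))"
    by (simp add: prod.distrib prod_power_mabs norm_vec_power2 sum_divide_distrib exp_sum)
  finally show ?thesis .
qed

section \<open>Integration against the Gaussian measure\<close>

definition gauss_density :: "complex ^ 'd::finite \<Rightarrow> real" where
  "gauss_density w = exp (- (norm w)\<^sup>2) / pi ^ CARD('d)"

lemma gauss_density_nonneg: "0 \<le> gauss_density w"
  and gauss_density_measurable [measurable]: "gauss_density \<in> borel_measurable borel"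
  unfolding gauss_density_def
  by (simp, intro borel_measurable_continuous_onI continuous_intros, simp)

lemma
  fixes f :: "complex ^ 'd::finite \<Rightarrow> complex"
  assumes f: "f \<in> borel_measurable borel"
  shows integrable_gauss: "integrable gauss_measure f \<longleftrightarrow> integrable lborel (\<lambda>w. gauss_density w *\<^sub>R f w)"
    and integral_gauss: "integral\<^sup>L gauss_measure f = (LINT w|lborel. gauss_density w *\<^sub>R f w)"
proof -
  have eq: "gauss_measure = density lborel (\<lambda>w. ennreal (gauss_density w))"
    by (simp add: gauss_measure_def gauss_density_def)
  show "integrable gauss_measure f \<longleftrightarrow> integrable lborel (\<lambda>w. gauss_density w *\<^sub>R f w)"
    unfolding eq by (rule integrable_density) (use f gauss_density_nonneg in auto)
  show "integral\<^sup>L gauss_measure f = (LINT w|lborel. gauss_density w *\<^sub>R f w)"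
    unfolding eq by (rule integral_density) (use f gauss_density_nonneg in auto)
qed

text \<open>Density and monomials factor over the coordinates. In each coordinate pi cancels the
  constant of the density, and the factorial cancels the two square roots of the
  normalisation.\<close>

lemma
  fixes \<beta> \<gamma> :: "nat ^ 'd::finite"
  shows integrable_e_basis: "integrable gauss_measure (\<lambda>w. cnj (e_basis \<gamma> w) * e_basis \<beta> w)"
    and e_basis_orthonormal: "(LINT w|gauss_measure. cnj (e_basis \<gamma> w) * e_basis \<beta> w) = (if \<gamma> = \<beta> then 1 else 0)"
proof -
  define g :: "'d \<Rightarrow> complex \<Rightarrow> complex" where
    "g i u = (u ^ (\<beta> $ i) * cnj u ^ (\<gamma> $ i) * of_real (exp (- (cmod u)\<^sup>2))) *
      (1 / (of_real pi * of_real (sqrt (fact (\<beta> $ i))) * of_real (sqrt (fact (\<gamma> $ i)))))" for i u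
  have m: "(\<lambda>w. cnj (e_basis \<gamma> w) * e_basis \<beta> w) \<in> borel_measurable borel"
    by (intro borel_measurable_continuous_onI continuous_intros continuous_e_basis)
  have eq: "gauss_density w *\<^sub>R (cnj (e_basis \<gamma> w) * e_basis \<beta> w) = (\<Prod>i\<in>UNIV. g i (w $ i))" for w
  proof -
    have "complex_of_real (gauss_density w) = (\<Prod>i\<in>UNIV. of_real (exp (- (cmod (w $ i))\<^sup>2)) / of_real pi)"
      by (simp add: gauss_density_def norm_vec_power2 exp_sum prod_dividef flip: sum_negf)
    then show ?thesis
      by (simp add: scaleR_conv_of_real e_basis_prod g_def prod.distrib[symmetric] mult_ac)
  qed
  have gi: "integrable lborel (g i)" for i
    unfolding g_def[abs_def] by (intro integrable_mult_left integrable_cgauss_moment)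
  have cgauss_moment: "integral\<^sup>L lborel (g i) = (if \<gamma> $ i = \<beta> $ i then 1 else 0)" for i
    unfolding g_def[abs_def] integral_mult_left_zero cgauss_moment_def[symmetric] cgauss_moment_eq
    by (simp add: mult.assoc flip: of_real_mult) simp
  show "integrable gauss_measure (\<lambda>w. cnj (e_basis \<gamma> w) * e_basis \<beta> w)"
    unfolding integrable_gauss[OF m] eq by (rule lborel_integrable_vec_prod[OF gi])
  show "(LINT w|gauss_measure. cnj (e_basis \<gamma> w) * e_basis \<beta> w) = (if \<gamma> = \<beta> then 1 else 0)"
    unfolding integral_gauss[OF m] eq lborel_integral_vec_prod[OF gi] cgauss_moment
    by (auto simp: vec_eq_iff)
qed

text \<open>\<open>norm_e_basis_le\<close> with q = 2/3 yields sqrt (2/3)^|\<gamma>| exp (3/4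
  |w|^2). The permitted growth leaves the ratio sqrt (5/4) sqrt (2/3) = sqrt (5/6) < 1, so the
  series is geometric, and 3/4 < 1 keeps the majorant below the decay of the Gaussian.\<close>

lemma
  fixes d :: "nat ^ 'd::finite \<Rightarrow> complex"
  assumes \<delta>: "exp \<delta> \<le> sqrt (5 / 4)" and d: "\<And>\<gamma>. cmod (d \<gamma>) \<le> C * exp (\<delta> * mabs \<gamma>)" and "0 \<le> C"
  shows e_basis_series_sum_le: "finite X \<Longrightarrow> (\<Sum>\<gamma>\<in>X. cmod (d \<gamma> * e_basis \<gamma> w)) \<le>
      C * (1 / (1 - sqrt (5 / 6))) ^ CARD('d) * exp (3 / 4 * (norm w)\<^sup>2)"
    and e_basis_series_summable: "(\<lambda>\<gamma>. cmod (d \<gamma> * e_basis \<gamma> w)) summable_on UNIV"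
proof -
  have sums: "((\<lambda>\<alpha>::nat ^ 'd. sqrt (5 / 6) ^ mabs \<alpha>) has_sum (1 / (1 - sqrt (5 / 6))) ^ CARD('d)) UNIV"
    by (rule has_sum_power_mabs) (auto intro: real_less_lsqrt)
  have le: "cmod (d \<gamma> * e_basis \<gamma> w) \<le> C * exp (3 / 4 * (norm w)\<^sup>2) * sqrt (5 / 6) ^ mabs \<gamma>" for \<gamma>
  proof -
    have "cmod (d \<gamma> * e_basis \<gamma> w) \<le> (C * exp (\<delta> * mabs \<gamma>)) * (sqrt (2 / 3) ^ mabs \<gamma> * exp ((norm w)\<^sup>2 / (2 * (2 / 3))))"
      unfolding norm_mult using \<open>0 \<le> C\<close> by (intro mult_mono d norm_e_basis_le) auto
    also have "\<dots> = C * exp (3 / 4 * (norm w)\<^sup>2) * (exp \<delta> * sqrt (2 / 3)) ^ mabs \<gamma>"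
      by (simp add: power_mult_distrib exp_of_nat2_mult mult_ac)
    also have "\<dots> \<le> C * exp (3 / 4 * (norm w)\<^sup>2) * sqrt (5 / 6) ^ mabs \<gamma>"
      using \<open>0 \<le> C\<close> mult_right_mono[OF \<delta>, of "sqrt (2 / 3)"]
      by (intro mult_left_mono power_mono) (simp_all flip: real_sqrt_mult)
    finally show ?thesis .
  qed
  have sums': "((\<lambda>\<gamma>::nat ^ 'd. C * exp (3 / 4 * (norm w)\<^sup>2) * sqrt (5 / 6) ^ mabs \<gamma>) has_sum
      C * exp (3 / 4 * (norm w)\<^sup>2) * (1 / (1 - sqrt (5 / 6))) ^ CARD('d)) UNIV"
    by (intro has_sum_cmult_right sums)
  show "(\<lambda>\<gamma>. cmod (d \<gamma> * e_basis \<gamma> w)) summable_on UNIV"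
    by (rule summable_on_comparison_test[OF has_sum_imp_summable[OF sums']]) (use le in auto)
  assume X: "finite X"
  have "(\<Sum>\<gamma>\<in>X. cmod (d \<gamma> * e_basis \<gamma> w)) \<le> (\<Sum>\<gamma>\<in>X. C * exp (3 / 4 * (norm w)\<^sup>2) * sqrt (5 / 6) ^ mabs \<gamma>)"
    by (intro sum_mono le)
  also have "\<dots> \<le> C * exp (3 / 4 * (norm w)\<^sup>2) * (1 / (1 - sqrt (5 / 6))) ^ CARD('d)"
    by (rule finite_sum_le_has_sum[OF sums' X]) (use \<open>0 \<le> C\<close> in auto)
  finally show "(\<Sum>\<gamma>\<in>X. cmod (d \<gamma> * e_basis \<gamma> w)) \<le>
      C * (1 / (1 - sqrt (5 / 6))) ^ CARD('d) * exp (3 / 4 * (norm w)\<^sup>2)"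
    by (simp add: mult_ac)
qed

text \<open>By orthonormality the partial sum over \<open>mindex_le N\<close> integrates to d
  \<beta> once N \<ge> |\<beta>|; dominated convergence passes to the limit. In the exponent of the
  majorant, -1 comes from the density, 3/4 from the series and 1/8 from
  \<open>e_basis \<beta>\<close> estimated with q = 4, which leaves -1/8.\<close>

lemma
  fixes d :: "nat ^ 'd::finite \<Rightarrow> complex"
  assumes \<delta>: "exp \<delta> \<le> sqrt (5 / 4)" and d: "\<And>\<gamma>. cmod (d \<gamma>) \<le> C * exp (\<delta> * mabs \<gamma>)"
    and k: "\<And>w. ((\<lambda>\<gamma>. d \<gamma> * cnj (e_basis \<gamma> w)) has_sum k w) UNIV"
  shows integrable_gauss_antiholomorphic: "integrable gauss_measure (\<lambda>w. k w * e_basis \<beta> w)"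
    and integral_gauss_antiholomorphic: "(LINT w|gauss_measure. k w * e_basis \<beta> w) = d \<beta>"
proof -
  have "0 \<le> C * exp (\<delta> * mabs (0 :: nat ^ 'd))" using d[of 0] norm_ge_zero order_trans by blast
  then have C: "0 \<le> C" by (simp add: zero_le_mult_iff)
  define B where "B = C * (1 / (1 - sqrt (5 / 6))) ^ CARD('d) * 2 ^ mabs \<beta> / pi ^ CARD('d)"
  define s where "s N w = (\<Sum>\<gamma>\<in>mindex_le N. d \<gamma> * (cnj (e_basis \<gamma> w) * e_basis \<beta> w))" for N w
  have s_eq: "s N w = (\<Sum>\<gamma>\<in>mindex_le N. d \<gamma> * cnj (e_basis \<gamma> w)) * e_basis \<beta> w" for N w
    by (simp add: s_def sum_distrib_right mult.assoc)
  have lim: "(\<lambda>N. s N w) \<longlonglongrightarrow> k w * e_basis \<beta> w" for w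
    unfolding s_eq by (intro tendsto_mult has_sum_mindex_le k tendsto_const)
  have sm [measurable]: "s N \<in> borel_measurable borel" for N
    unfolding s_def[abs_def]
    by (intro borel_measurable_continuous_onI continuous_intros continuous_e_basis)
  have km [measurable]: "(\<lambda>w. k w * e_basis \<beta> w) \<in> borel_measurable borel"
    by (rule borel_measurable_LIMSEQ_metric[OF sm lim])
  have bound: "norm (gauss_density w *\<^sub>R s N w) \<le> B * exp (- (1 / 8 * (norm w)\<^sup>2))" for N w
  proof -
    have "cmod (\<Sum>\<gamma>\<in>mindex_le N. d \<gamma> * cnj (e_basis \<gamma> w)) \<le> (\<Sum>\<gamma>\<in>mindex_le N. cmod (d \<gamma> * e_basis \<gamma> w))"
      by (rule order_trans[OF norm_sum]) (simp add: norm_mult)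
    also have "\<dots> \<le> C * (1 / (1 - sqrt (5 / 6))) ^ CARD('d) * exp (3 / 4 * (norm w)\<^sup>2)"
      by (rule e_basis_series_sum_le[OF \<delta> d C finite_mindex_le])
    finally have "cmod (s N w) \<le> (C * (1 / (1 - sqrt (5 / 6))) ^ CARD('d) * exp (3 / 4 * (norm w)\<^sup>2)) *
        (2 ^ mabs \<beta> * exp ((norm w)\<^sup>2 / (2 * 4)))"
      using norm_e_basis_le[of 4 \<beta> w] C unfolding s_eq norm_mult
      by (intro mult_mono) (auto intro!: mult_nonneg_nonneg)
    then have "gauss_density w * cmod (s N w) \<le> gauss_density w *
        ((C * (1 / (1 - sqrt (5 / 6))) ^ CARD('d) * exp (3 / 4 * (norm w)\<^sup>2)) *
        (2 ^ mabs \<beta> * exp ((norm w)\<^sup>2 / (2 * 4))))"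
      by (rule mult_left_mono[OF _ gauss_density_nonneg])
    also have "\<dots> = B * (exp (- (norm w)\<^sup>2) * exp (3 / 4 * (norm w)\<^sup>2) * exp ((norm w)\<^sup>2 / (2 * 4)))"
      by (simp add: B_def gauss_density_def mult_ac)
    also have "exp (- (norm w)\<^sup>2) * exp (3 / 4 * (norm w)\<^sup>2) * exp ((norm w)\<^sup>2 / (2 * 4)) = exp (- (1 / 8 * (norm w)\<^sup>2))"
      unfolding exp_add[symmetric] by (rule arg_cong[of _ _ exp]) simp
    finally show ?thesis using gauss_density_nonneg[of w] by simp
  qed
  have dom: "integrable lborel (\<lambda>w::complex ^ 'd. B * exp (- (1 / 8 * (norm w)\<^sup>2)))"
    by (intro integrable_mult_right integrable_exp_neg_square_vec) simp
  have lim': "AE w in lborel. (\<lambda>N. gauss_density w *\<^sub>R s N w) \<longlonglongrightarrow> gauss_density w *\<^sub>R (k w * e_basis \<beta> w)"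
    by (intro AE_I2 tendsto_scaleR tendsto_const lim)
  have mm: "(\<lambda>w. gauss_density w *\<^sub>R (k w * e_basis \<beta> w)) \<in> borel_measurable lborel"
    "\<And>N. (\<lambda>w. gauss_density w *\<^sub>R s N w) \<in> borel_measurable lborel" by measurable
  show "integrable gauss_measure (\<lambda>w. k w * e_basis \<beta> w)"
    unfolding integrable_gauss[OF km]
    by (rule integrable_dominated_convergence[OF mm dom lim']) (use bound in auto)
  have lim_int: "(\<lambda>N. integral\<^sup>L gauss_measure (s N)) \<longlonglongrightarrow> (LINT w|gauss_measure. k w * e_basis \<beta> w)"
    unfolding integral_gauss[OF km] integral_gauss[OF sm]
    by (rule integral_dominated_convergence[OF mm dom lim']) (use bound in auto)
  have ev: "\<forall>\<^sub>F N in sequentially. integral\<^sup>L gauss_measure (s N) = d \<beta>"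
    using eventually_ge_at_top[of "mabs \<beta>"]
  proof eventually_elim
    case (elim N)
    have "integral\<^sup>L gauss_measure (s N) = (\<Sum>\<gamma>\<in>mindex_le N. if \<gamma> = \<beta> then d \<beta> else 0)"
      unfolding s_def[abs_def]
      by (subst Bochner_Integration.integral_sum)
         (auto simp: integrable_e_basis e_basis_orthonormal intro!: sum.cong)
    also have "\<dots> = d \<beta>" using elim by (simp add: finite_mindex_le) (simp add: mindex_le_def)
    finally show ?case .
  qed
  show "(LINT w|gauss_measure. k w * e_basis \<beta> w) = d \<beta>"
    by (rule LIMSEQ_unique[OF lim_int tendsto_eventually[OF ev]])
qed

section \<open>The operator on polynomials\<close>

lemma has_sum_finite_sum:
  fixes f :: "'b \<Rightarrow> 'a \<Rightarrow> 'c::topological_comm_monoid_add"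
  assumes "finite I" "\<And>i. i \<in> I \<Longrightarrow> (f i has_sum S i) A"
  shows "((\<lambda>x. \<Sum>i\<in>I. f i x) has_sum (\<Sum>i\<in>I. S i)) A"
  using assms by (induction I rule: finite_induct) (auto intro: has_sum_add)

lemma infsum_finite_support:
  assumes "finite S" "\<And>x. x \<notin> S \<Longrightarrow> f x = 0"
  shows "infsum f UNIV = sum f S"
proof -
  have "infsum f UNIV = infsum f S"
    by (rule infsum_cong_neutral) (use assms in auto)
  with assms(1) show ?thesis by simp
qed

text \<open>For fixed z the kernel is an antiholomorphic series in w with coefficients
  \<open>d z \<gamma>\<close>. Integrating it against \<open>e_basis \<beta>\<close> returns
  \<open>d z \<beta>\<close>, and this, as a power series in z, has column \<beta> of the matrix as
  its coefficients. A polynomial F involves finitely many columns only.\<close>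

lemma Op_V_maps_A_zero:
  fixes c :: "nat ^ 'd::finite \<Rightarrow> nat ^ 'd \<Rightarrow> complex"
  assumes \<delta>: "exp \<delta> \<le> sqrt (5 / 4)"
    and c: "\<And>\<alpha> \<beta>. cmod (c \<alpha> \<beta>) \<le> C * exp (\<delta> * mabs \<alpha>) * exp (\<delta> * mabs \<beta>)"
    and K: "\<And>z w. ((\<lambda>(\<alpha>, \<beta>). c \<alpha> \<beta> * e_basis \<alpha> z * cnj (e_basis \<beta> w)) has_sum exp (sesqui z w) * a z w) UNIV"
    and F: "F \<in> A_zero"
  shows "Op_V_maps a F (\<lambda>\<alpha>. \<Sum>\<^sub>\<infinity>\<beta>. c \<alpha> \<beta> * F \<beta>)"
proof -
  define S where "S = {\<beta>. F \<beta> \<noteq> 0}"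
  have S: "finite S" using F by (simp add: A_zero_def S_def)
  have "0 \<le> C * exp (\<delta> * mabs (0 :: nat ^ 'd)) * exp (\<delta> * mabs (0 :: nat ^ 'd))"
    using c[of 0 0] norm_ge_zero order_trans by blast
  then have C: "0 \<le> C" by (simp add: zero_le_mult_iff)
  have sF: "series_fun F w = (\<Sum>\<beta>\<in>S. F \<beta> * e_basis \<beta> w)" for w
    unfolding series_fun_def by (rule infsum_finite_support[OF S]) (simp add: S_def)
  have TF: "(\<Sum>\<^sub>\<infinity>\<beta>. c \<alpha> \<beta> * F \<beta>) = (\<Sum>\<beta>\<in>S. c \<alpha> \<beta> * F \<beta>)" for \<alpha>
    by (rule infsum_finite_support[OF S]) (simp add: S_def)
  define d where "d z \<gamma> = (\<Sum>\<^sub>\<infinity>\<alpha>. c \<alpha> \<gamma> * e_basis \<alpha> z)" for z \<gamma>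
  define B where "B = (1 / (1 - sqrt (5 / 6))) ^ CARD('d)"
  have c': "cmod (c \<alpha> \<gamma>) \<le> (C * exp (\<delta> * mabs \<gamma>)) * exp (\<delta> * mabs \<alpha>)" for \<alpha> \<gamma>
    using c[of \<alpha> \<gamma>] by (simp add: mult_ac)
  have C': "0 \<le> C * exp (\<delta> * mabs \<gamma>)" for \<gamma> :: "nat ^ 'd" using C by simp
  have dsum: "((\<lambda>\<alpha>. c \<alpha> \<gamma> * e_basis \<alpha> z) has_sum d z \<gamma>) UNIV" for z \<gamma>
    unfolding d_def
    by (rule has_sum_infsum[OF abs_summable_summable[OF e_basis_series_summable[OF \<delta> c' C']]])
  have dbound: "cmod (d z \<gamma>) \<le> C * B * exp (3 / 4 * (norm z)\<^sup>2) * exp (\<delta> * mabs \<gamma>)" for z \<gamma>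
  proof -
    have "cmod (d z \<gamma>) \<le> (\<Sum>\<^sub>\<infinity>\<alpha>. cmod (c \<alpha> \<gamma> * e_basis \<alpha> z))"
      unfolding d_def by (rule norm_infsum_bound) (rule e_basis_series_summable[OF \<delta> c' C'])
    also have "\<dots> \<le> (C * exp (\<delta> * mabs \<gamma>)) * B * exp (3 / 4 * (norm z)\<^sup>2)"
      unfolding B_def
      by (intro infsum_le_finite_sums e_basis_series_summable[OF \<delta> c' C'] e_basis_series_sum_le[OF \<delta> c' C'])
    finally show ?thesis by (simp add: mult_ac)
  qed
  have k: "((\<lambda>\<gamma>. d z \<gamma> * cnj (e_basis \<gamma> w)) has_sum exp (sesqui z w) * a z w) UNIV" for z w
  proof (rule has_sum_SigmaD)
    have "((\<lambda>(\<gamma>, \<alpha>). c \<alpha> \<gamma> * e_basis \<alpha> z * cnj (e_basis \<gamma> w)) has_sum exp (sesqui z w) * a z w) (UNIV \<times> UNIV)"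
      using K[of z w]
      by (subst has_sum_swap) (simp add: case_prod_unfold)
    then show "((\<lambda>(\<gamma>, \<alpha>). c \<alpha> \<gamma> * e_basis \<alpha> z * cnj (e_basis \<gamma> w)) has_sum exp (sesqui z w) * a z w) (UNIV \<times> UNIV)" .
    show "((\<lambda>\<alpha>. case (\<gamma>, \<alpha>) of (\<gamma>, \<alpha>) \<Rightarrow> c \<alpha> \<gamma> * e_basis \<alpha> z * cnj (e_basis \<gamma> w)) has_sum
        d z \<gamma> * cnj (e_basis \<gamma> w)) UNIV" for \<gamma>
      by (simp only: prod.case) (rule has_sum_cmult_left[OF dsum])
  qed
  have integrand: "Op_integrand a (series_fun F) z =
      (\<lambda>w. \<Sum>\<beta>\<in>S. F \<beta> * (exp (sesqui z w) * a z w * e_basis \<beta> w))" for z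
    by (simp add: Op_integrand_def sF fun_eq_iff sum_distrib_left sum_distrib_right mult_ac)
  have int: "integrable gauss_measure (\<lambda>w. exp (sesqui z w) * a z w * e_basis \<beta> w)" for z \<beta>
    by (rule integrable_gauss_antiholomorphic[OF \<delta> dbound k])
  have "Op_V a (series_fun F) z = (\<Sum>\<beta>\<in>S. F \<beta> * d z \<beta>)" for z
    unfolding Op_V_def integrand
    by (subst Bochner_Integration.integral_sum)
       (simp_all add: int integral_gauss_antiholomorphic[OF \<delta> dbound k])
  moreover have "((\<lambda>\<alpha>. (\<Sum>\<beta>\<in>S. c \<alpha> \<beta> * F \<beta>) * e_basis \<alpha> z) has_sum (\<Sum>\<beta>\<in>S. F \<beta> * d z \<beta>)) UNIV" for z
  proof -
    have "((\<lambda>\<alpha>. \<Sum>\<beta>\<in>S. F \<beta> * (c \<alpha> \<beta> * e_basis \<alpha> z)) has_sum (\<Sum>\<beta>\<in>S. F \<beta> * d z \<beta>)) UNIV"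
      by (intro has_sum_finite_sum S has_sum_cmult_right dsum)
    also have "(\<lambda>\<alpha>. \<Sum>\<beta>\<in>S. F \<beta> * (c \<alpha> \<beta> * e_basis \<alpha> z)) = (\<lambda>\<alpha>. (\<Sum>\<beta>\<in>S. c \<alpha> \<beta> * F \<beta>) * e_basis \<alpha> z)"
      unfolding sum_distrib_right by (simp add: mult_ac)
    finally show ?thesis .
  qed
  moreover have "integrable gauss_measure (Op_integrand a (series_fun F) z)" for z
    unfolding integrand by (intro Bochner_Integration.integrable_sum integrable_mult_right int)
  ultimately show ?thesis
    by (simp add: Op_V_maps_def is_series_of_def TF)
qed

section \<open>Taylor coefficients of the kernel\<close>

text \<open>Makes \<open>Op_V_maps\<close> single-valued in its last argument, so any two extensions
  agree on polynomials.\<close>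

lemma is_series_of_unique:
  fixes G H :: "('d::finite) fseries"
  assumes "is_series_of G f" "is_series_of H f"
  shows "G = H"
proof -
  define c where "c \<alpha> = (G (vec_lambda \<alpha>) - H (vec_lambda \<alpha>)) / of_real (sqrt (mfact (vec_lambda \<alpha> :: nat ^ 'd)))" for \<alpha>
  have "((\<lambda>\<alpha>. c \<alpha> * (\<Prod>i\<in>UNIV. z i ^ \<alpha> i)) has_sum 0) (multi_supp UNIV)" for z
  proof -
    have "((\<lambda>\<alpha>. G \<alpha> * e_basis \<alpha> (vec_lambda z) - H \<alpha> * e_basis \<alpha> (vec_lambda z)) has_sum
        f (vec_lambda z) - f (vec_lambda z)) UNIV"
      unfolding diff_conv_add_uminus
      using assms unfolding is_series_of_def by (intro has_sum_add has_sum_uminusI) auto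
    then have "((\<lambda>\<alpha>. c (vec_nth \<alpha>) * (\<Prod>i\<in>UNIV. z i ^ (\<alpha> $ i))) has_sum 0) UNIV"
      by (simp add: c_def e_basis_def vec_nth_inverse left_diff_distrib diff_divide_distrib)
    then show ?thesis by (simp add: has_sum_multi_vec[of "\<lambda>\<alpha>. c \<alpha> * (\<Prod>i\<in>UNIV. z i ^ \<alpha> i)"])
  qed
  then have "c (vec_nth \<alpha>) = 0" for \<alpha> :: "nat ^ 'd"
    by (rule multi_powser_eq_0_imp_coeff_eq_0[OF finite]) (auto simp: multi_supp_UNIV)
  moreover have "mfact \<alpha> \<noteq> 0" for \<alpha> :: "nat ^ 'd" by (simp add: mfact_def)
  ultimately show ?thesis by (auto simp: c_def vec_nth_inverse fun_eq_iff)
qed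

text \<open>Upper Stirling bound; n + 1 in place of n, together with 0^0 = 1, includes n = 0. The
  induction step is (1 + 1/n)^(n+1) \<ge> e, obtained from ln x \<le> x - 1 at x = 1/(1 +
  1/n).\<close>

lemma fact_mult_exp_le: "fact n * exp (real n) \<le> exp 1 * (real n + 1) * real n ^ n"
proof (cases n)
  case 0
  then show ?thesis by simp
next
  case (Suc m)
  have "fact n * exp (real n) \<le> exp 1 * real n * real n ^ n" if "n \<ge> 1" for n :: nat
    using that
  proof (induction n rule: nat_induct_at_least)
    case base
    show ?case by simp
  next
    case (Suc n)
    then have n: "real n > 0" by simp
    have "1 \<le> (real n + 1) * ln (1 + 1 / real n)"
    proof -
      have "ln (1 / (1 + 1 / real n)) \<le> 1 / (1 + 1 / real n) - 1"
        using n by (intro ln_le_minus_one) (simp add: add_pos_pos)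
      moreover have "ln (1 / (1 + 1 / real n)) = - ln (1 + 1 / real n)"
        using n by (simp add: ln_div add_pos_pos)
      moreover have "1 - 1 / (1 + 1 / real n) = 1 / (real n + 1)"
        using n by (simp add: field_simps)
      ultimately have "1 / (real n + 1) \<le> ln (1 + 1 / real n)" by linarith
      then show ?thesis using n by (simp add: field_simps)
    qed
    then have "exp 1 \<le> exp ((real n + 1) * ln (1 + 1 / real n))" by simp
    also have "\<dots> = (1 + 1 / real n) powr real (Suc n)"
      using n add_pos_pos[of 1 "1 / real n"] by (simp add: powr_def add.commute)
    also have "\<dots> = (1 + 1 / real n) ^ Suc n"
      using n by (intro powr_realpow) (simp add: add_pos_pos)
    finally have "exp 1 * real n ^ Suc n \<le> (1 + 1 / real n) ^ Suc n * real n ^ Suc n"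
      by (rule mult_right_mono) simp
    also have "\<dots> = real (Suc n) ^ Suc n"
    proof -
      have "(1 + 1 / real n) * real n = real (Suc n)" using n by (simp add: field_simps)
      then show ?thesis by (simp only: power_mult_distrib[symmetric])
    qed
    finally have e: "exp 1 * real n ^ Suc n \<le> real (Suc n) ^ Suc n" .
    have "fact (Suc n) * exp (real (Suc n)) = real (Suc n) * exp 1 * (fact n * exp (real n))"
      by (simp add: exp_add algebra_simps)
    also have "\<dots> \<le> real (Suc n) * exp 1 * (exp 1 * real n * real n ^ n)"
      by (rule mult_left_mono[OF Suc.IH]) simp
    also have "\<dots> = exp 1 * real (Suc n) * (exp 1 * real n ^ Suc n)" by simp
    also have "\<dots> \<le> exp 1 * real (Suc n) * real (Suc n) ^ Suc n"
      by (rule mult_left_mono[OF e]) simp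
    finally show ?case .
  qed
  from this[of n] Suc have "fact n * exp (real n) \<le> exp 1 * real n * real n ^ n" by simp
  also have "\<dots> \<le> exp 1 * (real n + 1) * real n ^ n" by (intro mult_right_mono mult_left_mono) auto
  finally show ?thesis .
qed

lemma sqrt_fact_mult_exp_le:
  "sqrt (fact n) * exp (real n / 2) \<le> sqrt (exp 1 * (real n + 1)) * sqrt (real n) ^ n"
proof -
  have "sqrt (fact n * exp (real n)) \<le> sqrt (exp 1 * (real n + 1) * real n ^ n)"
    using fact_mult_exp_le by (rule real_sqrt_le_mono)
  moreover have "sqrt (exp (real n)) = exp (real n / 2)"
    by (rule real_sqrt_unique) (simp_all flip: exp_double)
  ultimately show ?thesis by (simp add: real_sqrt_mult real_sqrt_power)
qed

text \<open>The left side is the loss in \<open>sqrt_fact_mult_exp_le\<close>, raised to a fixed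
  power such as the number of coordinates; being of polynomial growth, it is absorbed by any weight
  with \<epsilon> > 0.\<close>

lemma poly_le_exp_powr:
  fixes \<kappa> \<epsilon> :: real
  assumes "0 < \<kappa>" "0 < \<epsilon>"
  shows "\<exists>D\<ge>0. \<forall>n. sqrt (exp 1 * (real n + 1)) ^ m \<le> D * exp (\<epsilon> * real n powr \<kappa>)"
proof -
  have "(\<lambda>n. sqrt (exp 1 * (real n + 1)) ^ m * exp (- (\<epsilon> * real n powr \<kappa>))) \<longlonglongrightarrow> 0"
    using assms by real_asymp
  then have "Bseq (\<lambda>n. sqrt (exp 1 * (real n + 1)) ^ m * exp (- (\<epsilon> * real n powr \<kappa>)))"
    by (intro convergent_imp_Bseq) (auto simp: convergent_def)
  then obtain D where "D > 0" and D: "\<And>n. norm (sqrt (exp 1 * (real n + 1)) ^ m * exp (- (\<epsilon> * real n powr \<kappa>))) \<le> D"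
    by (auto elim: BseqE)
  have "sqrt (exp 1 * (real n + 1)) ^ m \<le> D * exp (\<epsilon> * real n powr \<kappa>)" for n
    using D[of n] by (simp add: exp_minus field_simps abs_mult)
  with \<open>D > 0\<close> show ?thesis by (intro exI[of _ D]) auto
qed


section \<open>The kernel: growth, holomorphy and expansion\<close>

definition Op_kernel :: "(complex ^ 'd \<Rightarrow> complex ^ 'd \<Rightarrow> complex) \<Rightarrow> complex ^ 'd \<Rightarrow> complex ^ 'd::finite \<Rightarrow> complex" where
  "Op_kernel a z w = exp (sesqui z w) * a z w"

lemma Re_sesqui: "Re (sesqui z w) = z \<bullet> w"
  by (simp add: sesqui_def inner_vec_def inner_complex_def)

lemma norm_kernel_le:
  assumes "cmod (a z w) \<le> C * exp (1/2 * (norm (z - w))\<^sup>2 + b)"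
  shows "cmod (Op_kernel a z w) \<le> C * exp ((norm z)\<^sup>2 / 2 + (norm w)\<^sup>2 / 2 + b)"
proof -
  have "cmod (Op_kernel a z w) \<le> exp (z \<bullet> w) * (C * exp (1/2 * (norm (z - w))\<^sup>2 + b))"
    unfolding Op_kernel_def norm_mult using assms by (intro mult_mono) (simp_all add: Re_sesqui)
  also have "\<dots> = C * exp (z \<bullet> w + (1/2 * (norm (z - w))\<^sup>2 + b))"
    by (simp add: exp_add)
  also have "z \<bullet> w + (1/2 * (norm (z - w))\<^sup>2 + b) = (norm z)\<^sup>2 / 2 + (norm w)\<^sup>2 / 2 + b"
    by (simp add: dot_norm_neg field_simps)
  finally show ?thesis .
qed

lemma A_tilde_continuous:
  assumes "a \<in> A_tilde" "continuous_on A f" "continuous_on A g"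
  shows "continuous_on A (\<lambda>x. a (f x) (cvec_conj (g x)))"
proof -
  have "continuous_on UNIV (\<lambda>(z, w). a z (cvec_conj w))"
  proof (intro continuous_at_imp_continuous_on ballI)
    fix x
    obtain D where "((\<lambda>(z, w). a z (cvec_conj w)) has_derivative D) (at x)"
      using assms(1) unfolding A_tilde_def entire2_def by blast
    then show "isCont (\<lambda>(z, w). a z (cvec_conj w)) x" by (rule has_derivative_continuous)
  qed
  from continuous_on_compose2[OF this, of A "\<lambda>x. (f x, g x)"] assms(2,3)
  show ?thesis by (simp add: continuous_on_Pair)
qed

text \<open>On a complex line the derivative is h -> D (h u, h v) = h D (u, v) by the complex
  homogeneity built into \<open>entire2\<close>, hence multiplication by a complex number.\<close>

lemma A_tilde_holomorphic:
  assumes "a \<in> A_tilde"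
  shows "(\<lambda>\<zeta>. a (z + \<zeta> *s u) (cvec_conj (w + \<zeta> *s v))) holomorphic_on UNIV"
proof -
  have lin: "bounded_linear (\<lambda>h::complex. (h *s u, h *s v))"
    by (intro linear_conv_bounded_linear[THEN iffD1] linearI)
       (simp_all add: vec_eq_iff algebra_simps)
  have "\<exists>D'. ((\<lambda>\<zeta>. a (z + \<zeta> *s u) (cvec_conj (w + \<zeta> *s v))) has_field_derivative D') (at \<zeta>)" for \<zeta>
  proof -
    obtain D where D: "((\<lambda>(z, w). a z (cvec_conj w)) has_derivative D) (at (z + \<zeta> *s u, w + \<zeta> *s v))"
      and D_lin: "\<And>k z w. D (k *s z, k *s w) = k * D (z, w)"
      using assms unfolding A_tilde_def entire2_def by blast
    have "((\<lambda>\<zeta>. (z, w) + (\<zeta> *s u, \<zeta> *s v)) has_derivative (\<lambda>h. 0 + (h *s u, h *s v))) (at \<zeta>)"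
      by (intro has_derivative_add has_derivative_const bounded_linear_imp_has_derivative lin)
    then have "((\<lambda>\<zeta>. (z + \<zeta> *s u, w + \<zeta> *s v)) has_derivative (\<lambda>h. (h *s u, h *s v))) (at \<zeta>)"
      by simp
    from diff_chain_at[OF this D] have
      "((\<lambda>\<zeta>. a (z + \<zeta> *s u) (cvec_conj (w + \<zeta> *s v))) has_derivative (\<lambda>h. h * D (u, v))) (at \<zeta>)"
      by (simp add: o_def D_lin)
    then show ?thesis
      unfolding has_field_derivative_def by (intro exI[of _ "D (u, v)"]) (simp add: mult.commute[of _ "D (u, v)"])
  qed
  then show ?thesis by (simp add: holomorphic_on_def field_differentiable_def)
qed

lemma norm_vec_le_sum: "norm (z :: complex ^ 'd::finite) \<le> (\<Sum>i\<in>UNIV. cmod (z $ i))"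
  unfolding norm_vec_def by (rule L2_set_le_sum) simp

text \<open>z and the conjugate of w are merged into one family of variables indexed by
  \<open>'d + 'd\<close>; in these variables \<open>sesqui\<close> becomes a polynomial. Bounds on
  polydiscs come from compactness in C^d x C^d, before passing to the function space.\<close>

lemma multi_entire_kernel:
  fixes a :: "complex ^ 'd::finite \<Rightarrow> complex ^ 'd \<Rightarrow> complex"
  assumes a: "a \<in> A_tilde"
  shows "multi_entire (\<lambda>u::'d + 'd \<Rightarrow> complex. Op_kernel a (\<chi> i. u (Inl i)) (cvec_conj (\<chi> i. u (Inr i))))"
proof -
  have K: "Op_kernel a z (cvec_conj w) = exp (\<Sum>j\<in>UNIV. z $ j * w $ j) * a z (cvec_conj w)" for z w
    by (simp add: Op_kernel_def sesqui_def cvec_conj_def)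
  have cont: "continuous_on A (\<lambda>x. Op_kernel a (f x) (cvec_conj (g x)))"
    if "continuous_on A f" "continuous_on A g" for A :: "'x::topological_space set" and f g
    unfolding K by (intro continuous_intros A_tilde_continuous a that)
  have coord: "continuous_on UNIV (\<lambda>u::'d + 'd \<Rightarrow> complex. \<chi> i. u (p i))" for p
    by (intro continuous_on_vec_lambda continuous_on_product_coordinates)
  show ?thesis
    unfolding multi_entire_def
  proof (intro conjI allI)
    show "continuous_on UNIV (\<lambda>u::'d + 'd \<Rightarrow> complex. Op_kernel a (\<chi> i. u (Inl i)) (cvec_conj (\<chi> i. u (Inr i))))"
      by (intro cont coord)
    fix k and u :: "'d + 'd \<Rightarrow> complex"
    \<comment> \<open>One of \<open>e Inl\<close>, \<open>e Inr\<close> is a unit vector and the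
      other is 0, so changing one coordinate of u moves the pair along a complex line.\<close>
    define e where "e p = ((\<chi> i. if p i = k then 1 else 0) :: complex ^ 'd)" for p :: "'d \<Rightarrow> 'd + 'd"
    have eq: "(\<chi> i. (u(k := \<zeta>)) (p i)) = (\<chi> i. (u(k := 0)) (p i)) + \<zeta> *s e p" for p \<zeta>
      by (simp add: vec_eq_iff e_def)
    have upd: "(\<lambda>\<zeta>. (u(k := \<zeta>)) j) holomorphic_on UNIV" for j
      by (cases "j = k") (auto intro: holomorphic_intros)
    have "(\<lambda>\<zeta>. exp (\<Sum>j\<in>UNIV. (u(k := \<zeta>)) (Inl j) * (u(k := \<zeta>)) (Inr j)) *
        a ((\<chi> i. (u(k := 0)) (Inl i)) + \<zeta> *s e Inl) (cvec_conj ((\<chi> i. (u(k := 0)) (Inr i)) + \<zeta> *s e Inr)))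
        holomorphic_on UNIV"
      by (intro holomorphic_on_mult holomorphic_on_exp' holomorphic_on_sum upd A_tilde_holomorphic a)
    then show "(\<lambda>\<zeta>. Op_kernel a (\<chi> i. (u(k := \<zeta>)) (Inl i)) (cvec_conj (\<chi> i. (u(k := \<zeta>)) (Inr i)))) holomorphic_on UNIV"
      unfolding K eq[symmetric] by simp
  next
    fix R :: real
    let ?B = "cball 0 (CARD('d) * R) :: (complex ^ 'd) set"
    have "continuous_on (?B \<times> ?B) (\<lambda>x. Op_kernel a (fst x) (cvec_conj (snd x)))"
      by (intro cont continuous_intros)
    then have "bounded ((\<lambda>x. Op_kernel a (fst x) (cvec_conj (snd x))) ` (?B \<times> ?B))"
      by (intro compact_imp_bounded compact_continuous_image compact_Times compact_cball)
    then obtain M where M: "\<And>x. x \<in> ?B \<times> ?B \<Longrightarrow> cmod (Op_kernel a (fst x) (cvec_conj (snd x))) \<le> M"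
      unfolding bounded_iff by blast
    have "cmod (Op_kernel a (\<chi> i. u (Inl i)) (cvec_conj (\<chi> i. u (Inr i)))) \<le> M"
      if u: "\<forall>i. cmod (u i) \<le> R" for u :: "'d + 'd \<Rightarrow> complex"
    proof -
      have "norm (\<chi> i. u (p i)) \<le> CARD('d) * R" for p :: "'d \<Rightarrow> 'd + 'd"
      proof -
        have "norm (\<chi> i. u (p i)) \<le> (\<Sum>i\<in>UNIV. cmod (u (p i)))"
          using norm_vec_le_sum[of "\<chi> i. u (p i)"] by simp
        also have "\<dots> \<le> CARD('d) * R"
          using sum_bounded_above[of UNIV "\<lambda>i. cmod (u (p i))" R] u by simp
        finally show ?thesis .
      qed
      then show ?thesis using M[of "((\<chi> i. u (Inl i)), (\<chi> i. u (Inr i)))"] by simp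
    qed
    then show "\<exists>M. \<forall>u. (\<forall>i. cmod (u i) \<le> R) \<longrightarrow>
        cmod (Op_kernel a (\<chi> i. u (Inl i)) (cvec_conj (\<chi> i. u (Inr i)))) \<le> M" by blast
  qed
qed

lemma prod_UNIV_sum:
  "(\<Prod>k\<in>(UNIV :: ('a::finite + 'b::finite) set). h k) = (\<Prod>i\<in>UNIV. h (Inl i)) * (\<Prod>i\<in>UNIV. h (Inr i))"
  by (subst UNIV_Plus_UNIV[symmetric], subst prod.Plus) (simp_all add: o_def)

text \<open>The square roots of \<open>mfact\<close> reflect the normalisation of
  \<open>e_basis\<close>. All radii are quantified because the optimal torus depends on (\<alpha>,
  \<beta>).\<close>

definition cauchy_coeffs ::
    "(complex ^ 'd \<Rightarrow> complex ^ 'd \<Rightarrow> complex) \<Rightarrow> (nat ^ 'd \<Rightarrow> nat ^ 'd \<Rightarrow> complex) \<Rightarrow> bool" where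
  "cauchy_coeffs a c \<longleftrightarrow> (\<forall>\<alpha> \<beta> R R' M. (\<forall>i. 0 \<le> R i) \<longrightarrow> (\<forall>i. 0 \<le> R' i) \<longrightarrow>
     (\<forall>z w. (\<forall>i. cmod (z $ i) = R i) \<longrightarrow> (\<forall>i. cmod (w $ i) = R' i) \<longrightarrow> cmod (Op_kernel a z w) \<le> M) \<longrightarrow>
     cmod (c \<alpha> \<beta>) * (\<Prod>i\<in>UNIV. R i ^ (\<alpha> $ i)) * (\<Prod>i\<in>UNIV. R' i ^ (\<beta> $ i))
       \<le> M * sqrt (mfact \<alpha>) * sqrt (mfact (\<beta> :: nat ^ 'd::finite)))"

lemma cauchy_coeffsD:
  assumes "cauchy_coeffs a c" "\<And>i. 0 \<le> R i" "\<And>i. 0 \<le> R' i"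
    "\<And>z w. (\<forall>i. cmod (z $ i) = R i) \<Longrightarrow> (\<forall>i. cmod (w $ i) = R' i) \<Longrightarrow> cmod (Op_kernel a z w) \<le> M"
  shows "cmod (c \<alpha> \<beta>) * (\<Prod>i\<in>UNIV. R i ^ (\<alpha> $ i)) * (\<Prod>i\<in>UNIV. R' i ^ (\<beta> $ i))
    \<le> M * sqrt (mfact \<alpha>) * sqrt (mfact \<beta>)"
  by (rule cauchy_coeffs_def[THEN iffD1, rule_format, OF assms(1)]) (use assms(2-4) in auto)

lemma kernel_expansion:
  fixes a :: "complex ^ 'd::finite \<Rightarrow> complex ^ 'd \<Rightarrow> complex"
  assumes a: "a \<in> A_tilde"
  obtains c where
    "\<And>z w. ((\<lambda>(\<alpha>, \<beta>). c \<alpha> \<beta> * e_basis \<alpha> z * cnj (e_basis \<beta> w)) has_sum Op_kernel a z w) UNIV"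
    "cauchy_coeffs a c"
proof -
  let ?f = "\<lambda>u::'d + 'd \<Rightarrow> complex. Op_kernel a (\<chi> i. u (Inl i)) (cvec_conj (\<chi> i. u (Inr i)))"
  have "\<exists>c. has_cauchy_expansion UNIV ?f c"
  proof (rule multi_entire_expansion[OF finite multi_entire_kernel[OF a]])
    fix z z' :: "'d + 'd \<Rightarrow> complex"
    assume "\<And>i. i \<in> UNIV \<Longrightarrow> z i = z' i"
    then have "z = z'" by auto
    then show "?f z = ?f z'" by simp
  qed
  then obtain c0 where c0: "has_cauchy_expansion UNIV ?f c0" by blast
  define c where "c \<alpha> \<beta> = c0 (case_sum (vec_nth \<alpha>) (vec_nth \<beta>)) * of_real (sqrt (mfact \<alpha>) * sqrt (mfact \<beta>))"
    for \<alpha> \<beta> :: "nat ^ 'd"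
  have mf: "mfact \<alpha> \<noteq> 0" for \<alpha> :: "nat ^ 'd" by (simp add: mfact_def)
  have cconj: "cvec_conj (cvec_conj w) = w" for w :: "complex ^ 'd"
    by (simp add: cvec_conj_def vec_eq_iff)
  have "((\<lambda>(\<alpha>, \<beta>). c \<alpha> \<beta> * e_basis \<alpha> z * cnj (e_basis \<beta> w)) has_sum Op_kernel a z w) UNIV" for z w
  proof -
    define u where "u = case_sum (vec_nth z) (vec_nth (cvec_conj w))"
    have cs: "case_sum (vec_nth (vec_lambda (\<gamma> \<circ> Inl))) (vec_nth (vec_lambda (\<gamma> \<circ> Inr))) = \<gamma>"
      for \<gamma> :: "'d + 'd \<Rightarrow> nat"
      by (auto simp: fun_eq_iff split: sum.split)
    have cs': "(case k of Inl i \<Rightarrow> vec_lambda (\<gamma> \<circ> Inl) $ i | Inr i \<Rightarrow> vec_lambda (\<gamma> \<circ> Inr) $ i) = \<gamma> k"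
      for k and \<gamma> :: "'d + 'd \<Rightarrow> nat"
      by (simp split: sum.split)
    have fu: "?f u = Op_kernel a z w" by (simp add: u_def vec_nth_inverse cconj)
    have "((\<lambda>\<gamma>. c0 \<gamma> * (\<Prod>i\<in>UNIV. u i ^ \<gamma> i)) has_sum Op_kernel a z w) (multi_supp UNIV)"
      unfolding fu[symmetric] by (rule has_cauchy_expansion_has_sum[OF c0])
    also have "?this \<longleftrightarrow> ((\<lambda>(\<alpha>, \<beta>). c0 (case_sum (vec_nth \<alpha>) (vec_nth \<beta>)) *
        (\<Prod>i\<in>UNIV. u i ^ case_sum (vec_nth \<alpha>) (vec_nth \<beta>) i)) has_sum Op_kernel a z w) UNIV"
      by (rule has_sum_reindex_bij_witness[where j = "\<lambda>\<gamma>. (vec_lambda (\<gamma> \<circ> Inl), vec_lambda (\<gamma> \<circ> Inr))"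
            and i = "\<lambda>(\<alpha>, \<beta>). case_sum (vec_nth \<alpha>) (vec_nth \<beta>)"])
         (auto simp: multi_supp_UNIV vec_eq_iff cs cs')
    also have "(\<lambda>(\<alpha>, \<beta>). c0 (case_sum (vec_nth \<alpha>) (vec_nth \<beta>)) *
        (\<Prod>i\<in>UNIV. u i ^ case_sum (vec_nth \<alpha>) (vec_nth \<beta>) i))
      = (\<lambda>(\<alpha>, \<beta>). c \<alpha> \<beta> * e_basis \<alpha> z * cnj (e_basis \<beta> w))"
      by (auto simp: fun_eq_iff c_def u_def prod_UNIV_sum e_basis_def cvec_conj_def mf)
    finally show ?thesis .
  qed
  moreover have "cauchy_coeffs a c"
    unfolding cauchy_coeffs_def
  proof (intro allI impI)
    fix \<alpha> \<beta> :: "nat ^ 'd" and R R' :: "'d \<Rightarrow> real" and M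
    assume R: "\<forall>i. 0 \<le> R i" and R': "\<forall>i. 0 \<le> R' i"
      and M: "\<forall>z w. (\<forall>i. cmod (z $ i) = R i) \<longrightarrow> (\<forall>i. cmod (w $ i) = R' i) \<longrightarrow> cmod (Op_kernel a z w) \<le> M"
    let ?\<gamma> = "case_sum (vec_nth \<alpha>) (vec_nth \<beta>)"
    have "cmod (c0 ?\<gamma>) * (\<Prod>k\<in>UNIV. case_sum R R' k ^ ?\<gamma> k) \<le> M"
    proof (rule has_cauchy_expansion_bound[OF c0])
      show "0 \<le> case_sum R R' k" for k using R R' by (simp split: sum.split)
      show "cmod (?f u) \<le> M" if "\<forall>k\<in>UNIV. cmod (u k) = case_sum R R' k" for u
        using that by (intro M[rule_format]) (auto simp: cvec_conj_def)
    qed (simp add: multi_supp_UNIV)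
    then have "(cmod (c0 ?\<gamma>) * (\<Prod>k\<in>UNIV. case_sum R R' k ^ ?\<gamma> k)) * (sqrt (mfact \<alpha>) * sqrt (mfact \<beta>))
        \<le> M * (sqrt (mfact \<alpha>) * sqrt (mfact \<beta>))"
      by (rule mult_right_mono) simp
    then show "cmod (c \<alpha> \<beta>) * (\<Prod>i\<in>UNIV. R i ^ (\<alpha> $ i)) * (\<Prod>i\<in>UNIV. R' i ^ (\<beta> $ i))
        \<le> M * sqrt (mfact \<alpha>) * sqrt (mfact \<beta>)"
      by (simp add: c_def prod_UNIV_sum norm_mult mult_ac)
  qed
  ultimately show ?thesis by (rule that)
qed

lemma norm_sqrt_multi_index:
  fixes z :: "complex ^ 'd::finite"
  assumes "\<And>i. cmod (z $ i) = sqrt (real (\<alpha> $ i))" "0 < s"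
  shows "(norm z)\<^sup>2 = real (mabs \<alpha>)" and "norm z powr (1 / s) = real (mabs \<alpha>) powr (1 / (2 * s))"
proof -
  show sq: "(norm z)\<^sup>2 = real (mabs \<alpha>)" by (simp add: norm_vec_power2 assms mabs_def)
  then have "norm z = sqrt (real (mabs \<alpha>))" by (metis norm_ge_zero real_sqrt_unique)
  then show "norm z powr (1 / s) = real (mabs \<alpha>) powr (1 / (2 * s))"
    by (simp add: powr_half_sqrt[symmetric] powr_powr)
qed

text \<open>With radii \<open>\<surd>\<alpha>\<^sub>j\<close> the Gaussian factor cancels \<open>\<surd>(\<alpha>!)\<close> up to a polynomial in \<open>|\<alpha>|\<close>,
  which costs an arbitrarily small \<open>\<epsilon>\<close>.\<close>

lemma kernel_coeff_bound:
  fixes a :: "complex ^ 'd::finite \<Rightarrow> complex ^ 'd \<Rightarrow> complex"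
  assumes cauchy: "cauchy_coeffs a c"
    and a: "\<And>z w. cmod (a z w) \<le> C * exp (1/2 * (norm (z - w))\<^sup>2 + \<mu> * (norm z powr (1/s) + norm w powr (1/s)))"
    and s: "0 < s" and \<epsilon>: "0 < \<epsilon>"
  shows "\<exists>C'\<ge>0. \<forall>\<alpha> \<beta>. cmod (c \<alpha> \<beta>) \<le> C' * vartheta (\<mu> + \<epsilon>) s \<alpha> * vartheta (\<mu> + \<epsilon>) s \<beta>"
proof -
  have "0 \<le> C * exp (1/2 * (norm (0 - 0 :: complex ^ 'd))\<^sup>2 + \<mu> * (norm (0 :: complex ^ 'd) powr (1/s) + norm (0 :: complex ^ 'd) powr (1/s)))"
    using a[of 0 0] norm_ge_zero order_trans by blast
  then have C: "0 \<le> C" by (simp add: zero_le_mult_iff)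
  obtain D where D: "D \<ge> 0" "\<And>n. sqrt (exp 1 * (real n + 1)) ^ CARD('d) \<le> D * exp (\<epsilon> * real n powr (1 / (2 * s)))"
    using poly_le_exp_powr[of "1 / (2 * s)" \<epsilon> "CARD('d)"] s \<epsilon> by auto
  define Q where "Q \<alpha> = (\<Prod>i\<in>UNIV. sqrt (real (\<alpha> $ i)) ^ (\<alpha> $ i))" for \<alpha> :: "nat ^ 'd"
  \<comment> \<open>True at n = 0 because 0^0 = 1; positivity of Q allows it to be cancelled at the
    end.\<close>
  have "0 < sqrt (real n) ^ n" for n by (cases "n = 0") simp_all
  then have Q: "Q \<alpha> > 0" for \<alpha>
    unfolding Q_def by (intro prod_pos) simp
  have stirling: "sqrt (mfact \<alpha>) * exp (real (mabs \<alpha>) / 2) \<le> D * exp (\<epsilon> * real (mabs \<alpha>) powr (1 / (2 * s))) * Q \<alpha>" for \<alpha> :: "nat ^ 'd"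
  proof -
    have "sqrt (mfact \<alpha>) * exp (real (mabs \<alpha>) / 2) = (\<Prod>i\<in>UNIV. sqrt (fact (\<alpha> $ i)) * exp (real (\<alpha> $ i) / 2))"
      by (simp add: mfact_def of_nat_prod sqrt_prod mabs_def sum_divide_distrib exp_sum prod.distrib)
    \<comment> \<open>Each \<alpha>_i + 1 is enlarged to |\<alpha>| + 1, so that the losses of all
      coordinates combine into one power that D controls.\<close>
    also have "\<dots> \<le> (\<Prod>i\<in>UNIV. sqrt (exp 1 * (real (mabs \<alpha>) + 1)) * sqrt (real (\<alpha> $ i)) ^ (\<alpha> $ i))"
    proof (intro prod_mono conjI)
      fix i
      have "sqrt (exp 1 * (real (\<alpha> $ i) + 1)) * sqrt (real (\<alpha> $ i)) ^ (\<alpha> $ i)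
          \<le> sqrt (exp 1 * (real (mabs \<alpha>) + 1)) * sqrt (real (\<alpha> $ i)) ^ (\<alpha> $ i)"
        by (intro mult_right_mono real_sqrt_le_mono mult_left_mono) (auto simp: le_mabs)
      with sqrt_fact_mult_exp_le[of "\<alpha> $ i"]
      show "sqrt (fact (\<alpha> $ i)) * exp (real (\<alpha> $ i) / 2)
        \<le> sqrt (exp 1 * (real (mabs \<alpha>) + 1)) * sqrt (real (\<alpha> $ i)) ^ (\<alpha> $ i)" by linarith
    qed simp
    also have "\<dots> = sqrt (exp 1 * (real (mabs \<alpha>) + 1)) ^ CARD('d) * Q \<alpha>"
      by (simp add: prod.distrib Q_def)
    also have "\<dots> \<le> D * exp (\<epsilon> * real (mabs \<alpha>) powr (1 / (2 * s))) * Q \<alpha>"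
      using D(2) Q[of \<alpha>] by (intro mult_right_mono) auto
    finally show ?thesis .
  qed
  have "cmod (c \<alpha> \<beta>) \<le> (C * D * D) * vartheta (\<mu> + \<epsilon>) s \<alpha> * vartheta (\<mu> + \<epsilon>) s \<beta>" for \<alpha> \<beta>
  proof -
    let ?p = "\<lambda>\<alpha>::nat ^ 'd. real (mabs \<alpha>) powr (1 / (2 * s))"
    let ?E = "C * exp (\<mu> * ?p \<alpha>) * exp (\<mu> * ?p \<beta>)"
    have "cmod (c \<alpha> \<beta>) * Q \<alpha> * Q \<beta> \<le>
        (C * exp (real (mabs \<alpha>) / 2 + real (mabs \<beta>) / 2 + \<mu> * (?p \<alpha> + ?p \<beta>))) * sqrt (mfact \<alpha>) * sqrt (mfact \<beta>)"
      unfolding Q_def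
    proof (rule cauchy_coeffsD[OF cauchy])
      fix z w :: "complex ^ 'd"
      assume z: "\<forall>i. cmod (z $ i) = sqrt (real (\<alpha> $ i))" and w: "\<forall>i. cmod (w $ i) = sqrt (real (\<beta> $ i))"
      from z have z': "(norm z)\<^sup>2 = real (mabs \<alpha>)" "norm z powr (1 / s) = ?p \<alpha>"
        by (auto intro!: norm_sqrt_multi_index s)
      from w have w': "(norm w)\<^sup>2 = real (mabs \<beta>)" "norm w powr (1 / s) = ?p \<beta>"
        by (auto intro!: norm_sqrt_multi_index s)
      show "cmod (Op_kernel a z w) \<le> C * exp (real (mabs \<alpha>) / 2 + real (mabs \<beta>) / 2 + \<mu> * (?p \<alpha> + ?p \<beta>))"
        using norm_kernel_le[where a = a and z = z and w = w, OF a] unfolding z' w' .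
    qed auto
    also have "\<dots> = ?E * ((sqrt (mfact \<alpha>) * exp (real (mabs \<alpha>) / 2)) * (sqrt (mfact \<beta>) * exp (real (mabs \<beta>) / 2)))"
      by (simp add: exp_add ring_distribs mult_ac)
    also have "\<dots> \<le> ?E * ((D * exp (\<epsilon> * ?p \<alpha>) * Q \<alpha>) * (D * exp (\<epsilon> * ?p \<beta>) * Q \<beta>))"
      using C D(1) Q less_imp_le[OF Q] by (intro mult_left_mono mult_mono stirling) auto
    also have "\<dots> = ((C * D * D) * vartheta (\<mu> + \<epsilon>) s \<alpha> * vartheta (\<mu> + \<epsilon>) s \<beta>) * Q \<alpha> * Q \<beta>"
      by (simp add: vartheta_def exp_add ring_distribs mult_ac)
    finally show ?thesis using Q by (simp add: mult_le_cancel_right)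
  qed
  then show ?thesis using C D(1) by (intro exI[of _ "C * D * D"]) auto
qed

section \<open>Weighted sequence spaces\<close>

lemma lp_norm_upper:
  assumes p: "1 \<le> p" and c: "c \<in> lp_space p"
  shows "cmod (c i) \<le> lp_norm p c"
proof (cases "p = \<infinity>")
  case True
  then have "bdd_above (range (\<lambda>i. cmod (c i)))"
    using c by (auto simp: lp_space_def bounded_iff bdd_above_def)
  then have "cmod (c i) \<le> (SUP i. cmod (c i))" by (rule cSUP_upper[OF UNIV_I])
  then show ?thesis using True c by (simp add: lp_norm_def)
next
  case False
  define q where "q = real_of_ereal p"
  have q: "1 \<le> q" using p False by (cases p) (auto simp: q_def one_ereal_def)
  have s: "(\<lambda>i. cmod (c i) powr q) summable_on UNIV"
    using c False by (simp add: lp_space_def q_def)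
  have "cmod (c i) powr q \<le> (\<Sum>\<^sub>\<infinity>i. cmod (c i) powr q)"
    using finite_sum_le_infsum[OF s, of "{i}"] by simp
  then have "(cmod (c i) powr q) powr (1 / q) \<le> (\<Sum>\<^sub>\<infinity>i. cmod (c i) powr q) powr (1 / q)"
    using q by (intro powr_mono2) auto
  then show ?thesis using q c False by (simp add: powr_powr lp_norm_def q_def)
qed

lemma lp_dominated:
  assumes p: "1 \<le> p" and c: "c \<in> lp_space p" and K: "0 \<le> K" and le: "\<And>i. cmod (d i) \<le> K * cmod (c i)"
  shows "d \<in> lp_space p" and "lp_norm p d \<le> K * lp_norm p c"
proof -
  have "d \<in> lp_space p \<and> lp_norm p d \<le> K * lp_norm p c"
  proof (cases "p = \<infinity>")
    case True
    have le': "cmod (d i) \<le> K * lp_norm p c" for i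
      using le[of i] mult_left_mono[OF lp_norm_upper[OF p c, of i] K] by linarith
    then have "d \<in> lp_space p" using True by (auto simp: lp_space_def bounded_iff)
    then show ?thesis using True le' by (auto simp: lp_norm_def intro: cSUP_least)
  next
    case False
    define q where "q = real_of_ereal p"
    have q: "1 \<le> q" using p False by (cases p) (auto simp: q_def one_ereal_def)
    have s: "(\<lambda>i. cmod (c i) powr q) summable_on UNIV"
      using c False by (simp add: lp_space_def q_def)
    have le': "cmod (d i) powr q \<le> K powr q * cmod (c i) powr q" for i
      using powr_mono2[OF _ _ le, of q i] q by (simp add: powr_mult)
    have sK: "(\<lambda>i. K powr q * cmod (c i) powr q) summable_on UNIV"
      using s by (rule summable_on_cmult_right)
    have sd: "(\<lambda>i. cmod (d i) powr q) summable_on UNIV"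
      by (rule summable_on_comparison_test[OF sK]) (use le' in auto)
    then have d: "d \<in> lp_space p" using False by (simp add: lp_space_def q_def)
    have "(\<Sum>\<^sub>\<infinity>i. cmod (d i) powr q) \<le> (\<Sum>\<^sub>\<infinity>i. K powr q * cmod (c i) powr q)"
      by (rule infsum_mono[OF sd sK le'])
    also have "\<dots> = K powr q * (\<Sum>\<^sub>\<infinity>i. cmod (c i) powr q)" by (rule infsum_cmult_right')
    finally have "(\<Sum>\<^sub>\<infinity>i. cmod (d i) powr q) powr (1 / q) \<le> (K powr q * (\<Sum>\<^sub>\<infinity>i. cmod (c i) powr q)) powr (1 / q)"
      using q by (intro powr_mono2) (auto intro: infsum_nonneg)
    also have "\<dots> = K * (\<Sum>\<^sub>\<infinity>i. cmod (c i) powr q) powr (1 / q)"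
      using q K by (simp add: powr_mult powr_powr)
    finally show ?thesis using d c False by (simp add: lp_norm_def q_def)
  qed
  then show "d \<in> lp_space p" "lp_norm p d \<le> K * lp_norm p c" by auto
qed

lemma vartheta_uminus: "1 / vartheta r s \<alpha> = vartheta (- r) s \<alpha>"
  by (simp add: vartheta_def exp_minus field_simps)

lemma vartheta_add: "vartheta (r + r') s \<alpha> = vartheta r s \<alpha> * vartheta r' s \<alpha>"
  by (simp add: vartheta_def ring_distribs exp_add)

text \<open>|\<alpha>|^\<kappa> is at least the average of the \<alpha>_i^\<kappa>, so the weight is
  dominated by a product of one-variable weights with rate \<eta> = -r / d, where d is the number of
  coordinates. Each of these is summable by comparison with 1/(n+1)^2.\<close>

lemma summable_on_vartheta:
  assumes "0 < s" "r < 0"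
  shows "(\<lambda>\<alpha>::nat ^ 'd::finite. vartheta r s \<alpha>) summable_on UNIV"
proof -
  define \<kappa> where "\<kappa> = 1 / (2 * s)"
  define \<eta> where "\<eta> = - r / CARD('d)"
  have \<kappa>: "0 < \<kappa>" and \<eta>: "0 < \<eta>" using assms by (simp_all add: \<kappa>_def \<eta>_def divide_pos_pos divide_neg_pos)
  \<comment> \<open>The fourth power of the square root is the square of e (n+1), enough to dominate
    (n+1)^2.\<close>
  obtain D where D: "\<And>n. sqrt (exp 1 * (real n + 1)) ^ 4 \<le> D * exp (\<eta> * real n powr \<kappa>)"
    using poly_le_exp_powr[OF \<kappa> \<eta>, of 4] by blast
  have "exp (- (\<eta> * real n powr \<kappa>)) \<le> D * inverse (real (Suc n) ^ 2)" for n
  proof -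
    define u where "u = exp 1 * (real n + 1)"
    have "1 * (real n + 1) \<le> exp 1 * (real n + 1)" by (rule mult_right_mono) simp_all
    then have u: "real (Suc n) \<le> u" by (simp only: u_def of_nat_Suc mult_1 add.commute)
    then have "0 \<le> u" by linarith
    have "sqrt u ^ 4 = (sqrt u ^ 2) ^ 2" by (simp only: power_mult[symmetric]) simp
    with D[of n] \<open>0 \<le> u\<close> have "u ^ 2 \<le> D * exp (\<eta> * real n powr \<kappa>)" by (simp add: u_def)
    moreover have "real (Suc n) ^ 2 \<le> u ^ 2" using u by (rule power_mono) simp
    ultimately have "real (Suc n) ^ 2 \<le> D * exp (\<eta> * real n powr \<kappa>)" by linarith
    then have "real (Suc n) ^ 2 * (inverse (real (Suc n) ^ 2) * exp (- (\<eta> * real n powr \<kappa>)))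
        \<le> D * exp (\<eta> * real n powr \<kappa>) * (inverse (real (Suc n) ^ 2) * exp (- (\<eta> * real n powr \<kappa>)))"
      by (rule mult_right_mono) auto
    moreover have "exp (\<eta> * real n powr \<kappa>) * exp (- (\<eta> * real n powr \<kappa>)) = 1"
      by (simp flip: exp_add)
    then have "D * exp (\<eta> * real n powr \<kappa>) * (inverse (real (Suc n) ^ 2) * exp (- (\<eta> * real n powr \<kappa>)))
        = D * inverse (real (Suc n) ^ 2)"
      by (simp only: mult_ac mult_1_right)
    moreover have "real (Suc n) ^ 2 * (inverse (real (Suc n) ^ 2) * exp (- (\<eta> * real n powr \<kappa>)))
        = exp (- (\<eta> * real n powr \<kappa>))"
      by (simp del: of_nat_Suc)
    ultimately show ?thesis by (simp only:)
  qed
  then have le: "norm (exp (- (\<eta> * real n powr \<kappa>))) \<le> D * inverse (real (Suc n) ^ 2)" for n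
    by simp
  have "summable (\<lambda>n. inverse (real n ^ 2))" by (rule inverse_power_summable) simp
  then have "summable (\<lambda>n. inverse (real (Suc n) ^ 2))"
    by (simp only: summable_Suc_iff[of "\<lambda>n. inverse (real n ^ 2)"])
  then have "summable (\<lambda>n. D * inverse (real (Suc n) ^ 2))" by (rule summable_mult)
  then have "summable (\<lambda>n. exp (- (\<eta> * real n powr \<kappa>)))"
    by (rule summable_comparison_test'[where N = 0]) (rule le)
  then have "((\<lambda>n. exp (- (\<eta> * real n powr \<kappa>))) has_sum (\<Sum>n. exp (- (\<eta> * real n powr \<kappa>)))) UNIV"
    by (intro sums_nonneg_imp_has_sum summable_sums) auto
  from has_sum_prod_vec[of "\<lambda>_::'d. \<lambda>n. exp (- (\<eta> * real n powr \<kappa>))", OF this]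
  have "(\<lambda>\<alpha>::nat ^ 'd. \<Prod>i\<in>UNIV. exp (- (\<eta> * real (\<alpha> $ i) powr \<kappa>))) summable_on UNIV"
    by (intro has_sum_imp_summable) auto
  then show ?thesis
  proof (rule summable_on_comparison_test)
    fix \<alpha> :: "nat ^ 'd"
    have "(\<Sum>i\<in>UNIV. \<eta> * real (\<alpha> $ i) powr \<kappa>) \<le> (\<Sum>i\<in>(UNIV :: 'd set). \<eta> * real (mabs \<alpha>) powr \<kappa>)"
      using \<kappa> \<eta> by (intro sum_mono mult_left_mono powr_mono2) (auto simp: le_mabs)
    also have "\<dots> = - r * real (mabs \<alpha>) powr \<kappa>" by (simp add: \<eta>_def)
    finally show "vartheta r s \<alpha> \<le> (\<Prod>i\<in>UNIV. exp (- (\<eta> * real (\<alpha> $ i) powr \<kappa>)))"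
      by (simp add: vartheta_def \<kappa>_def sum_negf flip: exp_sum)
  qed (simp add: vartheta_def)
qed

text \<open>The weight is summable and at most 1, so raising it to a power p \<ge> 1 only makes it
  smaller.\<close>

lemma vartheta_in_lp_space:
  assumes "1 \<le> p" "0 < s" "r < 0"
  shows "(\<lambda>\<alpha>::nat ^ 'd::finite. of_real (vartheta r s \<alpha>)) \<in> lp_space p"
proof -
  have le1: "vartheta r s \<alpha> \<le> 1" for \<alpha> :: "nat ^ 'd"
    using assms by (simp add: vartheta_def mult_nonpos_nonneg)
  show ?thesis
  proof (cases "p = \<infinity>")
    case True
    have "cmod (of_real (vartheta r s \<alpha>)) \<le> 1" for \<alpha> :: "nat ^ 'd"
      using le1 by (simp add: abs_of_pos[OF vartheta_pos])
    then show ?thesis using True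
      by (auto simp: lp_space_def bounded_iff simp del: norm_of_real)
  next
    case False
    have q: "1 \<le> real_of_ereal p" using assms(1) False by (cases p) (auto simp: one_ereal_def)
    have "(\<lambda>\<alpha>::nat ^ 'd. vartheta r s \<alpha> powr real_of_ereal p) summable_on UNIV"
    proof (rule summable_on_comparison_test[OF summable_on_vartheta[OF assms(2,3)]])
      show "vartheta r s \<alpha> powr real_of_ereal p \<le> vartheta r s \<alpha>" for \<alpha> :: "nat ^ 'd"
        using powr_mono'[OF q, of "vartheta r s \<alpha>"] le1 vartheta_pos[of r s \<alpha>] by simp
    qed simp
    then show ?thesis using False
      by (simp add: lp_space_def abs_of_pos[OF vartheta_pos])
  qed
qed

section \<open>The scale of weighted spaces over all real r\<close>

definition wsp :: "ereal \<Rightarrow> real \<Rightarrow> real \<Rightarrow> ('d::finite) fseries set" where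
  "wsp p s r = weighted_lp p (vartheta r s)"

definition wnorm :: "ereal \<Rightarrow> real \<Rightarrow> real \<Rightarrow> ('d::finite) fseries \<Rightarrow> real" where
  "wnorm p s r F = lp_norm p (\<lambda>\<alpha>. F \<alpha> * of_real (vartheta r s \<alpha>))"

definition wtop :: "ereal \<Rightarrow> real \<Rightarrow> real \<Rightarrow> ('d::finite) fseries topology" where
  "wtop p s r = weighted_lp_topology p (vartheta r s)"

lemma wnorm_nonneg: "0 \<le> wnorm p s r F"
  by (simp add: wnorm_def lp_norm_nonneg)

lemma wnorm_0: "1 \<le> p \<Longrightarrow> wnorm p s r (\<lambda>_. 0) = 0"
  by (simp add: wnorm_def lp_norm_0)

lemma wsp_0: "1 \<le> p \<Longrightarrow> (\<lambda>_. 0) \<in> wsp p s r"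
  by (simp add: wsp_def weighted_lp_def lp_space_0)

lemma topspace_wtop: "1 \<le> p \<Longrightarrow> topspace (wtop p s r) = wsp p s r"
  unfolding wtop_def wsp_def
  by (rule topspace_weighted_lp_topology) (auto simp: vartheta_def)

lemma wsp_lincomb:
  "1 \<le> p \<Longrightarrow> F \<in> wsp p s r \<Longrightarrow> G \<in> wsp p s r \<Longrightarrow> (\<lambda>\<alpha>. k * F \<alpha> + l * G \<alpha>) \<in> wsp p s r"
  unfolding wsp_def by (rule weighted_lp_lincomb)

lemma wsp_antimono: "1 \<le> p \<Longrightarrow> r \<le> r' \<Longrightarrow> wsp p s r' \<subseteq> wsp p s r"
  unfolding wsp_def
  by (rule weighted_lp_antimono) (auto simp: vartheta_mono less_imp_le[OF vartheta_pos])

lemma wnorm_dominated: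
  assumes "1 \<le> p" "F \<in> wsp p s r" "0 \<le> K"
    "\<And>\<alpha>. cmod (G \<alpha>) * vartheta t s \<alpha> \<le> K * (cmod (F \<alpha>) * vartheta r s \<alpha>)"
  shows "G \<in> wsp p s t" "wnorm p s t G \<le> K * wnorm p s r F"
proof -
  have F: "(\<lambda>\<alpha>. F \<alpha> * of_real (vartheta r s \<alpha>)) \<in> lp_space p"
    using assms(2) by (simp add: wsp_def weighted_lp_def)
  have le: "cmod (G \<alpha> * of_real (vartheta t s \<alpha>)) \<le> K * cmod (F \<alpha> * of_real (vartheta r s \<alpha>))" for \<alpha>
    using assms(4)[of \<alpha>] vartheta_pos[of t s \<alpha>] vartheta_pos[of r s \<alpha>] by (simp add: norm_mult)
  show "G \<in> wsp p s t" "wnorm p s t G \<le> K * wnorm p s r F"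
    unfolding wnorm_def wsp_def weighted_lp_def
    using lp_dominated[OF assms(1) F assms(3) le] by simp_all
qed

lemma wnorm_lincomb_le:
  assumes p: "1 \<le> p" and F: "F \<in> wsp p s r" and G: "G \<in> wsp p s r"
  shows "wnorm p s r (\<lambda>\<alpha>. k * F \<alpha> + l * G \<alpha>) \<le> cmod k * wnorm p s r F + cmod l * wnorm p s r G"
proof -
  have kF: "(\<lambda>\<alpha>. k * F \<alpha>) \<in> wsp p s r" "wnorm p s r (\<lambda>\<alpha>. k * F \<alpha>) \<le> cmod k * wnorm p s r F"
    if "F \<in> wsp p s r" for k F
    using wnorm_dominated[OF p that, of "cmod k" "\<lambda>\<alpha>. k * F \<alpha>" r]
    by (simp_all add: norm_mult mult.assoc)
  have "wnorm p s r (\<lambda>\<alpha>. k * F \<alpha> + l * G \<alpha>) \<le> wnorm p s r (\<lambda>\<alpha>. k * F \<alpha>) + wnorm p s r (\<lambda>\<alpha>. l * G \<alpha>)"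
    using lp_minkowski[OF p, of "\<lambda>\<alpha>. k * F \<alpha> * of_real (vartheta r s \<alpha>)" "\<lambda>\<alpha>. l * G \<alpha> * of_real (vartheta r s \<alpha>)"]
      kF(1)[OF F, of k] kF(1)[OF G, of l]
    by (simp add: wnorm_def wsp_def weighted_lp_def distrib_right)
  with kF(2)[OF F, of k] kF(2)[OF G, of l] show ?thesis by linarith
qed

lemma norm_le_wnorm:
  assumes p: "1 \<le> p" and F: "F \<in> wsp p s r"
  shows "cmod (F \<alpha>) \<le> wnorm p s r F * vartheta (- r) s \<alpha>"
proof -
  have "cmod (F \<alpha> * of_real (vartheta r s \<alpha>)) \<le> wnorm p s r F"
    unfolding wnorm_def by (rule lp_norm_upper[OF p]) (use F in \<open>simp add: wsp_def weighted_lp_def\<close>)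
  then have "cmod (F \<alpha>) * vartheta r s \<alpha> \<le> wnorm p s r F"
    using vartheta_pos[of r s \<alpha>] by (simp add: norm_mult)
  then show ?thesis
    using vartheta_pos[of r s \<alpha>] by (simp add: vartheta_uminus[symmetric] pos_le_divide_eq)
qed

lemma openin_wtop:
  assumes p: "1 \<le> p"
  shows "openin (wtop p s r) U \<longleftrightarrow> U \<subseteq> wsp p s r \<and>
    (\<forall>F\<in>U. \<exists>e>0. \<forall>G\<in>wsp p s r. wnorm p s r (\<lambda>\<alpha>. F \<alpha> - G \<alpha>) < e \<longrightarrow> G \<in> U)"
proof -
  interpret Metric_space "weighted_lp p (vartheta r s) :: 'a fseries set" "weighted_lp_dist p (vartheta r s)"
    by (rule Metric_space_weighted_lp[OF p]) (simp add: vartheta_def)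
  have dist: "weighted_lp_dist p (vartheta r s) F G = wnorm p s r (\<lambda>\<alpha>. F \<alpha> - G \<alpha>)" for F G :: "'a fseries"
    by (simp add: weighted_lp_dist_def wnorm_def)
  show ?thesis
    unfolding wtop_def weighted_lp_topology_def openin_mtopology wsp_def
  proof (intro conj_cong refl)
    assume U: "U \<subseteq> weighted_lp p (vartheta r s)"
    have "mball F e \<subseteq> U \<longleftrightarrow> (\<forall>G\<in>weighted_lp p (vartheta r s). wnorm p s r (\<lambda>\<alpha>. F \<alpha> - G \<alpha>) < e \<longrightarrow> G \<in> U)"
      if "F \<in> U" for F e
      using U that by (auto simp: subset_iff in_mball dist)
    then show "(\<forall>F. F \<in> U \<longrightarrow> (\<exists>e>0. mball F e \<subseteq> U)) \<longleftrightarrow>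
        (\<forall>F\<in>U. \<exists>e>0. \<forall>G\<in>weighted_lp p (vartheta r s). wnorm p s r (\<lambda>\<alpha>. F \<alpha> - G \<alpha>) < e \<longrightarrow> G \<in> U)"
      unfolding Ball_def[of U] by (simp cong: imp_cong)
  qed
qed

text \<open>Crude estimates suffice: |F \<beta>| is at most \<open>wnorm p s r F\<close> times the
  weight of index -r, the sum over \<beta> of the weight of index \<mu> - r converges since \<mu> <
  r, and a sequence dominated by the weight of index \<mu> lies in \<open>wsp p s t\<close> since
  \<mu> + t < 0. The two strict gaps replace any use of Hoelder's inequality.\<close>

lemma bounded_matrix_operator:
  fixes c :: "nat ^ 'd::finite \<Rightarrow> nat ^ 'd \<Rightarrow> complex"
  assumes p: "1 \<le> p" and s: "0 < s" and C: "0 \<le> C"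
    and c: "\<And>\<alpha> \<beta>. cmod (c \<alpha> \<beta>) \<le> C * vartheta \<mu> s \<alpha> * vartheta \<mu> s \<beta>"
    and \<mu>: "\<mu> < r" "\<mu> + t < 0"
  shows "F \<in> wsp p s r \<Longrightarrow> (\<lambda>\<beta>. c \<alpha> \<beta> * F \<beta>) summable_on UNIV"
    and "F \<in> wsp p s r \<Longrightarrow> (\<lambda>\<alpha>. \<Sum>\<^sub>\<infinity>\<beta>. c \<alpha> \<beta> * F \<beta>) \<in> wsp p s t"
    and "\<exists>B\<ge>0. \<forall>F\<in>wsp p s r. wnorm p s t (\<lambda>\<alpha>. \<Sum>\<^sub>\<infinity>\<beta>. c \<alpha> \<beta> * F \<beta>) \<le> B * wnorm p s r F"
proof -
  define S where "S = (\<Sum>\<^sub>\<infinity>\<beta>::nat ^ 'd. vartheta (\<mu> - r) s \<beta>)"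
  have sS: "(\<lambda>\<beta>::nat ^ 'd. vartheta (\<mu> - r) s \<beta>) summable_on UNIV"
    by (rule summable_on_vartheta[OF s]) (use \<mu> in simp)
  have S: "0 \<le> S" unfolding S_def by (rule infsum_nonneg) (simp add: vartheta_def)
  define L where "L = lp_norm p (\<lambda>\<alpha>::nat ^ 'd. of_real (vartheta (\<mu> + t) s \<alpha>))"
  have L: "0 \<le> L" by (simp add: L_def lp_norm_nonneg)
  have term_le: "cmod (c \<alpha> \<beta> * F \<beta>) \<le> (C * vartheta \<mu> s \<alpha> * wnorm p s r F) * vartheta (\<mu> - r) s \<beta>"
    if "F \<in> wsp p s r" for F \<alpha> \<beta>
  proof -
    have "cmod (c \<alpha> \<beta> * F \<beta>) \<le> (C * vartheta \<mu> s \<alpha> * vartheta \<mu> s \<beta>) * (wnorm p s r F * vartheta (- r) s \<beta>)"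
      unfolding norm_mult using C
      by (intro mult_mono c norm_le_wnorm[OF p that]) (auto simp: less_imp_le[OF vartheta_pos])
    also have "\<dots> = (C * vartheta \<mu> s \<alpha> * wnorm p s r F) * vartheta (\<mu> - r) s \<beta>"
      using vartheta_add[of \<mu> "- r" s \<beta>] by (simp add: mult_ac)
    finally show ?thesis .
  qed
  have sums: "(\<lambda>\<beta>. cmod (c \<alpha> \<beta> * F \<beta>)) summable_on UNIV" if "F \<in> wsp p s r" for F \<alpha>
    by (rule summable_on_comparison_test[OF summable_on_cmult_right[OF sS]])
       (use term_le[OF that] in auto)
  show "(\<lambda>\<beta>. c \<alpha> \<beta> * F \<beta>) summable_on UNIV" if "F \<in> wsp p s r" for F \<alpha>
    by (rule abs_summable_summable[OF sums[OF that]])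
  have T_le: "cmod (\<Sum>\<^sub>\<infinity>\<beta>. c \<alpha> \<beta> * F \<beta>) \<le> C * wnorm p s r F * S * vartheta \<mu> s \<alpha>"
    if "F \<in> wsp p s r" for F \<alpha>
  proof -
    have "cmod (\<Sum>\<^sub>\<infinity>\<beta>. c \<alpha> \<beta> * F \<beta>) \<le> (\<Sum>\<^sub>\<infinity>\<beta>. cmod (c \<alpha> \<beta> * F \<beta>))"
      by (rule norm_infsum_bound[OF sums[OF that]])
    also have "\<dots> \<le> (\<Sum>\<^sub>\<infinity>\<beta>::nat ^ 'd. (C * vartheta \<mu> s \<alpha> * wnorm p s r F) * vartheta (\<mu> - r) s \<beta>)"
      by (intro infsum_mono sums[OF that] summable_on_cmult_right sS term_le[OF that])
    also have "\<dots> = (C * vartheta \<mu> s \<alpha> * wnorm p s r F) * S"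
      unfolding S_def by (rule infsum_cmult_right')
    finally show ?thesis by (simp add: mult_ac)
  qed
  have T: "(\<lambda>\<alpha>. \<Sum>\<^sub>\<infinity>\<beta>. c \<alpha> \<beta> * F \<beta>) \<in> wsp p s t \<and>
      wnorm p s t (\<lambda>\<alpha>. \<Sum>\<^sub>\<infinity>\<beta>. c \<alpha> \<beta> * F \<beta>) \<le> (C * wnorm p s r F * S) * L"
    if F: "F \<in> wsp p s r" for F
  proof -
    have K: "0 \<le> C * wnorm p s r F * S" using C S by (simp add: wnorm_nonneg)
    have le: "cmod ((\<Sum>\<^sub>\<infinity>\<beta>. c \<alpha> \<beta> * F \<beta>) * of_real (vartheta t s \<alpha>)) \<le>
        (C * wnorm p s r F * S) * cmod (of_real (vartheta (\<mu> + t) s \<alpha>))" for \<alpha>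
      using mult_right_mono[OF T_le[OF F], of "vartheta t s \<alpha>" \<alpha>] vartheta_pos[of t s \<alpha>] vartheta_pos[of \<mu> s \<alpha>]
      by (simp add: norm_mult vartheta_add mult_ac)
    show ?thesis
      using lp_dominated[OF p vartheta_in_lp_space[OF p s \<mu>(2)] K le]
      by (simp add: wsp_def weighted_lp_def wnorm_def L_def)
  qed
  then show "(\<lambda>\<alpha>. \<Sum>\<^sub>\<infinity>\<beta>. c \<alpha> \<beta> * F \<beta>) \<in> wsp p s t" if "F \<in> wsp p s r" for F using that by blast
  show "\<exists>B\<ge>0. \<forall>F\<in>wsp p s r. wnorm p s t (\<lambda>\<alpha>. \<Sum>\<^sub>\<infinity>\<beta>. c \<alpha> \<beta> * F \<beta>) \<le> B * wnorm p s r F"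
  proof (intro exI[of _ "C * S * L"] conjI ballI)
    show "0 \<le> C * S * L" using C S L by simp
    show "wnorm p s t (\<lambda>\<alpha>. \<Sum>\<^sub>\<infinity>\<beta>. c \<alpha> \<beta> * F \<beta>) \<le> C * S * L * wnorm p s r F" if "F \<in> wsp p s r" for F
      using T[OF that] by (simp add: mult_ac)
  qed
qed

section \<open>Approximation by polynomials\<close>

definition truncate :: "nat \<Rightarrow> ('d::finite) fseries \<Rightarrow> 'd fseries" where
  "truncate N F \<alpha> = (if \<alpha> \<in> mindex_le N then F \<alpha> else 0)"

lemma truncate_A_zero: "truncate N F \<in> A_zero"
  unfolding A_zero_def truncate_def
  by (auto intro: finite_subset[OF _ finite_mindex_le[of N]])

lemma truncate_wsp:
  assumes p: "1 \<le> p" and F: "F \<in> wsp p s r"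
  shows "truncate N F \<in> wsp p s r"
  by (rule wnorm_dominated(1)[OF p F, of 1])
     (auto simp: truncate_def less_imp_le[OF vartheta_pos])

text \<open>The norm is weakened from r to t: for p = \<infinity> truncations need not converge in
  the norm of index r itself. On the tail |\<alpha>| > N the change of weight gains the factor exp
  ((t - r) N^(1/(2s))).\<close>

lemma truncate_tendsto:
  assumes p: "1 \<le> p" and s: "0 < s" and F: "F \<in> wsp p s r" and t: "t < r"
  shows "(\<lambda>N. wnorm p s t (\<lambda>\<alpha>. F \<alpha> - truncate N F \<alpha>)) \<longlonglongrightarrow> 0"
proof (rule tendsto_sandwich[where f = "\<lambda>_. 0"])
  let ?e = "\<lambda>N. exp ((t - r) * real N powr (1 / (2 * s)))"
  show "\<forall>\<^sub>F N in sequentially. wnorm p s t (\<lambda>\<alpha>. F \<alpha> - truncate N F \<alpha>) \<le> ?e N * wnorm p s r F"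
  proof (intro always_eventually allI wnorm_dominated(2)[OF p F])
    fix N \<alpha>
    show "cmod (F \<alpha> - truncate N F \<alpha>) * vartheta t s \<alpha> \<le> ?e N * (cmod (F \<alpha>) * vartheta r s \<alpha>)"
    proof (cases "mabs \<alpha> \<le> N")
      case True
      then show ?thesis by (simp add: truncate_def mindex_le_def less_imp_le[OF vartheta_pos])
    next
      case False
      then have "(t - r) * real (mabs \<alpha>) powr (1 / (2 * s)) \<le> (t - r) * real N powr (1 / (2 * s))"
        using t s by (intro mult_left_mono_neg powr_mono2) auto
      then have "vartheta (t - r) s \<alpha> \<le> ?e N" by (simp add: vartheta_def)
      then have "vartheta (t - r) s \<alpha> * (cmod (F \<alpha>) * vartheta r s \<alpha>) \<le> ?e N * (cmod (F \<alpha>) * vartheta r s \<alpha>)"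
        by (rule mult_right_mono) (simp add: less_imp_le[OF vartheta_pos])
      moreover have "vartheta t s \<alpha> = vartheta (t - r) s \<alpha> * vartheta r s \<alpha>"
        using vartheta_add[of "t - r" r s \<alpha>] by simp
      ultimately show ?thesis using False by (simp add: truncate_def mindex_le_def mult_ac)
    qed
  qed simp
  have "?e \<longlonglongrightarrow> 0"
  proof -
    define \<kappa> \<eta> where "\<kappa> = 1 / (2 * s)" and "\<eta> = r - t"
    have "0 < \<kappa>" "0 < \<eta>" using s t by (simp_all add: \<kappa>_def \<eta>_def)
    then have "(\<lambda>N. exp (- (\<eta> * real N powr \<kappa>))) \<longlonglongrightarrow> 0" by real_asymp
    then show ?thesis by (simp add: \<kappa>_def \<eta>_def algebra_simps)
  qed
  from tendsto_mult_right[OF this, of "wnorm p s r F"]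
  show "(\<lambda>N. ?e N * wnorm p s r F) \<longlonglongrightarrow> 0" by simp
qed (auto simp: wnorm_nonneg)

section \<open>Continuity between limit spaces\<close>

text \<open>Since \<open>1/\<vartheta>\<^sub>r = \<vartheta>\<^bsub>-r\<^esub>\<close>, all four spaces are limits of \<open>wsp p s r\<close> with \<open>r\<close> ranging over
  one of the two open half-lines.\<close>

definition open_ray :: "real set \<Rightarrow> bool" where
  "open_ray R \<longleftrightarrow> R \<noteq> {} \<and> (\<forall>r\<in>R. (\<exists>t\<in>R. t < r) \<and> (\<exists>t\<in>R. r < t))"

lemma open_ray_pos: "open_ray {0<..}" and open_ray_neg: "open_ray {..<0}"
proof -
  show "open_ray {0<..}"
    unfolding open_ray_def
  proof (intro conjI ballI)
    show "{0::real<..} \<noteq> {}" using zero_less_one by blast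
    fix r :: real assume "r \<in> {0<..}"
    then show "\<exists>t\<in>{0<..}. t < r" "\<exists>t\<in>{0<..}. r < t"
      by (auto intro: bexI[of _ "r / 2"] bexI[of _ "r + 1"])
  qed
  show "open_ray {..<0}"
    unfolding open_ray_def
  proof (intro conjI ballI)
    show "{..<0::real} \<noteq> {}" using neg_less_0_iff_less zero_less_one by blast
    fix r :: real assume "r \<in> {..<0}"
    then show "\<exists>t\<in>{..<0}. t < r" "\<exists>t\<in>{..<0}. r < t"
      by (auto intro: bexI[of _ "r - 1"] bexI[of _ "r / 2"])
  qed
qed

definition proj_sp :: "ereal \<Rightarrow> real \<Rightarrow> real set \<Rightarrow> ('d::finite) fseries topology" where
  "proj_sp p s R = projective_limit_topology R (wtop p s)"

definition ind_sp :: "ereal \<Rightarrow> real \<Rightarrow> real set \<Rightarrow> ('d::finite) fseries topology" where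
  "ind_sp p s R = inductive_limit_topology R (wtop p s)"

lemma projective_limit_reindex:
  "projective_limit_topology (f ` R) T = projective_limit_topology R (\<lambda>r. T (f r))"
  unfolding projective_limit_topology_def by (rule arg_cong[of _ _ topology_generated_by]) auto

lemma inductive_limit_reindex:
  "inductive_limit_topology (f ` R) T = inductive_limit_topology R (\<lambda>r. T (f r))"
  unfolding inductive_limit_topology_def inductive_limit_nhd0_def by simp

lemma uminus_pos_ray: "uminus ` {0::real<..} = {..<0}"
  by simp

lemma A_spaces_eq:
  shows A_0s_eq: "A_0s p s = proj_sp p s {0<..}"
    and A_s_eq: "A_s p s = ind_sp p s {0<..}"
    and A_s_dual_eq: "A_s_dual p s = proj_sp p s {..<0}"
    and A_0s_dual_eq: "A_0s_dual p s = ind_sp p s {..<0}"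
  unfolding A_0s_def A_s_def A_s_dual_def A_0s_dual_def proj_sp_def ind_sp_def
    uminus_pos_ray[symmetric] projective_limit_reindex inductive_limit_reindex wtop_def vartheta_uminus
  by simp_all

lemma topspace_proj_sp: "1 \<le> p \<Longrightarrow> R \<noteq> {} \<Longrightarrow> topspace (proj_sp p s R) = (\<Inter>r\<in>R. wsp p s r)"
  by (simp add: proj_sp_def topspace_projective_limit_topology topspace_wtop)

lemma openin_ind_sp:
  assumes "1 \<le> p"
  shows "openin (ind_sp p s R) U \<longleftrightarrow> U \<subseteq> (\<Union>r\<in>R. wsp p s r) \<and>
    (\<forall>x\<in>U. \<exists>V. inductive_limit_nhd0 R (wtop p s) V \<and> (\<forall>y\<in>V. (\<lambda>i. x i + y i) \<in> U))"
  unfolding ind_sp_def openin_inductive_limit_topology by (simp add: topspace_wtop assms)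

lemma openin_wtopE:
  assumes p: "1 \<le> p" and U: "openin (wtop p s r) U" "F \<in> U"
  obtains e where "e > 0" "\<And>G. G \<in> wsp p s r \<Longrightarrow> wnorm p s r (\<lambda>\<alpha>. F \<alpha> - G \<alpha>) < e \<Longrightarrow> G \<in> U"
  using U(1)[unfolded openin_wtop[OF p], THEN conjunct2, THEN bspec, OF U(2)] by blast

lemma ind_carrier_lincomb:
  assumes p: "1 \<le> p" and "F \<in> (\<Union>r\<in>R. wsp p s r)" "G \<in> (\<Union>r\<in>R. wsp p s r)"
  shows "(\<lambda>\<alpha>. k * F \<alpha> + l * G \<alpha>) \<in> (\<Union>r\<in>R. wsp p s r)"
proof -
  obtain r t where r: "r \<in> R" "F \<in> wsp p s r" and t: "t \<in> R" "G \<in> wsp p s t"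
    using assms(2,3) by blast
  have m: "min r t \<in> R" using r t by (simp add: min_def)
  have "F \<in> wsp p s (min r t)" "G \<in> wsp p s (min r t)"
    using r t wsp_antimono[OF p, of "min r t" r s] wsp_antimono[OF p, of "min r t" t s] by auto
  then show ?thesis by (intro UN_I[OF m] wsp_lincomb[OF p])
qed

text \<open>A seminorm bounded on every step is continuous on the inductive limit. All
  neighbourhoods of 0 that have to be exhibited are balls of such seminorms.\<close>

lemma seminorm_nhd0:
  fixes q :: "('d::finite) fseries \<Rightarrow> real"
  assumes p: "1 \<le> p" and e: "0 < e"
    and lin: "\<And>F G k l. F \<in> (\<Union>r\<in>R. wsp p s r) \<Longrightarrow> G \<in> (\<Union>r\<in>R. wsp p s r) \<Longrightarrow>
      q (\<lambda>\<alpha>. k * F \<alpha> + l * G \<alpha>) \<le> cmod k * q F + cmod l * q G"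
    and bound: "\<And>r. r \<in> R \<Longrightarrow> \<exists>B\<ge>0. \<forall>F\<in>wsp p s r. q F \<le> B * wnorm p s r F"
  shows "inductive_limit_nhd0 R (wtop p s) {F \<in> (\<Union>r\<in>R. wsp p s r). q F < e}" (is "inductive_limit_nhd0 _ _ ?V")
  unfolding inductive_limit_nhd0_def topspace_wtop[OF p]
proof (intro conjI ballI)
  show "?V \<subseteq> (\<Union>r\<in>R. wsp p s r)" by blast
  show "absolutely_convex ?V"
    unfolding absolutely_convex_def
  proof (intro ballI allI impI)
    fix F G and k l :: complex
    assume F: "F \<in> ?V" and G: "G \<in> ?V" and kl: "cmod k + cmod l \<le> 1"
    have "(\<lambda>\<alpha>. k * F \<alpha> + l * G \<alpha>) \<in> (\<Union>r\<in>R. wsp p s r)"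
      using F G by (intro ind_carrier_lincomb p) auto
    moreover have "q (\<lambda>\<alpha>. k * F \<alpha> + l * G \<alpha>) < e"
    proof -
      \<comment> \<open>q is not assumed nonnegative, hence the maximum with 0.\<close>
      define m where "m = max 0 (max (q F) (q G))"
      have m: "0 \<le> m" "q F \<le> m" "q G \<le> m" "m < e" using F G e by (auto simp: m_def)
      have "q (\<lambda>\<alpha>. k * F \<alpha> + l * G \<alpha>) \<le> cmod k * q F + cmod l * q G"
        using F G by (intro lin) auto
      also have "\<dots> \<le> cmod k * m + cmod l * m"
        using m by (intro add_mono mult_left_mono) auto
      also have "\<dots> \<le> 1 * m"
        unfolding distrib_right[symmetric] using kl m(1) by (rule mult_right_mono)
      finally show ?thesis using m by simp
    qed
    ultimately show "(\<lambda>\<alpha>. k * F \<alpha> + l * G \<alpha>) \<in> ?V" by simp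
  qed
  fix r assume r: "r \<in> R"
  obtain B where B: "B \<ge> 0" "\<And>F. F \<in> wsp p s r \<Longrightarrow> q F \<le> B * wnorm p s r F" using bound[OF r] by blast
  \<comment> \<open>B may be 0, so B + 1 is used as the divisor.\<close>
  let ?d = "e / (B + 1)"
  let ?W = "{F \<in> wsp p s r. wnorm p s r F < ?d} :: 'd fseries set"
  have "openin (wtop p s r) ?W"
    unfolding openin_wtop[OF p]
  proof (intro conjI ballI)
    fix F assume F: "F \<in> ?W"
    show "\<exists>e'>0. \<forall>G\<in>wsp p s r. wnorm p s r (\<lambda>\<alpha>. F \<alpha> - G \<alpha>) < e' \<longrightarrow> G \<in> ?W"
    proof (intro exI[of _ "?d - wnorm p s r F"] conjI ballI impI)
      show "0 < ?d - wnorm p s r F" using F by simp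
      fix G :: "'d fseries" assume G: "G \<in> wsp p s r" "wnorm p s r (\<lambda>\<alpha>. F \<alpha> - G \<alpha>) < ?d - wnorm p s r F"
      have "(\<lambda>\<alpha>. F \<alpha> - G \<alpha>) \<in> wsp p s r" using wsp_lincomb[OF p, where F = F and G = G and r = r and s = s and k = 1 and l = "- 1"] F G by simp
      from wnorm_lincomb_le[OF p _ this, of F 1 "- 1"] F
      have "wnorm p s r G \<le> wnorm p s r F + wnorm p s r (\<lambda>\<alpha>. F \<alpha> - G \<alpha>)" by simp
      then show "G \<in> ?W" using G by simp
    qed
  qed blast
  moreover have "(\<lambda>_. 0) \<in> ?W" using e B(1) by (simp add: wsp_0 wnorm_0 p)
  moreover have "?W \<subseteq> ?V"
  proof
    fix F assume F: "F \<in> ?W"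
    have "q F \<le> B * wnorm p s r F" using B F by blast
    also have "\<dots> \<le> (B + 1) * wnorm p s r F" by (intro mult_right_mono) (auto simp: wnorm_nonneg)
    also have "\<dots> < (B + 1) * ?d" using F B(1) by (intro mult_strict_left_mono) auto
    also have "\<dots> = e" using B(1) by simp
    finally show "F \<in> ?V" using F r by blast
  qed
  ultimately show "\<exists>W. openin (wtop p s r) W \<and> (\<lambda>i. 0) \<in> W \<and> W \<subseteq> ?V" by blast
qed

lemma topspace_ind_sp:
  assumes p: "1 \<le> p"
  shows "topspace (ind_sp p s R :: ('d::finite) fseries topology) = (\<Union>r\<in>R. wsp p s r)" (is "topspace ?Y = ?X")
proof
  show "topspace (?Y) \<subseteq> ?X"
    using openin_topspace[of "?Y"] unfolding openin_ind_sp[OF p] by blast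
  \<comment> \<open>The zero seminorm, whose ball of radius 1 is the whole carrier.\<close>
  have nhd: "inductive_limit_nhd0 R (wtop p s) {F \<in> ?X. 0 < (1::real)}"
    by (rule seminorm_nhd0[OF p, where q = "\<lambda>_. 0"]) auto
  have "openin (?Y) ?X"
    unfolding openin_ind_sp[OF p]
  proof (intro conjI ballI exI, rule order_refl, rule nhd)
    fix F G assume "F \<in> ?X" "G \<in> {F \<in> ?X. 0 < (1::real)}"
    then show "(\<lambda>\<alpha>. F \<alpha> + G \<alpha>) \<in> ?X"
      using ind_carrier_lincomb[OF p, where F = F and G = G and R = R and s = s and k = 1 and l = 1] by simp
  qed
  then show "?X \<subseteq> topspace (?Y)" by (rule openin_subset)
qed

text \<open>Continuity of the inclusion of a step: a neighbourhood of 0 in the limit contains one in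
  the step, and this is translated to F.\<close>

lemma openin_ind_sp_step:
  assumes p: "1 \<le> p" and U: "openin (ind_sp p s R) U" and r: "r \<in> R"
  shows "openin (wtop p s r) (U \<inter> wsp p s r)"
  unfolding openin_wtop[OF p]
proof (intro conjI ballI)
  fix F assume F: "F \<in> U \<inter> wsp p s r"
  then obtain V where V: "inductive_limit_nhd0 R (wtop p s) V" "\<forall>y\<in>V. (\<lambda>i. F i + y i) \<in> U"
    using U unfolding openin_ind_sp[OF p] by blast
  then obtain W where W: "openin (wtop p s r) W" "(\<lambda>_. 0) \<in> W" "W \<subseteq> V"
    using r unfolding inductive_limit_nhd0_def by blast
  obtain e where e: "e > 0" "\<And>G. G \<in> wsp p s r \<Longrightarrow> wnorm p s r (\<lambda>\<alpha>. 0 - G \<alpha>) < e \<Longrightarrow> G \<in> W"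
    using openin_wtopE[OF p W(1,2)] by blast
  show "\<exists>e>0. \<forall>G\<in>wsp p s r. wnorm p s r (\<lambda>\<alpha>. F \<alpha> - G \<alpha>) < e \<longrightarrow> G \<in> U \<inter> wsp p s r"
  proof (intro exI conjI ballI impI)
    show "e > 0" by fact
    fix G assume G: "G \<in> wsp p s r" "wnorm p s r (\<lambda>\<alpha>. F \<alpha> - G \<alpha>) < e"
    have "(\<lambda>\<alpha>. G \<alpha> - F \<alpha>) \<in> wsp p s r" using wsp_lincomb[OF p, where F = G and G = F and r = r and s = s and k = 1 and l = "- 1"] F G by simp
    then have "(\<lambda>\<alpha>. G \<alpha> - F \<alpha>) \<in> W" using G(2) by (intro e(2)) simp_all
    then show "G \<in> U \<inter> wsp p s r" using V(2) W(3) G(1) by force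
  qed
qed blast

lemma openin_proj_sp_step:
  assumes p: "1 \<le> p" and U: "openin (wtop p s r) U" and r: "r \<in> R"
  shows "openin (proj_sp p s R) (U \<inter> (\<Inter>r\<in>R. wsp p s r))"
  unfolding proj_sp_def projective_limit_topology_def topspace_wtop[OF p]
  by (rule topology_generated_by_Basis) (use U r in blast)

section \<open>Continuity of the coefficient functionals\<close>

lemma openin_wtop_coord:
  assumes p: "1 \<le> p"
  shows "openin (wtop p s r) {F \<in> wsp p s r. cmod (F \<alpha> - z) < e}"
  unfolding openin_wtop[OF p]
proof (intro conjI ballI)
  fix F assume F: "F \<in> {F \<in> wsp p s r. cmod (F \<alpha> - z) < e}"
  let ?d = "(e - cmod (F \<alpha> - z)) * vartheta r s \<alpha>"
  show "\<exists>d>0. \<forall>G\<in>wsp p s r. wnorm p s r (\<lambda>\<alpha>. F \<alpha> - G \<alpha>) < d \<longrightarrow> G \<in> {F \<in> wsp p s r. cmod (F \<alpha> - z) < e}"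
  proof (intro exI[of _ ?d] conjI ballI impI)
    show "0 < ?d" using F by (simp add: vartheta_pos)
    fix G assume G: "G \<in> wsp p s r" "wnorm p s r (\<lambda>\<alpha>. F \<alpha> - G \<alpha>) < ?d"
    have "(\<lambda>\<alpha>. F \<alpha> - G \<alpha>) \<in> wsp p s r" using wsp_lincomb[OF p, where F = F and G = G and r = r and s = s and k = 1 and l = "- 1"] F G by simp
    from norm_le_wnorm[OF p this, of \<alpha>] have "cmod (F \<alpha> - G \<alpha>) \<le> wnorm p s r (\<lambda>\<alpha>. F \<alpha> - G \<alpha>) / vartheta r s \<alpha>"
      by (simp add: vartheta_uminus[symmetric])
    also have "\<dots> < e - cmod (F \<alpha> - z)" using G(2) by (simp add: pos_divide_less_eq vartheta_pos)
    finally have "cmod (G \<alpha> - F \<alpha>) + cmod (F \<alpha> - z) < e" by (simp add: norm_minus_commute)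
    moreover have "cmod (G \<alpha> - z) \<le> cmod (G \<alpha> - F \<alpha>) + cmod (F \<alpha> - z)"
      using norm_triangle_ineq[of "G \<alpha> - F \<alpha>" "F \<alpha> - z"] by simp
    ultimately show "G \<in> {F \<in> wsp p s r. cmod (F \<alpha> - z) < e}" using G(1) by simp
  qed
qed blast

lemma openin_proj_sp_coord:
  assumes p: "1 \<le> p" and "R \<noteq> {}"
  shows "openin (proj_sp p s R) {F \<in> topspace (proj_sp p s R). cmod (F \<alpha> - z) < e}"
proof -
  obtain r where r: "r \<in> R" using assms by blast
  have "openin (proj_sp p s R) ({F \<in> wsp p s r. cmod (F \<alpha> - z) < e} \<inter> (\<Inter>r\<in>R. wsp p s r))"
    by (rule openin_proj_sp_step[OF p openin_wtop_coord[OF p] r])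
  also have "{F \<in> wsp p s r. cmod (F \<alpha> - z) < e} \<inter> (\<Inter>r\<in>R. wsp p s r) =
      {F \<in> topspace (proj_sp p s R). cmod (F \<alpha> - z) < e}"
    using r by (auto simp: topspace_proj_sp[OF assms])
  finally show ?thesis .
qed

lemma openin_ind_sp_coord:
  assumes p: "1 \<le> p"
  shows "openin (ind_sp p s R) {F \<in> topspace (ind_sp p s R). cmod (F \<alpha> - z) < e}"
  unfolding openin_ind_sp[OF p] topspace_ind_sp[OF p]
proof (intro conjI ballI)
  fix F assume F: "F \<in> {F \<in> (\<Union>r\<in>R. wsp p s r). cmod (F \<alpha> - z) < e}"
  let ?V = "{G \<in> (\<Union>r\<in>R. wsp p s r). cmod (G \<alpha>) < e - cmod (F \<alpha> - z)}"
  show "\<exists>V. inductive_limit_nhd0 R (wtop p s) V \<and>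
      (\<forall>G\<in>V. (\<lambda>\<alpha>. F \<alpha> + G \<alpha>) \<in> {F \<in> (\<Union>r\<in>R. wsp p s r). cmod (F \<alpha> - z) < e})"
  proof (intro exI[of _ ?V] conjI ballI)
    show "inductive_limit_nhd0 R (wtop p s) ?V"
    proof (rule seminorm_nhd0[OF p])
      show "0 < e - cmod (F \<alpha> - z)" using F by simp
      show "cmod (k * F \<alpha> + l * G \<alpha>) \<le> cmod k * cmod (F \<alpha>) + cmod l * cmod (G \<alpha>)" for F G :: "'a fseries" and k l
        using norm_triangle_ineq[of "k * F \<alpha>" "l * G \<alpha>"] by (simp add: norm_mult)
      show "\<exists>B\<ge>0. \<forall>F\<in>wsp p s r. cmod (F \<alpha>) \<le> B * wnorm p s r F" for r
        using norm_le_wnorm[OF p] vartheta_pos[of "- r" s \<alpha>]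
        by (intro exI[of _ "vartheta (- r) s \<alpha>"]) (auto simp: mult.commute less_imp_le)
    qed
    fix G assume G: "G \<in> ?V"
    have "(\<lambda>\<alpha>. F \<alpha> + G \<alpha>) \<in> (\<Union>r\<in>R. wsp p s r)"
      using ind_carrier_lincomb[OF p, where F = F and G = G and R = R and s = s and k = 1 and l = 1] F G by simp
    moreover have "cmod (F \<alpha> + G \<alpha> - z) \<le> cmod (F \<alpha> - z) + cmod (G \<alpha>)"
      using norm_triangle_ineq[of "F \<alpha> - z" "G \<alpha>"] by (simp add: algebra_simps)
    ultimately show "(\<lambda>\<alpha>. F \<alpha> + G \<alpha>) \<in> {F \<in> (\<Union>r\<in>R. wsp p s r). cmod (F \<alpha> - z) < e}"
      using G by simp
  qed
qed blast

text \<open>Continuous coefficient functionals separate points, so limits are unique in the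
  targets.\<close>

lemma limitin_coord_unique:
  fixes Y :: "('d::finite) fseries topology"
  assumes coord: "\<And>\<alpha> z e. openin Y {F \<in> topspace Y. cmod (F \<alpha> - z) < e}"
    and lim: "limitin Y f G sequentially" "limitin Y f H sequentially"
  shows "G = H"
proof
  fix \<alpha>
  have "(\<lambda>n. f n \<alpha>) \<longlonglongrightarrow> L \<alpha>" if L: "limitin Y f L sequentially" for L
  proof (rule tendstoI)
    fix e :: real assume "0 < e"
    moreover have "L \<in> topspace Y" using L by (rule limitin_topspace)
    ultimately have "L \<in> {F \<in> topspace Y. cmod (F \<alpha> - L \<alpha>) < e}" by simp
    then have "\<forall>\<^sub>F n in sequentially. f n \<in> {F \<in> topspace Y. cmod (F \<alpha> - L \<alpha>) < e}"
      using L[unfolded limitin_def, THEN conjunct2, THEN spec, of "{F \<in> topspace Y. cmod (F \<alpha> - L \<alpha>) < e}"] coord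
      by blast
    then show "\<forall>\<^sub>F n in sequentially. dist (f n \<alpha>) (L \<alpha>) < e"
      by eventually_elim (simp add: dist_norm)
  qed
  from LIMSEQ_unique[OF this[OF lim(1)] this[OF lim(2)]] show "G \<alpha> = H \<alpha>" .
qed

lemma limitin_wtop_truncate:
  assumes p: "1 \<le> p" and s: "0 < s" and F: "F \<in> wsp p s r" and t: "t < r"
  shows "limitin (wtop p s t) (\<lambda>N. truncate N F) F sequentially"
  unfolding limitin_def topspace_wtop[OF p]
proof (intro conjI allI impI)
  show Ft: "F \<in> wsp p s t" using F wsp_antimono[OF p, of t r s] t by auto
  fix U assume "openin (wtop p s t) U \<and> F \<in> U"
  then obtain e where e: "e > 0" "\<And>G. G \<in> wsp p s t \<Longrightarrow> wnorm p s t (\<lambda>\<alpha>. F \<alpha> - G \<alpha>) < e \<Longrightarrow> G \<in> U"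
    using openin_wtopE[OF p, of s t U F] by blast
  have "\<forall>\<^sub>F N in sequentially. wnorm p s t (\<lambda>\<alpha>. F \<alpha> - truncate N F \<alpha>) < e"
    using order_tendstoD(2)[OF truncate_tendsto[OF p s F t] e(1)] .
  then show "\<forall>\<^sub>F N in sequentially. truncate N F \<in> U"
    by eventually_elim (rule e(2)[OF truncate_wsp[OF p Ft]])
qed

text \<open>Truncations converge only after the index is lowered, so the step r containing F is
  exchanged for a larger space with t < r. In the projective case the neighbourhood lives at r and F
  is used as an element of a smaller space with t > r. Both directions are provided by
  \<open>open_ray\<close>.\<close>

lemma limitin_ind_sp_truncate:
  assumes p: "1 \<le> p" and s: "0 < s" and R: "open_ray R" and F: "F \<in> topspace (ind_sp p s R)"
  shows "limitin (ind_sp p s R) (\<lambda>N. truncate N F) F sequentially"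
  unfolding limitin_def
proof (intro conjI allI impI F)
  obtain r where r: "r \<in> R" "F \<in> wsp p s r" using F unfolding topspace_ind_sp[OF p] by blast
  obtain t where t: "t \<in> R" "t < r" using R r unfolding open_ray_def by blast
  fix U assume U: "openin (ind_sp p s R) U \<and> F \<in> U"
  have lim: "limitin (wtop p s t) (\<lambda>N. truncate N F) F sequentially"
    by (rule limitin_wtop_truncate[OF p s r(2) t(2)])
  moreover have "openin (wtop p s t) (U \<inter> wsp p s t)"
    using openin_ind_sp_step[OF p _ t(1)] U by blast
  moreover have "F \<in> U \<inter> wsp p s t"
    using U limitin_topspace[OF lim] by (simp add: topspace_wtop[OF p])
  ultimately have "\<forall>\<^sub>F N in sequentially. truncate N F \<in> U \<inter> wsp p s t"
    unfolding limitin_def by blast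
  then show "\<forall>\<^sub>F N in sequentially. truncate N F \<in> U" by eventually_elim simp
qed

lemma limitin_topology_generated_by:
  assumes "l \<in> \<Union>S" "\<And>U. U \<in> S \<Longrightarrow> l \<in> U \<Longrightarrow> \<forall>\<^sub>F x in F. f x \<in> U"
  shows "limitin (topology_generated_by S) f l F"
  unfolding limitin_def topology_generated_by_topspace
proof (intro conjI allI impI assms(1))
  fix U assume "openin (topology_generated_by S) U \<and> l \<in> U"
  then have "generate_topology_on S U" "l \<in> U" by (auto simp: openin_topology_generated_by_iff)
  then show "\<forall>\<^sub>F x in F. f x \<in> U"
  proof (induction rule: generate_topology_on.induct)
    case (Int a b)
    then show ?case by (auto intro: eventually_conj)
  next
    case (UN K)
    then obtain k where "k \<in> K" "l \<in> k" by blast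
    then have "\<forall>\<^sub>F x in F. f x \<in> k" by (rule UN.IH)
    then show ?case by (rule eventually_mono) (use \<open>k \<in> K\<close> in blast)
  qed (use assms(2) in auto)
qed

lemma limitin_proj_sp_truncate:
  assumes p: "1 \<le> p" and s: "0 < s" and R: "open_ray R" and F: "F \<in> topspace (proj_sp p s R)"
  shows "limitin (proj_sp p s R) (\<lambda>N. truncate N F) F sequentially"
proof -
  have ne: "R \<noteq> {}" using R by (simp add: open_ray_def)
  have FW: "F \<in> wsp p s r" if "r \<in> R" for r using F that by (simp add: topspace_proj_sp[OF p ne])
  show ?thesis
    unfolding proj_sp_def projective_limit_topology_def topspace_wtop[OF p]
  proof (rule limitin_topology_generated_by)
    obtain r where r: "r \<in> R" using ne by blast
    show "F \<in> \<Union>{U \<inter> (\<Inter>r\<in>R. wsp p s r) |U r. r \<in> R \<and> openin (wtop p s r) U}"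
      using FW r openin_topspace[of "wtop p s r"] unfolding topspace_wtop[OF p] by blast
    fix U assume "U \<in> {U \<inter> (\<Inter>r\<in>R. wsp p s r) |U r. r \<in> R \<and> openin (wtop p s r) U}" and "F \<in> U"
    then obtain U' r where U: "U = U' \<inter> (\<Inter>r\<in>R. wsp p s r)" "r \<in> R" "openin (wtop p s r) U'" "F \<in> U'"
      by blast
    obtain t where t: "t \<in> R" "r < t" using R U(2) unfolding open_ray_def by blast
    have "\<forall>\<^sub>F N in sequentially. truncate N F \<in> U'"
      using limitin_wtop_truncate[OF p s FW[OF t(1)] t(2)] U(3,4) unfolding limitin_def by blast
    then show "\<forall>\<^sub>F N in sequentially. truncate N F \<in> U"
      by eventually_elim (use U truncate_wsp[OF p FW] in auto)
  qed
qed

text \<open>T factors through one pair of steps: projective limit, step r, step t, inductive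
  limit.\<close>

lemma continuous_map_proj_ind:
  fixes T :: "('d::finite) fseries \<Rightarrow> 'd fseries"
  assumes p: "1 \<le> p" and r: "r \<in> R" and t: "t \<in> R'"
    and lin: "linear_on_space (proj_sp p s R) T"
    and T: "\<And>F. F \<in> wsp p s r \<Longrightarrow> T F \<in> wsp p s t"
    and bound: "\<exists>B\<ge>0. \<forall>F\<in>wsp p s r. wnorm p s t (T F) \<le> B * wnorm p s r F"
  shows "continuous_map (proj_sp p s R) (ind_sp p s R') T"
  unfolding continuous_map_def
proof (intro conjI funcsetI allI impI)
  have ne: "R \<noteq> {}" using r by blast
  note X = topspace_proj_sp[OF p ne]
  show "T F \<in> topspace (ind_sp p s R')" if "F \<in> topspace (proj_sp p s R)" for F
    using that T r t by (auto simp: X topspace_ind_sp[OF p])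
  obtain B where B: "B \<ge> 0" "\<And>F. F \<in> wsp p s r \<Longrightarrow> wnorm p s t (T F) \<le> B * wnorm p s r F"
    using bound by blast
  fix U :: "'d fseries set" assume U: "openin (ind_sp p s R') U"
  let ?S = "{F \<in> topspace (proj_sp p s R). T F \<in> U}"
  show "openin (proj_sp p s R) ?S"
  proof (subst openin_subopen, intro ballI)
    fix F assume F: "F \<in> ?S"
    then have Fr: "F \<in> wsp p s r" using r by (simp add: X)
    have "T F \<in> U \<inter> wsp p s t" using F T[OF Fr] by simp
    then obtain e where e: "e > 0"
      "\<And>G. G \<in> wsp p s t \<Longrightarrow> wnorm p s t (\<lambda>\<alpha>. T F \<alpha> - G \<alpha>) < e \<Longrightarrow> G \<in> U \<inter> wsp p s t"
      using openin_wtopE[OF p openin_ind_sp_step[OF p U t]] by blast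
    let ?d = "e / (B + 1)"
    interpret Metric_space "weighted_lp p (vartheta r s) :: 'd fseries set" "weighted_lp_dist p (vartheta r s)"
      by (rule Metric_space_weighted_lp[OF p]) (simp add: vartheta_def)
    have dist: "weighted_lp_dist p (vartheta r s) F G = wnorm p s r (\<lambda>\<alpha>. F \<alpha> - G \<alpha>)" for G
      by (simp add: weighted_lp_dist_def wnorm_def)
    have ball: "openin (wtop p s r) (mball F ?d)"
      unfolding wtop_def weighted_lp_topology_def by (rule openin_mball)
    show "\<exists>W. openin (proj_sp p s R) W \<and> F \<in> W \<and> W \<subseteq> ?S"
    proof (intro exI conjI)
      show "openin (proj_sp p s R) (mball F ?d \<inter> (\<Inter>r\<in>R. wsp p s r))"
        by (rule openin_proj_sp_step[OF p ball r])
      show "F \<in> mball F ?d \<inter> (\<Inter>r\<in>R. wsp p s r)"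
        using F Fr e(1) B(1) by (simp add: X wsp_def)
      show "mball F ?d \<inter> (\<Inter>r\<in>R. wsp p s r) \<subseteq> ?S"
      proof
        fix G assume G: "G \<in> mball F ?d \<inter> (\<Inter>r\<in>R. wsp p s r)"
        then have GX: "G \<in> topspace (proj_sp p s R)" and Gr: "G \<in> wsp p s r"
          and d: "wnorm p s r (\<lambda>\<alpha>. F \<alpha> - G \<alpha>) < ?d"
          using r by (auto simp: X in_mball dist)
        have diff: "(\<lambda>\<alpha>. F \<alpha> - G \<alpha>) \<in> wsp p s r" using wsp_lincomb[OF p Fr Gr, of 1 "- 1"] by simp
        \<comment> \<open>Linearity is available only on the projective carrier, which is why the
          ball is intersected with it; the bound by B holds on the whole step.\<close>
        have "T (\<lambda>\<alpha>. 1 * F \<alpha> + (- 1) * G \<alpha>) = (\<lambda>\<alpha>. 1 * T F \<alpha> + (- 1) * T G \<alpha>)"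
          using lin F GX unfolding linear_on_space_def by blast
        then have "(\<lambda>\<alpha>. T F \<alpha> - T G \<alpha>) = T (\<lambda>\<alpha>. F \<alpha> - G \<alpha>)" by simp
        then have "wnorm p s t (\<lambda>\<alpha>. T F \<alpha> - T G \<alpha>) \<le> B * wnorm p s r (\<lambda>\<alpha>. F \<alpha> - G \<alpha>)"
          using B(2)[OF diff] by simp
        also have "\<dots> \<le> (B + 1) * wnorm p s r (\<lambda>\<alpha>. F \<alpha> - G \<alpha>)"
          by (intro mult_right_mono) (auto simp: wnorm_nonneg)
        also have "\<dots> < (B + 1) * ?d" using d B(1) by (intro mult_strict_left_mono) auto
        also have "\<dots> = e" using B(1) by simp
        finally have "T G \<in> U" using e(2)[OF T[OF Gr]] by simp
        with GX show "G \<in> ?S" by simp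
      qed
    qed
  qed
qed

text \<open>For each target index t the map G -> \<open>wnorm p s t (T G)\<close> is a seminorm
  bounded on every source step, so its balls are neighbourhoods of 0 in the inductive limit.\<close>

lemma continuous_map_ind_proj:
  fixes T :: "('d::finite) fseries \<Rightarrow> 'd fseries"
  assumes p: "1 \<le> p" and R': "R' \<noteq> {}"
    and lin: "linear_on_space (ind_sp p s R) T"
    and T: "\<And>r t F. r \<in> R \<Longrightarrow> t \<in> R' \<Longrightarrow> F \<in> wsp p s r \<Longrightarrow> T F \<in> wsp p s t"
    and bound: "\<And>r t. r \<in> R \<Longrightarrow> t \<in> R' \<Longrightarrow> \<exists>B\<ge>0. \<forall>F\<in>wsp p s r. wnorm p s t (T F) \<le> B * wnorm p s r F"
  shows "continuous_map (ind_sp p s R) (proj_sp p s R') T"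
  unfolding proj_sp_def projective_limit_topology_def topspace_wtop[OF p]
proof (rule continuous_on_generated_topo)
  note X = topspace_ind_sp[OF p]
  obtain t0 where t0: "t0 \<in> R'" using R' by blast
  have TX: "T F \<in> (\<Inter>r\<in>R'. wsp p s r)" if "F \<in> topspace (ind_sp p s R)" for F
    using that T by (auto simp: X)
  show "T ` topspace (ind_sp p s R) \<subseteq> \<Union>{U \<inter> (\<Inter>r\<in>R'. wsp p s r) |U r. r \<in> R' \<and> openin (wtop p s r) U}"
    using TX t0 openin_topspace[of "wtop p s t0"] unfolding topspace_wtop[OF p] by blast
  fix U :: "'d fseries set" assume "U \<in> {U \<inter> (\<Inter>r\<in>R'. wsp p s r) |U r. r \<in> R' \<and> openin (wtop p s r) U}"
  then obtain U' t where U: "U = U' \<inter> (\<Inter>r\<in>R'. wsp p s r)" and t: "t \<in> R'" and U': "openin (wtop p s t) U'"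
    by blast
  show "openin (ind_sp p s R) (T -` U \<inter> topspace (ind_sp p s R))"
    unfolding openin_ind_sp[OF p]
  proof (intro conjI ballI)
    show "T -` U \<inter> topspace (ind_sp p s R) \<subseteq> (\<Union>r\<in>R. wsp p s r)" by (auto simp: X)
    fix F assume F: "F \<in> T -` U \<inter> topspace (ind_sp p s R)"
    have "T F \<in> U'" using F U by simp
    then obtain e where e: "e > 0" "\<And>G. G \<in> wsp p s t \<Longrightarrow> wnorm p s t (\<lambda>\<alpha>. T F \<alpha> - G \<alpha>) < e \<Longrightarrow> G \<in> U'"
      using openin_wtopE[OF p U'] by blast
    let ?V = "{G \<in> (\<Union>r\<in>R. wsp p s r). wnorm p s t (T G) < e}"
    have Tt: "T G \<in> wsp p s t" if "G \<in> (\<Union>r\<in>R. wsp p s r)" for G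
      using that T t by blast
    have Tlin: "T (\<lambda>\<alpha>. k * G \<alpha> + l * H \<alpha>) = (\<lambda>\<alpha>. k * T G \<alpha> + l * T H \<alpha>)"
      if "G \<in> (\<Union>r\<in>R. wsp p s r)" "H \<in> (\<Union>r\<in>R. wsp p s r)" for G H k l
      using lin that unfolding linear_on_space_def X by blast
    show "\<exists>V. inductive_limit_nhd0 R (wtop p s) V \<and>
        (\<forall>G\<in>V. (\<lambda>\<alpha>. F \<alpha> + G \<alpha>) \<in> T -` U \<inter> topspace (ind_sp p s R))"
    proof (intro exI[of _ ?V] conjI ballI)
      show "inductive_limit_nhd0 R (wtop p s) ?V"
        by (rule seminorm_nhd0[OF p e(1)])
           (simp_all add: Tlin wnorm_lincomb_le[OF p Tt Tt] bound[OF _ t] del: UN_iff)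
      fix G assume G: "G \<in> ?V"
      have FX: "F \<in> (\<Union>r\<in>R. wsp p s r)" using F by (simp add: X)
      have FG: "(\<lambda>\<alpha>. F \<alpha> + G \<alpha>) \<in> (\<Union>r\<in>R. wsp p s r)"
        using ind_carrier_lincomb[OF p FX, where G = G and k = 1 and l = 1] G by simp
      have TFG: "T (\<lambda>\<alpha>. F \<alpha> + G \<alpha>) = (\<lambda>\<alpha>. T F \<alpha> + T G \<alpha>)"
        using Tlin[OF FX, of G 1 1] G by simp
      have "wnorm p s t (\<lambda>\<alpha>. - T G \<alpha>) \<le> wnorm p s t (T G)"
        using wnorm_dominated(2)[OF p Tt, of G 1 "\<lambda>\<alpha>. - T G \<alpha>" t] G by simp
      then have "wnorm p s t (\<lambda>\<alpha>. T F \<alpha> - T (\<lambda>\<alpha>. F \<alpha> + G \<alpha>) \<alpha>) < e"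
        using G by (simp add: TFG)
      then have "T (\<lambda>\<alpha>. F \<alpha> + G \<alpha>) \<in> U'" by (rule e(2)[OF Tt[OF FG]])
      then show "(\<lambda>\<alpha>. F \<alpha> + G \<alpha>) \<in> T -` U \<inter> topspace (ind_sp p s R)"
        using FG TX[of "\<lambda>\<alpha>. F \<alpha> + G \<alpha>"] by (simp add: U X)
    qed
  qed
qed

section \<open>Unique extendability\<close>

lemma uniquely_extendable_OpI:
  fixes T :: "('d::finite) fseries \<Rightarrow> 'd fseries"
  assumes lin: "linear_on_space X T" and cont: "continuous_map X Y T"
    and maps: "\<And>F. F \<in> A_zero \<Longrightarrow> Op_V_maps a F (T F)"
    and coord: "\<And>\<alpha> z e. openin Y {F \<in> topspace Y. cmod (F \<alpha> - z) < e}"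
    and dense: "\<And>F. F \<in> topspace X \<Longrightarrow> limitin X (\<lambda>N. truncate N F) F sequentially"
  shows "uniquely_extendable_Op a X Y"
  unfolding uniquely_extendable_Op_def
proof (intro exI[of _ T] conjI allI impI ballI)
  show "continuous_extension_Op a X Y T"
    using lin cont maps by (simp add: continuous_extension_Op_def)
  fix T' F assume T': "continuous_extension_Op a X Y T'" and F: "F \<in> topspace X"
  \<comment> \<open>Both values are power series of the same function
    \<open>Op_V a (series_fun (truncate N F))\<close>.\<close>
  have eq: "T' (truncate N F) = T (truncate N F)" for N
    using T' maps[OF truncate_A_zero] truncate_A_zero[of N F]
    unfolding continuous_extension_Op_def Op_V_maps_def
    by (intro is_series_of_unique[where f = "Op_V a (series_fun (truncate N F))"]) blast+
  have "limitin Y (T \<circ> (\<lambda>N. truncate N F)) (T F) sequentially"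
    by (rule continuous_map_limit[OF cont dense[OF F]])
  moreover have "limitin Y (T' \<circ> (\<lambda>N. truncate N F)) (T' F) sequentially"
    using T' by (intro continuous_map_limit[OF _ dense[OF F]]) (simp add: continuous_extension_Op_def)
  then have "limitin Y (T \<circ> (\<lambda>N. truncate N F)) (T' F) sequentially"
    by (simp add: o_def eq)
  ultimately show "T' F = T F" by (intro limitin_coord_unique[OF coord])
qed

lemma linear_on_space_matrix:
  assumes "\<And>F \<alpha>. F \<in> topspace X \<Longrightarrow> (\<lambda>\<beta>. c \<alpha> \<beta> * F \<beta>) summable_on UNIV"
  shows "linear_on_space X (\<lambda>F \<alpha>. \<Sum>\<^sub>\<infinity>\<beta>. c \<alpha> \<beta> * F \<beta>)"
  unfolding linear_on_space_def
proof (intro ballI allI ext)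
  fix F G and k l :: complex and \<alpha> assume F: "F \<in> topspace X" and G: "G \<in> topspace X"
  have "(\<Sum>\<^sub>\<infinity>\<beta>. c \<alpha> \<beta> * (k * F \<beta> + l * G \<beta>)) = (\<Sum>\<^sub>\<infinity>\<beta>. k * (c \<alpha> \<beta> * F \<beta>) + l * (c \<alpha> \<beta> * G \<beta>))"
    by (rule infsum_cong) (simp add: algebra_simps)
  also have "\<dots> = (\<Sum>\<^sub>\<infinity>\<beta>. k * (c \<alpha> \<beta> * F \<beta>)) + (\<Sum>\<^sub>\<infinity>\<beta>. l * (c \<alpha> \<beta> * G \<beta>))"
    by (intro infsum_add summable_on_cmult_right assms F G)
  also have "\<dots> = k * (\<Sum>\<^sub>\<infinity>\<beta>. c \<alpha> \<beta> * F \<beta>) + l * (\<Sum>\<^sub>\<infinity>\<beta>. c \<alpha> \<beta> * G \<beta>)"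
    by (simp only: infsum_cmult_right')
  finally show "(\<Sum>\<^sub>\<infinity>\<beta>. c \<alpha> \<beta> * (k * F \<beta> + l * G \<beta>)) =
      k * (\<Sum>\<^sub>\<infinity>\<beta>. c \<alpha> \<beta> * F \<beta>) + l * (\<Sum>\<^sub>\<infinity>\<beta>. c \<alpha> \<beta> * G \<beta>)" .
qed

section \<open>From coefficient bounds to extensions\<close>

definition coeffs_bounded :: "real \<Rightarrow> (nat ^ 'd \<Rightarrow> nat ^ 'd \<Rightarrow> complex) \<Rightarrow> real \<Rightarrow> bool" where
  "coeffs_bounded s c \<mu> \<longleftrightarrow>
    (\<exists>C\<ge>0. \<forall>\<alpha> \<beta>. cmod (c \<alpha> \<beta>) \<le> C * vartheta \<mu> s \<alpha> * vartheta \<mu> s (\<beta> :: nat ^ 'd::finite))"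

text \<open>exp (ln (5/4) / 2) = sqrt (5/4) is the largest growth rate that
  \<open>Op_V_maps_A_zero\<close> accepts; the constant D absorbs the passage from the weight to a
  pure exponential.\<close>

lemma Op_V_maps_coeffs:
  fixes c :: "nat ^ 'd::finite \<Rightarrow> nat ^ 'd \<Rightarrow> complex"
  assumes K: "\<And>z w. ((\<lambda>(\<alpha>, \<beta>). c \<alpha> \<beta> * e_basis \<alpha> z * cnj (e_basis \<beta> w)) has_sum Op_kernel a z w) UNIV"
    and c: "coeffs_bounded s c \<mu>" and D: "D \<ge> 0" "\<And>\<alpha>::nat ^ 'd. vartheta \<mu> s \<alpha> \<le> D * exp (ln (5 / 4) / 2 * mabs \<alpha>)"
    and F: "F \<in> A_zero"
  shows "Op_V_maps a F (\<lambda>\<alpha>. \<Sum>\<^sub>\<infinity>\<beta>. c \<alpha> \<beta> * F \<beta>)"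
proof -
  obtain C where C: "C \<ge> 0" "\<And>\<alpha> \<beta>. cmod (c \<alpha> \<beta>) \<le> C * vartheta \<mu> s \<alpha> * vartheta \<mu> s \<beta>"
    using c unfolding coeffs_bounded_def by blast
  have \<delta>: "exp (ln (5 / 4) / 2 :: real) \<le> sqrt (5 / 4)"
    by (simp add: real_le_rsqrt flip: exp_double)
  have "cmod (c \<alpha> \<beta>) \<le> (C * D * D) * exp (ln (5 / 4) / 2 * mabs \<alpha>) * exp (ln (5 / 4) / 2 * mabs \<beta>)" for \<alpha> \<beta>
  proof -
    have "C * vartheta \<mu> s \<alpha> * vartheta \<mu> s \<beta> \<le>
        C * (D * exp (ln (5 / 4) / 2 * mabs \<alpha>)) * (D * exp (ln (5 / 4) / 2 * mabs \<beta>))"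
      using C(1) D less_imp_le[OF vartheta_pos] by (intro mult_mono mult_left_mono) auto
    with C(2)[of \<alpha> \<beta>] show ?thesis by (simp add: mult_ac)
  qed
  from Op_V_maps_A_zero[OF \<delta> this K[unfolded Op_kernel_def] F] show ?thesis .
qed

lemma extendable_proj_ind:
  fixes c :: "nat ^ 'd::finite \<Rightarrow> nat ^ 'd \<Rightarrow> complex"
  assumes p: "1 \<le> p" and s: "0 < s" and R: "open_ray R"
    and maps: "\<And>F. F \<in> A_zero \<Longrightarrow> Op_V_maps a F (\<lambda>\<alpha>. \<Sum>\<^sub>\<infinity>\<beta>. c \<alpha> \<beta> * F \<beta>)"
    and c: "coeffs_bounded s c \<mu>" and r: "r \<in> R" "\<mu> < r" and t: "t \<in> R'" "\<mu> + t < 0"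
  shows "uniquely_extendable_Op a (proj_sp p s R) (ind_sp p s R')"
proof -
  let ?T = "\<lambda>F \<alpha>. \<Sum>\<^sub>\<infinity>\<beta>. c \<alpha> \<beta> * F \<beta>"
  obtain C where C: "C \<ge> 0" "\<And>\<alpha> \<beta>. cmod (c \<alpha> \<beta>) \<le> C * vartheta \<mu> s \<alpha> * vartheta \<mu> s \<beta>"
    using c unfolding coeffs_bounded_def by blast
  note op = bounded_matrix_operator[OF p s C r(2) t(2)]
  have ne: "R \<noteq> {}" using r by blast
  have lin: "linear_on_space (proj_sp p s R) ?T"
    by (rule linear_on_space_matrix, rule op(1)) (use r in \<open>simp add: topspace_proj_sp[OF p ne]\<close>)
  show ?thesis
  proof (rule uniquely_extendable_OpI[OF lin _ maps])
    show "continuous_map (proj_sp p s R) (ind_sp p s R') ?T"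
      by (rule continuous_map_proj_ind[OF p r(1) t(1) lin op(2,3)])
    show "openin (ind_sp p s R') {F \<in> topspace (ind_sp p s R'). cmod (F \<alpha> - z) < e}"
      for \<alpha> :: "nat ^ 'd" and z e
      by (rule openin_ind_sp_coord[OF p])
    show "limitin (proj_sp p s R) (\<lambda>N. truncate N F) F sequentially"
      if "F \<in> topspace (proj_sp p s R)" for F :: "'d fseries"
      by (rule limitin_proj_sp_truncate[OF p s R that])
  qed
qed

text \<open>The rate \<mu> may vary with the pair of steps while the matrix stays the same, so the
  resulting bounds all concern a single operator.\<close>

lemma extendable_ind_proj:
  fixes c :: "nat ^ 'd::finite \<Rightarrow> nat ^ 'd \<Rightarrow> complex"
  assumes p: "1 \<le> p" and s: "0 < s" and R: "open_ray R" and R': "R' \<noteq> {}"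
    and maps: "\<And>F. F \<in> A_zero \<Longrightarrow> Op_V_maps a F (\<lambda>\<alpha>. \<Sum>\<^sub>\<infinity>\<beta>. c \<alpha> \<beta> * F \<beta>)"
    and c: "\<And>r t. r \<in> R \<Longrightarrow> t \<in> R' \<Longrightarrow> \<exists>\<mu>. coeffs_bounded s c \<mu> \<and> \<mu> < r \<and> \<mu> + t < 0"
  shows "uniquely_extendable_Op a (ind_sp p s R) (proj_sp p s R')"
proof -
  let ?T = "\<lambda>F \<alpha>. \<Sum>\<^sub>\<infinity>\<beta>. c \<alpha> \<beta> * F \<beta>"
  have op: "(\<forall>F\<in>wsp p s r. \<forall>\<alpha>. (\<lambda>\<beta>. c \<alpha> \<beta> * F \<beta>) summable_on UNIV) \<and>
      (\<forall>F\<in>wsp p s r. ?T F \<in> wsp p s t) \<and>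
      (\<exists>B\<ge>0. \<forall>F\<in>wsp p s r. wnorm p s t (?T F) \<le> B * wnorm p s r F)"
    if rt: "r \<in> R" "t \<in> R'" for r t
  proof -
    obtain \<mu> where \<mu>: "coeffs_bounded s c \<mu>" "\<mu> < r" "\<mu> + t < 0" using c[OF rt] by blast
    obtain C where C: "C \<ge> 0" "\<And>\<alpha> \<beta>. cmod (c \<alpha> \<beta>) \<le> C * vartheta \<mu> s \<alpha> * vartheta \<mu> s \<beta>"
      using \<mu>(1) unfolding coeffs_bounded_def by blast
    note o = bounded_matrix_operator[OF p s C \<mu>(2,3)]
    show ?thesis by (intro conjI ballI allI o)
  qed
  obtain t0 where t0: "t0 \<in> R'" using R' by blast
  have lin: "linear_on_space (ind_sp p s R) ?T"
    by (rule linear_on_space_matrix) (use op[OF _ t0] in \<open>auto simp: topspace_ind_sp[OF p]\<close>)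
  show ?thesis
  proof (rule uniquely_extendable_OpI[OF lin _ maps])
    show "continuous_map (ind_sp p s R) (proj_sp p s R') ?T"
      by (rule continuous_map_ind_proj[OF p R' lin]) (use op in blast)+
    show "openin (proj_sp p s R') {F \<in> topspace (proj_sp p s R'). cmod (F \<alpha> - z) < e}"
      for \<alpha> :: "nat ^ 'd" and z e
      by (rule openin_proj_sp_coord[OF p R'])
    show "limitin (ind_sp p s R) (\<lambda>N. truncate N F) F sequentially"
      if "F \<in> topspace (ind_sp p s R)" for F :: "'d fseries"
      by (rule limitin_ind_sp_truncate[OF p s R that])
  qed
qed

text \<open>|\<alpha>| is 0 or at least 1, so an exponent 1/(2s) \<le> 1 does not enlarge
  it.\<close>

lemma vartheta_le_exp_small:
  assumes "1 / 2 \<le> s" "\<mu> \<le> \<delta>" "0 \<le> \<delta>"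
  shows "vartheta \<mu> s \<alpha> \<le> exp (\<delta> * mabs \<alpha>)"
proof -
  have "real (mabs \<alpha>) powr (1 / (2 * s)) \<le> real (mabs \<alpha>)"
  proof (cases "mabs \<alpha> = 0")
    case False
    then show ?thesis using powr_mono[of "1 / (2 * s)" 1 "real (mabs \<alpha>)"] assms(1) by simp
  qed simp
  then have "\<mu> * real (mabs \<alpha>) powr (1 / (2 * s)) \<le> \<delta> * real (mabs \<alpha>)"
    using assms by (intro mult_mono) auto
  then show ?thesis by (simp add: vartheta_def)
qed

text \<open>For s > 1/2 the exponent 1/(2s) is below 1, so the linear term wins however large \<mu>
  and however small \<delta> are.\<close>

lemma vartheta_le_exp:
  fixes s \<mu> \<delta> :: real
  assumes "1 / 2 < s" "0 < \<mu>" "0 < \<delta>"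
  shows "\<exists>D\<ge>0. \<forall>\<alpha>. vartheta \<mu> s \<alpha> \<le> D * exp (\<delta> * mabs \<alpha>)"
proof -
  define \<kappa> where "\<kappa> = 1 / (2 * s)"
  have \<kappa>: "0 < \<kappa>" "\<kappa> < 1" using assms by (simp_all add: \<kappa>_def)
  have "(\<lambda>n. exp (\<mu> * real n powr \<kappa> - \<delta> * real n)) \<longlonglongrightarrow> 0"
    using assms \<kappa> by real_asymp
  then have "Bseq (\<lambda>n. exp (\<mu> * real n powr \<kappa> - \<delta> * real n))"
    by (intro convergent_imp_Bseq) (auto simp: convergent_def)
  then obtain D where "D > 0" and D: "\<And>n. norm (exp (\<mu> * real n powr \<kappa> - \<delta> * real n)) \<le> D"
    by (auto elim: BseqE)
  have "vartheta \<mu> s \<alpha> \<le> D * exp (\<delta> * mabs \<alpha>)" for \<alpha>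
    using D[of "mabs \<alpha>"] by (simp add: exp_diff pos_divide_le_eq vartheta_def \<kappa>_def)
  with \<open>D > 0\<close> show ?thesis by (intro exI[of _ D]) auto
qed

theorem theorem3p10:
  fixes s :: real and p :: ereal
    and a :: "complex ^ 'd::finite \<Rightarrow> complex ^ 'd \<Rightarrow> complex"
  assumes "1 \<le> p" and "a \<in> A_tilde"
  shows
    "(s \<ge> 1/2 \<longrightarrow>
       ((\<exists>r>0. lesssim a (\<lambda>z w.
            exp (1/2 * (norm (z - w))\<^sup>2 - r * (norm z powr (1/s) + norm w powr (1/s)))))
         \<longrightarrow> uniquely_extendable_Op a (A_s_dual p s) (A_s p s)) \<and>
       ((\<forall>r>0. lesssim a (\<lambda>z w.
            exp (1/2 * (norm (z - w))\<^sup>2 + r * (norm z powr (1/s) + norm w powr (1/s)))))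
         \<longrightarrow> uniquely_extendable_Op a (A_s p s) (A_s_dual p s)))
     \<and>
     (s > 1/2 \<longrightarrow>
       ((\<forall>r>0. lesssim a (\<lambda>z w.
            exp (1/2 * (norm (z - w))\<^sup>2 - r * (norm z powr (1/s) + norm w powr (1/s)))))
         \<longrightarrow> uniquely_extendable_Op a (A_0s_dual p s) (A_0s p s)) \<and>
       ((\<exists>r>0. lesssim a (\<lambda>z w.
            exp (1/2 * (norm (z - w))\<^sup>2 + r * (norm z powr (1/s) + norm w powr (1/s)))))
         \<longrightarrow> uniquely_extendable_Op a (A_0s p s) (A_0s_dual p s)))"
proof -
  note p = assms(1)
  obtain c where K: "\<And>z w. ((\<lambda>(\<alpha>, \<beta>). c \<alpha> \<beta> * e_basis \<alpha> z * cnj (e_basis \<beta> w)) has_sum Op_kernel a z w) UNIV"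
    and cauchy: "cauchy_coeffs a c"
    using kernel_expansion[OF assms(2)] by blast
  \<comment> \<open>A signed rate m treats decay and growth together.\<close>
  define L where "L m \<longleftrightarrow> lesssim a (\<lambda>z w. exp (1/2 * (norm (z - w))\<^sup>2 + m * (norm z powr (1/s) + norm w powr (1/s))))" for m
  have minus: "lesssim a (\<lambda>z w. exp (1/2 * (norm (z - w))\<^sup>2 - r * (norm z powr (1/s) + norm w powr (1/s)))) \<longleftrightarrow> L (- r)"
    and plus: "lesssim a (\<lambda>z w. exp (1/2 * (norm (z - w))\<^sup>2 + r * (norm z powr (1/s) + norm w powr (1/s)))) \<longleftrightarrow> L r" for r
    by (simp_all add: L_def)
  \<comment> \<open>The gap \<mu> - m is the \<epsilon> of the coefficient estimate.\<close>
  have bounded: "coeffs_bounded s c \<mu>" if "0 < s" "L m" "m < \<mu>" for m \<mu>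
  proof -
    obtain C where "\<And>z w. cmod (a z w) \<le> C * exp (1/2 * (norm (z - w))\<^sup>2 + m * (norm z powr (1/s) + norm w powr (1/s)))"
      using \<open>L m\<close> unfolding L_def lesssim_def by blast
    from kernel_coeff_bound[OF cauchy this \<open>0 < s\<close>, of "\<mu> - m"] show ?thesis
      using \<open>m < \<mu>\<close> by (simp add: coeffs_bounded_def)
  qed
  have ln: "0 < ln (5 / 4) / (2::real)" by simp
  have maps: "Op_V_maps a F (\<lambda>\<alpha>. \<Sum>\<^sub>\<infinity>\<beta>. c \<alpha> \<beta> * F \<beta>)"
    if "1 / 2 \<le> s" "coeffs_bounded s c \<mu>" "\<mu> \<le> ln (5 / 4) / 2" "F \<in> A_zero" for \<mu> F
    using vartheta_le_exp_small[OF that(1,3)] ln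
    by (intro Op_V_maps_coeffs[OF K that(2), of 1] that(4)) auto
  show ?thesis
    unfolding minus plus A_spaces_eq
  proof (intro conjI impI)
    assume s: "1 / 2 \<le> s" and "\<exists>r>0. L (- r)"
    then obtain r where r: "r > 0" "L (- r)" by blast
    \<comment> \<open>Half of the decay pays for \<epsilon>; the source index -r/4 and the target
      index r/4 then leave strict gaps on both sides.\<close>
    have c: "coeffs_bounded s c (- r / 2)" by (rule bounded[OF _ r(2)]) (use s r in auto)
    show "uniquely_extendable_Op a (proj_sp p s {..<0}) (ind_sp p s {0<..})"
    proof (rule extendable_proj_ind[OF p _ open_ray_neg maps[OF s c] c])
      show "- r / 2 \<le> ln (5 / 4) / 2" using r ln by linarith
      show "- r / 4 \<in> {..<0}" "- r / 2 < - r / 4" "r / 4 \<in> {0<..}" "- r / 2 + r / 4 < 0"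
        using r by auto
    qed (use s in auto)
  next
    assume s: "1 / 2 \<le> s" and L: "\<forall>r>0. L r"
    have c: "coeffs_bounded s c \<mu>" if "0 < \<mu>" for \<mu>
      by (rule bounded[of "\<mu> / 2"]) (use s L that in auto)
    show "uniquely_extendable_Op a (ind_sp p s {0<..}) (proj_sp p s {..<0})"
    \<comment> \<open>Agreement with the integral operator is a property of the matrix alone and
      uses the single rate ln (5/4) / 2; continuity uses a rate adapted to each pair (r, t),
      positive and below both r and -t.\<close>
    proof (rule extendable_ind_proj[OF p _ open_ray_pos _ maps[OF s c[OF ln] order_refl]])
      fix r t :: real assume "r \<in> {0<..}" "t \<in> {..<0}"
      then show "\<exists>\<mu>. coeffs_bounded s c \<mu> \<and> \<mu> < r \<and> \<mu> + t < 0"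
        by (intro exI[of _ "min r (- t) / 2"] conjI c) (auto simp: min_def)
    qed (use s open_ray_neg in \<open>auto simp: open_ray_def\<close>)
  next
    assume s: "1 / 2 < s" and L: "\<forall>r>0. L (- r)"
    \<comment> \<open>Arbitrarily fast decay makes every real \<mu> available, since -(|\<mu>| + 1)
      < \<mu>.\<close>
    have c: "coeffs_bounded s c \<mu>" for \<mu>
    proof (rule bounded)
      show "L (- (\<bar>\<mu>\<bar> + 1))" by (rule L[rule_format]) simp
    qed (use s in auto)
    show "uniquely_extendable_Op a (ind_sp p s {..<0}) (proj_sp p s {0<..})"
    proof (rule extendable_ind_proj[OF p _ open_ray_neg _ maps[OF less_imp_le[OF s] c order_refl]])
      fix r t :: real
      show "\<exists>\<mu>. coeffs_bounded s c \<mu> \<and> \<mu> < r \<and> \<mu> + t < 0"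
        by (intro exI[of _ "min r (- t) - 1"] conjI c) (auto simp: min_def)
    qed (use s open_ray_pos in \<open>auto simp: open_ray_def\<close>)
  next
    assume s: "1 / 2 < s" and "\<exists>r>0. L r"
    then obtain r where r: "r > 0" "L r" by blast
    have c: "coeffs_bounded s c (r + 1)" by (rule bounded[OF _ r(2)]) (use s in auto)
    \<comment> \<open>The rate r + 1 may exceed ln (5/4) / 2, so sublinearity of the exponent, that
      is s > 1/2, is used to restore the growth condition of the Gaussian integral.\<close>
    obtain D where D: "D \<ge> 0" "\<And>\<alpha>::nat ^ 'd. vartheta (r + 1) s \<alpha> \<le> D * exp (ln (5 / 4) / 2 * mabs \<alpha>)"
      using vartheta_le_exp[OF s _ ln, of "r + 1"] r by auto
    show "uniquely_extendable_Op a (proj_sp p s {0<..}) (ind_sp p s {..<0})"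
      by (rule extendable_proj_ind[OF p _ open_ray_pos Op_V_maps_coeffs[OF K c D] c, of "r + 2" "- (r + 2)"])
         (use s r in auto)
  qed
qed

end
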